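(* Let $\mathbb F$ be a field of characteristic $\neq 2$ and let $A$ be a weak PAJ over $\mathbb F$ which is generated (as an algebra) by a homogeneous set $X$ of special axes. Then $A$ admits a Frobenius form $(\cdot,\cdot)$ which satisfies $(a,y)=\varphi_a(y)$, and hence $(a,a)=1$, for all axes $a\in \operatorname{Cl}(X)$ and all $y\in A$. Furthermore $(xy,z)=(yx,z)$ for all $x,y,z\in A$.
   Context: Throughout, $A$ is an algebra (not necessarily commutative or associative) over a field $\mathbb F$ of characteristic $\ne 2$. $\langle\langle Y\rangle\rangle$ denotes the subalgebra generated by $Y$. For $y\in A$: $L_y(z)=yz$, $R_y(z)=zy$; $A_{\mu,\nu}(y)=\{z\in A: yz=\mu z,\ zy=\nu z\}$ and $A_\mu(y)=A_{\mu,\mu}(y)$. An axis $a\in A$ is a (nonzero) idempotent such that $A$ is the direct sum of the eigenspaces of $L_a$, $A$ is the direct sum of the eigenspaces of $R_a$, and $L_aR_a=R_aL_a$. Let $S_L(a)$, $S_R(a)$ be the sets of eigenvalues of $L_a$, $R_a$, and $S(a)=(S_L(a)\times S_R(a))\setminus\{(0,0),(1,1)\}$ (when $a$ is understood write $S=S(a)$). Then $A=A_1(a)\oplus A_0(a)\oplus\bigoplus_{(\mu,\nu)\in S}A_{\mu,\nu}(a)$. Put $S^\circ(a)=\{(\mu,\nu)\in S(a): A_{\mu,\nu}(a)\neq 0\}$ and $\tilde S^\circ(a)=\{(\nu,\mu):(\mu,\nu)\in S^\circ(a)\}$. The axis $a$ satisfies the fusion rules if: (a) $A_1(a)+A_0(a)$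 is a subalgebra; (b) for $(\mu,\nu)\in S$, $A_{\mu,\nu}(a)$ is closed under left and right multiplication by $A_1(a)+A_0(a)$; (c) for $(\mu,\nu),(\mu',\nu')\in S$, $A_{\mu,\nu}(a)A_{\mu',\nu'}(a)\subseteq A_1(a)+A_0(a)$ if $(\mu,\nu)=(\mu',\nu')$, and $A_{\mu,\nu}(a)A_{\mu',\nu'}(a)=0$ otherwise. An axis $a$ is of Jordan type if it satisfies the fusion rules and $A_0(a)^2\subseteq A_0(a)$. It is weakly primitive if $A_1(a)=\mathbb F a$; in this case $\varphi_a(y)\in\mathbb F$ (for $y\in A$) is defined by: $\varphi_a(y)a$ is the component of $y$ in $A_1(a)$ in the decomposition $A=A_1(a)\oplus A_0(a)\oplus\bigoplus_{(\mu,\nu)\in S(a)}A_{\mu,\nu}(a)$. It is special if it is weakly primitive, satisfies the fusion rules, and for every idempotent $b\in A$ the subalgebra $B=\langle\langle a,b\rangle\rangle$ satisfies $\dim B_0(a)\le 1$. $A$ is a weak PAJ if $A=\langle\langle Y\rangle\rangle$ for some set $Y$ of weakly primitive axes of Jordan type. A set $X$ of axes is homogeneous if for all $b,c\in X$, $S^\circ(b)=S^\circ(c)$ or $S^\circ(b)=\tilde S^\circ(c)$. For an axis $a$ and $S'\subseteq S(a)$, the Miyamoto map $\tau_{a;S'}:A\to A$ is the linear map that is $-1$ on $A_{\mu,\nu}(a)$ for $(\mu,\nu)\in S'$ and $+1$ on $A_1(a)$, $A_0(a)$ and $A_{\mu,\nu}(a)$ for $(\mu,\nu)\in S\setminus S'$;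 if $a$ satisfies the fusion rules it is an algebra automorphism. For a set $X$ of axes satisfying the fusion rules, $\mathcal G(X)$ is the group of automorphisms of $A$ generated by all $\tau_{x;S'}$, $x\in X$, $S'\subseteq S(x)$, and $\operatorname{Cl}(X)=\{\tau(x):x\in X,\ \tau\in\mathcal G(X)\}$. A Frobenius form on an algebra is a symmetric bilinear form with $(xy,z)=(x,yz)$ for all $x,y,z$. *)

theory Defs
  imports Complex_Main "HOL-Algebra.Generated_Groups"
begin

section \<open>Internal direct sums\<close>

definition is_decomposition ::
    "'i set \<Rightarrow> ('i \<Rightarrow> 'a::ab_group_add set) \<Rightarrow> 'a \<Rightarrow> ('i \<Rightarrow> 'a) \<Rightarrow> bool" where
  "is_decomposition I V x f \<longleftrightarrow>
     (\<forall>i\<in>I. f i \<in> V i) \<and> (\<forall>i. i \<notin> I \<longrightarrow> f i = 0) \<and> finite {i. f i \<noteq> 0} \<and>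
     x = (\<Sum>i | f i \<noteq> 0. f i)"

text \<open>The whole type is the internal direct sum of the family \<open>V\<close> over the (possibly
  infinite) index set \<open>I\<close>.\<close>

definition is_direct_sum :: "'i set \<Rightarrow> ('i \<Rightarrow> 'a::ab_group_add set) \<Rightarrow> bool" where
  "is_direct_sum I V \<longleftrightarrow> (\<forall>x. \<exists>!f. is_decomposition I V x f)"

text \<open>The component of \<open>x\<close> in \<open>V i\<close>; only meaningful if \<^term>\<open>is_direct_sum I V\<close>.\<close>

definition dcomponent ::
    "'i set \<Rightarrow> ('i \<Rightarrow> 'a::ab_group_add set) \<Rightarrow> 'a \<Rightarrow> 'i \<Rightarrow> 'a" where
  "dcomponent I V x = (THE f. is_decomposition I V x f)"


section \<open>Nonassociative algebras\<close>

text \<open>The underlying vector space of the algebra is the whole type \<^typ>\<open>'a\<close>; the product is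
  bilinear, with no associativity, commutativity or unit.\<close>

locale nonassoc_algebra = vector_space scale
  for scale :: "'f::field \<Rightarrow> 'a::ab_group_add \<Rightarrow> 'a" (infixr \<open>*s\<close> 75) +
  fixes mul :: "'a \<Rightarrow> 'a \<Rightarrow> 'a" (infixl \<open>\<cdot>\<close> 77)
  assumes linear_mul_left: "Vector_Spaces.linear scale scale (\<lambda>z. y \<cdot> z)"
    and linear_mul_right: "Vector_Spaces.linear scale scale (\<lambda>z. z \<cdot> y)"
begin

definition subalgebra :: "'a set \<Rightarrow> bool" where
  "subalgebra B \<longleftrightarrow> subspace B \<and> (\<forall>x\<in>B. \<forall>y\<in>B. x \<cdot> y \<in> B)"

definition generated_subalgebra :: "'a set \<Rightarrow> 'a set" where
  "generated_subalgebra Y = subalgebra hull Y"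

definition idempotent :: "'a \<Rightarrow> bool" where
  "idempotent a \<longleftrightarrow> a \<cdot> a = a"

definition left_mul :: "'a \<Rightarrow> 'a \<Rightarrow> 'a" where
  "left_mul y = (\<lambda>z. y \<cdot> z)"

definition right_mul :: "'a \<Rightarrow> 'a \<Rightarrow> 'a" where
  "right_mul y = (\<lambda>z. z \<cdot> y)"

definition eigenspace :: "('a \<Rightarrow> 'a) \<Rightarrow> 'f \<Rightarrow> 'a set" where
  "eigenspace T \<mu> = {z. T z = \<mu> *s z}"

definition eigenvalues :: "('a \<Rightarrow> 'a) \<Rightarrow> 'f set" where
  "eigenvalues T = {\<mu>. \<exists>z. z \<noteq> 0 \<and> z \<in> eigenspace T \<mu>}"

text \<open>\<open>eig2 y (\<mu>, \<nu>)\<close> is the two-sided eigenspace \<open>A\<^bsub>\<mu>,\<nu>\<^esub>(y)\<close>, and \<open>eig y \<mu>\<close> is \<open>A\<^sub>\<mu>(y)\<close>.\<close>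

definition eig2 :: "'a \<Rightarrow> 'f \<times> 'f \<Rightarrow> 'a set" where
  "eig2 y = (\<lambda>(\<mu>, \<nu>). {z. y \<cdot> z = \<mu> *s z \<and> z \<cdot> y = \<nu> *s z})"

definition eig :: "'a \<Rightarrow> 'f \<Rightarrow> 'a set" where
  "eig y \<mu> = eig2 y (\<mu>, \<mu>)"

definition eig01 :: "'a \<Rightarrow> 'a set" where
  "eig01 a = {x + y |x y. x \<in> eig a 1 \<and> y \<in> eig a 0}"


subsection \<open>Axes\<close>

definition axis :: "'a \<Rightarrow> bool" where
  "axis a \<longleftrightarrow> a \<noteq> 0 \<and> idempotent a \<and>
     is_direct_sum (eigenvalues (left_mul a)) (eigenspace (left_mul a)) \<and>
     is_direct_sum (eigenvalues (right_mul a)) (eigenspace (right_mul a)) \<and>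
     left_mul a \<circ> right_mul a = right_mul a \<circ> left_mul a"

definition S_L :: "'a \<Rightarrow> 'f set" where
  "S_L a = eigenvalues (left_mul a)"

definition S_R :: "'a \<Rightarrow> 'f set" where
  "S_R a = eigenvalues (right_mul a)"

definition S :: "'a \<Rightarrow> ('f \<times> 'f) set" where
  "S a = (S_L a \<times> S_R a) - {(0, 0), (1, 1)}"

definition S_circ :: "'a \<Rightarrow> ('f \<times> 'f) set" where
  "S_circ a = {p \<in> S a. eig2 a p \<noteq> {0}}"

definition S_circ_tilde :: "'a \<Rightarrow> ('f \<times> 'f) set" where
  "S_circ_tilde a = {(\<nu>, \<mu>) |\<mu> \<nu>. (\<mu>, \<nu>) \<in> S_circ a}"

text \<open>The component of \<open>y\<close> in \<open>A\<^sub>p(a)\<close> with respect to the decomposition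
  \<open>A = A\<^sub>1(a) \<oplus> A\<^sub>0(a) \<oplus> (\<Oplus>p \<in> S(a). A\<^sub>p(a))\<close> of the algebra given by an axis \<open>a\<close>.\<close>

definition component :: "'a \<Rightarrow> 'a \<Rightarrow> 'f \<times> 'f \<Rightarrow> 'a" where
  "component a y = dcomponent ({(1, 1), (0, 0)} \<union> S a) (eig2 a) y"

definition fusion_rules :: "'a \<Rightarrow> bool" where
  "fusion_rules a \<longleftrightarrow>
     subalgebra (eig01 a) \<and>
     (\<forall>p\<in>S a. \<forall>x\<in>eig01 a. \<forall>y\<in>eig2 a p. x \<cdot> y \<in> eig2 a p \<and> y \<cdot> x \<in> eig2 a p) \<and>
     (\<forall>p\<in>S a. \<forall>q\<in>S a. \<forall>x\<in>eig2 a p. \<forall>y\<in>eig2 a q.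
        if p = q then x \<cdot> y \<in> eig01 a else x \<cdot> y = 0)"

definition jordan_type :: "'a \<Rightarrow> bool" where
  "jordan_type a \<longleftrightarrow> axis a \<and> fusion_rules a \<and> (\<forall>x\<in>eig a 0. \<forall>y\<in>eig a 0. x \<cdot> y \<in> eig a 0)"

definition weakly_primitive :: "'a \<Rightarrow> bool" where
  "weakly_primitive a \<longleftrightarrow> axis a \<and> eig a 1 = range (\<lambda>c. c *s a)"

definition phi :: "'a \<Rightarrow> 'a \<Rightarrow> 'f" where
  "phi a y = (THE c. c *s a = component a y (1, 1))"

text \<open>Spelled out with finite generation because \<^const>\<open>dim\<close> is \<open>0\<close> on
  infinite-dimensional subspaces.\<close>

definition dim_le :: "'a set \<Rightarrow> nat \<Rightarrow> bool" where
  "dim_le V n \<longleftrightarrow> (\<exists>D. finite D \<and> V \<subseteq> span D) \<and> dim V \<le> n"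

definition special :: "'a \<Rightarrow> bool" where
  "special a \<longleftrightarrow> weakly_primitive a \<and> fusion_rules a \<and>
     (\<forall>b. idempotent b \<longrightarrow> dim_le (generated_subalgebra {a, b} \<inter> eig a 0) 1)"

definition weak_PAJ :: bool where
  "weak_PAJ \<longleftrightarrow>
     (\<exists>Y. (\<forall>y\<in>Y. weakly_primitive y \<and> jordan_type y) \<and> generated_subalgebra Y = UNIV)"

definition homogeneous :: "'a set \<Rightarrow> bool" where
  "homogeneous X \<longleftrightarrow> (\<forall>x\<in>X. axis x) \<and>
     (\<forall>b\<in>X. \<forall>c\<in>X. S_circ b = S_circ c \<or> S_circ b = S_circ_tilde c)"


subsection \<open>Miyamoto maps and the closure of a set of axes\<close>

definition miyamoto :: "'a \<Rightarrow> ('f \<times> 'f) set \<Rightarrow> 'a \<Rightarrow> 'a" where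
  "miyamoto a S' y =
     (\<Sum>p | component a y p \<noteq> 0. if p \<in> S' then - component a y p else component a y p)"

definition algebra_automorphism :: "('a \<Rightarrow> 'a) \<Rightarrow> bool" where
  "algebra_automorphism f \<longleftrightarrow>
     bij f \<and> Vector_Spaces.linear scale scale f \<and> (\<forall>x y. f (x \<cdot> y) = f x \<cdot> f y)"

definition automorphism_group :: "('a \<Rightarrow> 'a) monoid" where
  "automorphism_group = \<lparr>carrier = {f. algebra_automorphism f}, mult = (\<circ>), one = id\<rparr>"

definition miyamoto_group :: "'a set \<Rightarrow> ('a \<Rightarrow> 'a) set" where
  "miyamoto_group X = generate automorphism_group {miyamoto x S' |x S'. x \<in> X \<and> S' \<subseteq> S x}"

definition Cl :: "'a set \<Rightarrow> 'a set" where
  "Cl X = {\<tau> x |x \<tau>. x \<in> X \<and> \<tau> \<in> miyamoto_group X}"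


subsection \<open>Frobenius forms\<close>

definition frobenius_form :: "('a \<Rightarrow> 'a \<Rightarrow> 'f) \<Rightarrow> bool" where
  "frobenius_form B \<longleftrightarrow>
     (\<forall>x. Vector_Spaces.linear scale (*) (\<lambda>y. B x y)) \<and>
     (\<forall>y. Vector_Spaces.linear scale (*) (\<lambda>x. B x y)) \<and>
     (\<forall>x y. B x y = B y x) \<and>
     (\<forall>x y z. B (x \<cdot> y) z = B x (y \<cdot> z))"

end

end

theory Submission
  imports Defs
begin

text \<open>
  Let \<open>C = Cl X\<close>. It is closed under the Miyamoto maps of its elements, and therefore spans \<open>A\<close>.
  Everything follows from \<open>\<phi>\<^sub>a(b) = \<phi>\<^sub>b(a)\<close> for \<open>a, b \<in> C\<close>: then the \<open>\<phi>\<^sub>a\<close> define a symmetric bilinear form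
  that is invariant under the Miyamoto maps, so that left and right multiplication by \<open>a \<in> C\<close> are
  self-adjoint, and \<open>(ab - ba, c)\<close>, being antisymmetric in \<open>a, b\<close> and symmetric in \<open>b, c\<close>, vanishes.

  For the symmetry of \<open>\<phi>\<close> one passes to the Jordan product; this is harmless because \<open>\<mu> + \<nu> = 1\<close>
  whenever \<open>\<mu> \<noteq> \<nu>\<close> and \<open>A\<^bsub>\<mu>,\<nu>\<^esub>(a) \<noteq> 0\<close>. Write \<open>b = \<phi> a + b\<^sub>0 + \<Sum> x\<^sub>p\<close> and \<open>a = \<psi> b + a\<^sub>0 + \<Sum> y\<^sub>q\<close>. As the
  \<open>0\<close>-eigenspaces in the subalgebra generated by \<open>a\<close> and \<open>b\<close> are at most one-dimensional, the
  \<open>q\<close>-component of \<open>x\<^sub>p\<close> is a multiple of \<open>y\<^sub>q\<close>. Comparing components in \<open>a x\<^sub>p = p x\<^sub>p\<close>,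
  \<open>b x\<^sub>p = x\<^sub>p/2 + x\<^sub>p\<^sup>2\<close>, \<open>x\<^sub>p x\<^sub>p\<^sub>' = 0\<close> and the two expansions of \<open>ab\<close> shows that if \<open>\<phi> \<noteq> \<psi>\<close>, then there
  are only one \<open>p\<close> and one \<open>q\<close>, and \<open>p \<noteq> q\<close>. In this case \<open>A\<^sub>q(a) \<noteq> 0\<close> by homogeneity, and \<open>b\<close> acts on it
  as a scalar \<open>r\<close> with \<open>\<phi> q = \<psi> r\<close>. Choose \<open>e \<in> C\<close> with a component \<open>x \<noteq> 0\<close> in \<open>A\<^sub>q(a)\<close> and an eigenvalue
  \<open>t\<close> of \<open>e\<close> occurring in \<open>x\<close>. The \<open>t\<close>-components of \<open>a\<close> and \<open>b\<close> with respect to \<open>e\<close> are in the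
  ratio \<open>2q - 1\<close> to \<open>2r - 1\<close>, and \<open>ab\<close> yields \<open>\<phi> (2q - 1) = \<psi> (2r - 1)\<close>, hence \<open>\<phi> = \<psi>\<close> after all.
\<close>

section \<open>Direct sums and eigenvectors\<close>

lemma dcomponent_decomposition:
  "is_direct_sum I V \<Longrightarrow> is_decomposition I V x (dcomponent I V x)"
  unfolding is_direct_sum_def dcomponent_def by (rule theI'[where P = "is_decomposition I V x"]) (erule spec)

lemma dcomponent_unique:
  "is_direct_sum I V \<Longrightarrow> is_decomposition I V x f \<Longrightarrow> dcomponent I V x = f"
  unfolding is_direct_sum_def dcomponent_def by (rule the1_equality) (erule spec)

lemma
  assumes "is_direct_sum I V"
  shows dcomponent_mem: "i \<in> I \<Longrightarrow> dcomponent I V x i \<in> V i"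
    and dcomponent_outside: "i \<notin> I \<Longrightarrow> dcomponent I V x i = 0"
    and finite_dcomponent: "finite {i. dcomponent I V x i \<noteq> 0}"
    and sum_dcomponent: "(\<Sum>i | dcomponent I V x i \<noteq> 0. dcomponent I V x i) = x"
proof -
  note d = dcomponent_decomposition[OF assms, of x, unfolded is_decomposition_def]
  show "i \<in> I \<Longrightarrow> dcomponent I V x i \<in> V i" "i \<notin> I \<Longrightarrow> dcomponent I V x i = 0"
    using d[THEN conjunct1] d[THEN conjunct2, THEN conjunct1] by simp_all
  show "finite {i. dcomponent I V x i \<noteq> 0}"
    by (rule d[THEN conjunct2, THEN conjunct2, THEN conjunct1])
  show "(\<Sum>i | dcomponent I V x i \<noteq> 0. dcomponent I V x i) = x"
    by (rule d[THEN conjunct2, THEN conjunct2, THEN conjunct2, symmetric])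
qed

lemma sum_dcomponent_superset:
  assumes "is_direct_sum I V" "finite M" "{i. dcomponent I V x i \<noteq> 0} \<subseteq> M"
  shows "(\<Sum>i\<in>M. dcomponent I V x i) = x"
proof -
  have "(\<Sum>i\<in>M. dcomponent I V x i) = (\<Sum>i | dcomponent I V x i \<noteq> 0. dcomponent I V x i)"
    using assms by (intro sum.mono_neutral_right) auto
  also have "\<dots> = x"
    by (rule sum_dcomponent[OF assms(1)])
  finally show ?thesis .
qed

lemma direct_sum_induct:
  assumes "is_direct_sum I V"
    and "\<And>i x. i \<in> I \<Longrightarrow> x \<in> V i \<Longrightarrow> P x" and "P 0" and "\<And>x y. P x \<Longrightarrow> P y \<Longrightarrow> P (x + y)"
  shows "P x"
proof -
  have sum: "P (\<Sum>i\<in>M. g i)" if "finite M" "\<And>i. i \<in> M \<Longrightarrow> P (g i)" for M and g :: "'a \<Rightarrow> 'b"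
    using that by (induction M rule: finite_induct) (auto simp: assms(3,4))
  have "i \<in> I" if "dcomponent I V x i \<noteq> 0" for i
    using dcomponent_outside[OF assms(1)] that by blast
  then have "P (\<Sum>i | dcomponent I V x i \<noteq> 0. dcomponent I V x i)"
    using assms(2)[OF _ dcomponent_mem[OF assms(1)]] finite_dcomponent[OF assms(1)] by (intro sum) auto
  then show ?thesis
    by (simp only: sum_dcomponent[OF assms(1)])
qed

section \<open>Independence of eigenvectors and linearity of components\<close>

context vector_space
begin

text \<open>Applying \<open>T - k\<close> kills the summand with eigenvalue \<open>k\<close> and
  multiplies every other one by the nonzero scalar \<open>m - k\<close>, so induction applies. For
  \<open>J = {0}\<close> this is the linear independence of eigenvectors; in general it shows that
  an invariant subspace contains the eigencomponents of its elements.\<close>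

lemma eigen_sum_mem:
  assumes "Vector_Spaces.linear scale scale T" "finite M" "\<And>m. m \<in> M \<Longrightarrow> T (g m) = scale m (g m)"
    and "subspace J" "\<And>x. x \<in> J \<Longrightarrow> T x \<in> J" "(\<Sum>m\<in>M. g m) \<in> J"
  shows "\<forall>m\<in>M. g m \<in> J"
  using assms(2,3,6)
proof (induction M arbitrary: g rule: finite_induct)
  case (insert k M)
  interpret T: Vector_Spaces.linear scale scale T by fact
  let ?s = "\<Sum>m\<in>insert k M. g m"
  have "T ?s = (\<Sum>m\<in>insert k M. scale m (g m))"
    using insert.prems by (auto simp: T.sum intro!: sum.cong)
  then have "T ?s - scale k ?s = (\<Sum>m\<in>insert k M. scale (m - k) (g m))"
    by (simp add: scale_sum_right scale_left_diff_distrib sum_subtractf)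
  also have "\<dots> = (\<Sum>m\<in>M. scale (m - k) (g m))"
    using insert.hyps by simp
  finally have diff: "T ?s - scale k ?s = (\<Sum>m\<in>M. scale (m - k) (g m))" .
  have "T ?s - scale k ?s \<in> J"
    using insert.prems(2) by (intro subspace_diff[OF assms(4)] assms(5) subspace_scale[OF assms(4)])
  then have "(\<Sum>m\<in>M. scale (m - k) (g m)) \<in> J"
    by (simp only: diff)
  then have "\<forall>m\<in>M. scale (m - k) (g m) \<in> J"
    using insert.prems by (intro insert.IH) (auto simp: T.scale mult.commute)
  moreover have "m - k \<noteq> 0" if "m \<in> M" for m
    using insert.hyps that by auto
  ultimately have M: "g m \<in> J" if "m \<in> M" for m
    using subspace_scale[OF assms(4), of "scale (m - k) (g m)" "inverse (m - k)"] that by simp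
  have "?s - (\<Sum>m\<in>M. g m) \<in> J"
    using M insert.prems(2) by (blast intro: subspace_diff[OF assms(4)] subspace_sum[OF assms(4)])
  then have "g k \<in> J"
    using insert.hyps by simp
  with M show ?case by simp
qed simp

lemma is_decomposition_sum:
  assumes "\<And>i. i \<in> I \<Longrightarrow> subspace (V i)" "finite M" "M \<subseteq> I" "\<And>i. i \<in> M \<Longrightarrow> g i \<in> V i" "x = (\<Sum>i\<in>M. g i)"
  shows "is_decomposition I V x (\<lambda>i. if i \<in> M then g i else 0)"
proof -
  let ?f = "\<lambda>i. if i \<in> M then g i else 0"
  have sub: "{i. ?f i \<noteq> 0} \<subseteq> M" by auto
  have "x = (\<Sum>i\<in>M. ?f i)"
    by (simp add: assms(5))
  also have "\<dots> = (\<Sum>i | ?f i \<noteq> 0. ?f i)"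
    using assms(2) sub by (intro sum.mono_neutral_right) auto
  finally have "x = (\<Sum>i | ?f i \<noteq> 0. ?f i)" .
  then show ?thesis
    unfolding is_decomposition_def
    using assms(1-4) finite_subset[OF sub] by (intro conjI) (auto simp: subspace_0)
qed

lemma dcomponent_sum:
  assumes "is_direct_sum I V" "\<And>i. i \<in> I \<Longrightarrow> subspace (V i)" "finite M" "M \<subseteq> I"
    "\<And>i. i \<in> M \<Longrightarrow> g i \<in> V i" "x = (\<Sum>i\<in>M. g i)"
  shows "dcomponent I V x = (\<lambda>i. if i \<in> M then g i else 0)"
  by (rule dcomponent_unique[OF assms(1) is_decomposition_sum[OF assms(2-)]])

lemma dcomponent_of_mem:
  assumes "is_direct_sum I V" "\<And>i. i \<in> I \<Longrightarrow> subspace (V i)" "i \<in> I" "x \<in> V i"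
  shows "dcomponent I V x j = (if j = i then x else 0)"
proof -
  have "dcomponent I V x = (\<lambda>j. if j \<in> {i} then x else 0)"
    using assms by (intro dcomponent_sum) simp_all
  then show ?thesis by simp
qed

lemma dcomponent_hom:
  assumes "is_direct_sum I V" "is_direct_sum I W" "\<And>i. i \<in> I \<Longrightarrow> subspace (W i)"
    and "Vector_Spaces.linear scale scale F" "\<And>i x. i \<in> I \<Longrightarrow> x \<in> V i \<Longrightarrow> F x \<in> W i"
  shows "dcomponent I W (F x) i = F (dcomponent I V x i)"
proof -
  interpret F: Vector_Spaces.linear scale scale F by fact
  let ?M = "{i. dcomponent I V x i \<noteq> 0}"
  have "?M \<subseteq> I"
    using dcomponent_outside[OF assms(1)] by blast
  moreover have "F x = (\<Sum>i\<in>?M. F (dcomponent I V x i))"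
    using F.sum[of "dcomponent I V x" ?M] sum_dcomponent[OF assms(1), of x] by simp
  ultimately have "dcomponent I W (F x) = (\<lambda>i. if i \<in> ?M then F (dcomponent I V x i) else 0)"
    using assms(5)[OF _ dcomponent_mem[OF assms(1)]]
    by (intro dcomponent_sum[OF assms(2,3)] finite_dcomponent[OF assms(1)]) auto
  then show ?thesis by simp
qed

lemma linear_dcomponent:
  assumes "is_direct_sum I V" "\<And>i. i \<in> I \<Longrightarrow> subspace (V i)"
  shows "Vector_Spaces.linear scale scale (\<lambda>x. dcomponent I V x i)"
proof -
  have "dcomponent I V (x + y) i = dcomponent I V x i + dcomponent I V y i" for x y
  proof -
    let ?M = "{i. dcomponent I V x i \<noteq> 0} \<union> {i. dcomponent I V y i \<noteq> 0}"
    have fin: "finite ?M"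
      using finite_dcomponent[OF assms(1)] by simp
    have sub: "?M \<subseteq> I"
      using dcomponent_outside[OF assms(1)] by blast
    have "x + y = (\<Sum>i\<in>?M. dcomponent I V x i) + (\<Sum>i\<in>?M. dcomponent I V y i)"
      using sum_dcomponent_superset[OF assms(1) fin] by simp
    then have "x + y = (\<Sum>i\<in>?M. dcomponent I V x i + dcomponent I V y i)"
      by (simp add: sum.distrib)
    moreover have "dcomponent I V x i + dcomponent I V y i \<in> V i" if "i \<in> ?M" for i
      using that sub assms dcomponent_mem[OF assms(1)] by (blast intro: subspace_add)
    ultimately have "dcomponent I V (x + y) = (\<lambda>i. if i \<in> ?M then dcomponent I V x i + dcomponent I V y i else 0)"
      using fin sub by (intro dcomponent_sum assms) auto
    then show ?thesis by simp
  qed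
  moreover have "dcomponent I V (scale c x) i = scale c (dcomponent I V x i)" for c x
    using assms(2) by (intro dcomponent_hom[OF assms(1,1,2)]) (simp_all add: subspace_scale)
  ultimately show ?thesis
    unfolding Vector_Spaces.linear_iff using vector_space_axioms by blast
qed

lemma is_direct_sumI:
  assumes "\<And>i. i \<in> I \<Longrightarrow> subspace (V i)"
    and spanning: "\<And>x. \<exists>M g. finite M \<and> M \<subseteq> I \<and> (\<forall>i\<in>M. g i \<in> V i) \<and> x = (\<Sum>i\<in>M. g i)"
    and indep: "\<And>M g i. finite M \<Longrightarrow> M \<subseteq> I \<Longrightarrow> (\<forall>i\<in>M. g i \<in> V i) \<Longrightarrow> (\<Sum>i\<in>M. g i) = 0 \<Longrightarrow> i \<in> M \<Longrightarrow> g i = 0"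
  shows "is_direct_sum I V"
  unfolding is_direct_sum_def
proof
  fix x
  obtain M g where Mg: "finite M" "M \<subseteq> I" "\<forall>i\<in>M. g i \<in> V i" "x = (\<Sum>i\<in>M. g i)"
    using spanning[of x] by (elim exE conjE) (rule that)
  have ex: "is_decomposition I V x (\<lambda>i. if i \<in> M then g i else 0)"
    by (rule is_decomposition_sum[OF assms(1) Mg(1,2) bspec[OF Mg(3)] Mg(4)])
  have eq: "f = h" if f: "is_decomposition I V x f" and h: "is_decomposition I V x h" for f h
  proof
    fix i
    let ?M = "{i. f i \<noteq> 0} \<union> {i. h i \<noteq> 0}"
    note f = f[unfolded is_decomposition_def] and h = h[unfolded is_decomposition_def]
    have fin: "finite ?M"
      using f h by (simp only: finite_Un)
    have sub: "?M \<subseteq> I"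
      using f[THEN conjunct2, THEN conjunct1] h[THEN conjunct2, THEN conjunct1] by blast
    have "(\<Sum>i\<in>?M. f i) = (\<Sum>i | f i \<noteq> 0. f i)" "(\<Sum>i\<in>?M. h i) = (\<Sum>i | h i \<noteq> 0. h i)"
      using fin by (auto intro!: sum.mono_neutral_right)
    then have "(\<Sum>i\<in>?M. f i) = x" "(\<Sum>i\<in>?M. h i) = x"
      using f h by simp_all
    then have zero: "(\<Sum>i\<in>?M. f i - h i) = 0"
      by (simp add: sum_subtractf)
    have mem: "\<forall>i\<in>?M. f i - h i \<in> V i"
      by (intro ballI subspace_diff[OF assms(1)] bspec[OF f[THEN conjunct1]] bspec[OF h[THEN conjunct1]] subsetD[OF sub])
    have "i \<in> ?M \<Longrightarrow> f i - h i = 0"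
      by (rule indep[OF fin sub mem zero])
    then show "f i = h i" by (cases "i \<in> ?M") auto
  qed
  show "\<exists>!f. is_decomposition I V x f"
    by (rule ex1I[of "is_decomposition I V x", OF ex eq[OF _ ex]])
qed

end

section \<open>Bilinearity, two-sided eigenspaces and generated subalgebras\<close>

context nonassoc_algebra
begin

lemma mul_add_left: "(x + y) \<cdot> z = x \<cdot> z + y \<cdot> z"
  and mul_scale_left: "(c *s x) \<cdot> z = c *s (x \<cdot> z)"
  using linear_mul_right[of z] unfolding Vector_Spaces.linear_iff by blast+

lemma mul_add_right: "z \<cdot> (x + y) = z \<cdot> x + z \<cdot> y"
  and mul_scale_right: "z \<cdot> (c *s x) = c *s (z \<cdot> x)"
  using linear_mul_left[of z] unfolding Vector_Spaces.linear_iff by blast+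

lemma mul_zero_left [simp]: "0 \<cdot> z = 0"
  and mul_zero_right [simp]: "z \<cdot> 0 = 0"
  using mul_add_left[of 0 0 z] mul_add_right[of z 0 0] by simp_all

lemma mul_diff_left: "(x - y) \<cdot> z = x \<cdot> z - y \<cdot> z"
  and mul_diff_right: "z \<cdot> (x - y) = z \<cdot> x - z \<cdot> y"
  using mul_add_left[of "x - y" y z] mul_add_right[of z "x - y" y] by (simp_all add: algebra_simps)

lemma mul_minus_left: "(- x) \<cdot> z = - (x \<cdot> z)"
  and mul_minus_right: "z \<cdot> (- x) = - (z \<cdot> x)"
  using mul_diff_left[of 0 x z] mul_diff_right[of z 0 x] by simp_all

lemma mul_sum_left: "(\<Sum>i\<in>M. f i) \<cdot> z = (\<Sum>i\<in>M. f i \<cdot> z)"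
  and mul_sum_right: "z \<cdot> (\<Sum>i\<in>M. f i) = (\<Sum>i\<in>M. z \<cdot> f i)"
  by (induction M rule: infinite_finite_induct) (simp_all add: mul_add_left mul_add_right)

lemmas mul_simps = mul_add_left mul_add_right mul_scale_left mul_scale_right
  mul_diff_left mul_diff_right mul_minus_left mul_minus_right

lemma subspace_eig2: "subspace (eig2 a p)"
  unfolding eig2_def by (cases p) (auto intro!: subspaceI simp: mul_simps scale_right_distrib mult.commute)

lemma mem_eig2: "z \<in> eig2 a p \<longleftrightarrow> a \<cdot> z = fst p *s z \<and> z \<cdot> a = snd p *s z"
  unfolding eig2_def by (cases p) auto

lemma subspace_eig: "subspace (eig a l)"
  by (simp add: eig_def subspace_eig2)

lemma mem_eig: "z \<in> eig a l \<longleftrightarrow> a \<cdot> z = l *s z \<and> z \<cdot> a = l *s z"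
  by (simp add: eig_def mem_eig2)

lemma subspace_eig01: "subspace (eig01 a)"
  unfolding eig01_def by (intro subspace_sums subspace_eig)

lemma eig_le_eig01: "eig a 1 \<subseteq> eig01 a" "eig a 0 \<subseteq> eig01 a"
  unfolding eig01_def using subspace_0[OF subspace_eig] by force+

lemma subalgebra_generated: "subalgebra (generated_subalgebra Y)"
  unfolding generated_subalgebra_def
  by (rule hull_in) (auto simp: subalgebra_def intro: subspace_Inter)

lemma generated_superset: "Y \<subseteq> generated_subalgebra Y"
  unfolding generated_subalgebra_def by (rule hull_subset)

lemma generated_minimal: "Y \<subseteq> B \<Longrightarrow> subalgebra B \<Longrightarrow> generated_subalgebra Y \<subseteq> B"
  unfolding generated_subalgebra_def by (rule hull_minimal)

lemma subspace_generated: "subspace (generated_subalgebra Y)"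
  using subalgebra_generated unfolding subalgebra_def by blast

lemma mul_mem_generated:
  "x \<in> generated_subalgebra Y \<Longrightarrow> y \<in> generated_subalgebra Y \<Longrightarrow> x \<cdot> y \<in> generated_subalgebra Y"
  using subalgebra_generated unfolding subalgebra_def by blast

end

section \<open>Commutative algebras and axes with a fusion law\<close>

locale comm_algebra = nonassoc_algebra scale mul
  for scale :: "'f::field \<Rightarrow> 'a::ab_group_add \<Rightarrow> 'a" (infixr \<open>*s\<close> 75)
    and mul :: "'a \<Rightarrow> 'a \<Rightarrow> 'a" (infixl \<open>\<cdot>\<close> 77) +
  assumes mul_commute: "x \<cdot> y = y \<cdot> x"
    and two_nonzero: "(2::'f) \<noteq> 0"
begin

text \<open>The commutative counterpart of a weakly primitive axis with fusion rules. The direct sum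
  may be indexed by the whole field because eigenspaces of non-eigenvalues are zero. Eigenvalues
  other than \<open>0\<close> and \<open>1\<close> are called odd below; \<open>eig01 a\<close> is
  the even part and \<open>ev a\<close> the projection onto it.\<close>

definition fusion_axis :: "'a \<Rightarrow> bool" where
  "fusion_axis a \<longleftrightarrow> a \<noteq> 0 \<and> is_direct_sum UNIV (eig a) \<and> eig a 1 = range (\<lambda>c. c *s a) \<and>
     (\<forall>x\<in>eig a 0. \<forall>y\<in>eig a 0. x \<cdot> y \<in> eig01 a) \<and>
     (\<forall>l. l \<noteq> 0 \<and> l \<noteq> 1 \<longrightarrow>
        (\<forall>x\<in>eig a 0. \<forall>y\<in>eig a l. x \<cdot> y \<in> eig a l) \<and>
        (\<forall>x\<in>eig a l. \<forall>y\<in>eig a l. x \<cdot> y \<in> eig01 a) \<and>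
        (\<forall>k. k \<noteq> 0 \<and> k \<noteq> 1 \<and> k \<noteq> l \<longrightarrow> (\<forall>x\<in>eig a l. \<forall>y\<in>eig a k. x \<cdot> y = 0)))"

definition pr :: "'a \<Rightarrow> 'f \<Rightarrow> 'a \<Rightarrow> 'a" where
  "pr a l x = dcomponent UNIV (eig a) x l"

definition ev :: "'a \<Rightarrow> 'a \<Rightarrow> 'a" where
  "ev a x = pr a 1 x + pr a 0 x"

definition coef :: "'a \<Rightarrow> 'a \<Rightarrow> 'f" where
  "coef a x = (THE c. c *s a = pr a 1 x)"

lemma half_double: "(1/2) *s (x + x) = x"
proof -
  have "(1/2) *s (x + x) = (1/2 + 1/2) *s x"
    by (simp only: scale_left_distrib scale_right_distrib)
  also have "\<dots> = x"
    using two_nonzero by (simp add: field_simps)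
  finally show ?thesis .
qed

lemma mem_eig_iff: "z \<in> eig a l \<longleftrightarrow> a \<cdot> z = l *s z"
  by (simp add: mem_eig mul_commute[of z a])

section \<open>Projections and fusion rules of a single axis\<close>

context
  fixes a assumes fa: "fusion_axis a"
begin

lemma fusion_axis_nonzero: "a \<noteq> 0"
  and direct_sum_eig: "is_direct_sum UNIV (eig a)"
  and eig_one: "eig a 1 = range (\<lambda>c. c *s a)"
  and fusion_rule_0_0: "x \<in> eig a 0 \<Longrightarrow> y \<in> eig a 0 \<Longrightarrow> x \<cdot> y \<in> eig01 a"
  and fusion_rule_0_l: "x \<in> eig a 0 \<Longrightarrow> y \<in> eig a l \<Longrightarrow> l \<noteq> 0 \<Longrightarrow> l \<noteq> 1 \<Longrightarrow> x \<cdot> y \<in> eig a l"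
  and fusion_same: "x \<in> eig a l \<Longrightarrow> y \<in> eig a l \<Longrightarrow> l \<noteq> 0 \<Longrightarrow> l \<noteq> 1 \<Longrightarrow> x \<cdot> y \<in> eig01 a"
  and fusion_different: "x \<in> eig a l \<Longrightarrow> y \<in> eig a k \<Longrightarrow> l \<noteq> 0 \<Longrightarrow> l \<noteq> 1 \<Longrightarrow> k \<noteq> 0 \<Longrightarrow> k \<noteq> 1 \<Longrightarrow> k \<noteq> l \<Longrightarrow> x \<cdot> y = 0"
  by (insert fa[unfolded fusion_axis_def], elim conjE, (assumption | simp; fail)+)

lemma fusion_axis_mem: "a \<in> eig a 1"
  unfolding eig_one by (rule range_eqI[of _ _ 1]) simp

lemma fusion_axis_idem: "a \<cdot> a = a"
  using fusion_axis_mem by (simp add: mem_eig_iff)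

lemma pr_mem: "pr a l x \<in> eig a l"
  unfolding pr_def by (rule dcomponent_mem[OF direct_sum_eig UNIV_I])

lemma mul_pr: "a \<cdot> pr a l x = l *s pr a l x"
  using pr_mem by (simp add: mem_eig_iff)

lemma linear_pr: "Vector_Spaces.linear scale scale (pr a l)"
  unfolding pr_def by (rule linear_dcomponent[OF direct_sum_eig subspace_eig])

lemma pr_add: "pr a l (x + y) = pr a l x + pr a l y"
  and pr_scale: "pr a l (c *s x) = c *s pr a l x"
  using linear_pr[of l] unfolding Vector_Spaces.linear_iff by blast+

lemma pr_zero: "pr a l 0 = 0"
  using pr_scale[of l 0 0] by simp

lemma pr_diff: "pr a l (x - y) = pr a l x - pr a l y"
  using pr_add[of l "x - y" y] by (simp add: algebra_simps)

lemma pr_sum: "pr a l (\<Sum>i\<in>M. f i) = (\<Sum>i\<in>M. pr a l (f i))"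
  by (induction M rule: infinite_finite_induct) (simp_all add: pr_zero pr_add)

lemma pr_of_mem: "x \<in> eig a k \<Longrightarrow> pr a l x = (if l = k then x else 0)"
  unfolding pr_def by (rule dcomponent_of_mem[OF direct_sum_eig subspace_eig UNIV_I])

lemma pr_axis: "pr a l a = (if l = 1 then a else 0)"
  by (rule pr_of_mem[OF fusion_axis_mem])

lemma pr_pr: "pr a l (pr a k x) = (if l = k then pr a k x else 0)"
  by (rule pr_of_mem[OF pr_mem])

lemma finite_pr: "finite {l. pr a l x \<noteq> 0}"
  unfolding pr_def by (rule finite_dcomponent[OF direct_sum_eig])

lemma sum_pr: "(\<Sum>l | pr a l x \<noteq> 0. pr a l x) = x"
  unfolding pr_def by (rule sum_dcomponent[OF direct_sum_eig])

lemma eig_induct [case_names eig add]: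
  assumes "\<And>l x. x \<in> eig a l \<Longrightarrow> P x" "\<And>x y. P x \<Longrightarrow> P y \<Longrightarrow> P (x + y)"
  shows "P x"
  by (rule direct_sum_induct[OF direct_sum_eig, of P])
    (rule assms(1), assumption, rule assms(1)[OF subspace_0[OF subspace_eig]], rule assms(2))

lemma pr_eqI:
  assumes "\<And>l. pr a l x = pr a l y"
  shows "x = y"
proof -
  have "(\<Sum>l | pr a l x \<noteq> 0. pr a l x) = (\<Sum>l | pr a l y \<noteq> 0. pr a l y)"
    by (simp only: assms)
  then show ?thesis by (simp only: sum_pr)
qed

lemma pr_mul_axis: "pr a l (a \<cdot> x) = l *s pr a l x"
proof (induction x rule: eig_induct)
  case (eig k x)
  then show ?case
    using pr_of_mem[OF eig] by (simp add: mem_eig_iff pr_scale)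
qed (simp add: mul_simps pr_add scale_right_distrib)

lemma pr_one: "pr a 1 x = coef a x *s a"
proof -
  obtain c where c: "pr a 1 x = c *s a"
    using pr_mem[of 1 x] unfolding eig_one by (rule rangeE)
  have "coef a x = c"
    unfolding coef_def c using fusion_axis_nonzero by simp
  with c show ?thesis by simp
qed

lemma ev_add: "ev a (x + y) = ev a x + ev a y"
  and ev_scale: "ev a (c *s x) = c *s ev a x"
  unfolding ev_def by (simp_all add: pr_add pr_scale scale_right_distrib)

lemma ev_zero: "ev a 0 = 0"
  unfolding ev_def by (simp add: pr_zero)

lemma ev_sum: "ev a (\<Sum>i\<in>M. f i) = (\<Sum>i\<in>M. ev a (f i))"
  by (induction M rule: infinite_finite_induct) (simp_all add: ev_zero ev_add)

lemma ev_mem: "ev a x \<in> eig01 a"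
  unfolding ev_def eig01_def using pr_mem by blast

lemma ev_of_mem: "x \<in> eig a k \<Longrightarrow> ev a x = (if k = 0 \<or> k = 1 then x else 0)"
  unfolding ev_def by (auto simp: pr_of_mem)

lemma ev_axis: "ev a a = a"
  by (simp add: ev_of_mem[OF fusion_axis_mem])

lemma pr_eig01: "x \<in> eig01 a \<Longrightarrow> l \<noteq> 0 \<Longrightarrow> l \<noteq> 1 \<Longrightarrow> pr a l x = 0"
  unfolding eig01_def by (auto simp: pr_add pr_of_mem)

lemma fusion_even_odd:
  assumes "x \<in> eig01 a" "y \<in> eig a l" "l \<noteq> 0" "l \<noteq> 1"
  shows "x \<cdot> y \<in> eig a l"
proof -
  obtain u v where uv: "x = u + v" "u \<in> eig a 1" "v \<in> eig a 0"
    using assms(1) unfolding eig01_def by blast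
  obtain c where u: "u = c *s a"
    using uv(2) unfolding eig_one by (rule rangeE)
  have "u \<cdot> y = (c * l) *s y"
    using assms(2) by (simp add: u mul_simps mem_eig_iff)
  then have "u \<cdot> y \<in> eig a l"
    using assms(2) by (simp add: subspace_scale[OF subspace_eig])
  moreover have "v \<cdot> y \<in> eig a l"
    by (rule fusion_rule_0_l[OF uv(3) assms(2-4)])
  ultimately show ?thesis
    by (simp add: uv(1) mul_simps subspace_add[OF subspace_eig])
qed

lemma fusion_even_even:
  assumes "x \<in> eig01 a" "y \<in> eig01 a"
  shows "x \<cdot> y \<in> eig01 a"
proof -
  obtain u v u' v' where uv: "x = u + v" "u \<in> eig a 1" "v \<in> eig a 0"
      "y = u' + v'" "u' \<in> eig a 1" "v' \<in> eig a 0"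
    using assms unfolding eig01_def by blast
  obtain c where u: "u = c *s a"
    using uv(2) unfolding eig_one by (rule rangeE)
  obtain c' where u': "u' = c' *s a"
    using uv(5) unfolding eig_one by (rule rangeE)
  have "x \<cdot> y = (c * c') *s a + v \<cdot> v'"
    using uv(3,6) by (simp add: uv(1,4) u u' mul_simps fusion_axis_idem mem_eig_iff mul_commute[of v a])
  moreover have "v \<cdot> v' \<in> eig01 a"
    by (rule fusion_rule_0_0[OF uv(3,6)])
  moreover have "(c * c') *s a \<in> eig01 a"
    using fusion_axis_mem eig_le_eig01 by (blast intro: subspace_scale[OF subspace_eig])
  ultimately show ?thesis
    by (simp add: subspace_add[OF subspace_eig01])
qed

text \<open>Odd eigenspaces with different eigenvalues annihilate each other, so \<open>y\<close>
  only meets the even part and the \<open>l\<close>-part of \<open>u\<close>.\<close>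

lemma mul_odd:
  assumes "y \<in> eig a l" "l \<noteq> 0" "l \<noteq> 1"
  shows "u \<cdot> y = ev a u \<cdot> y + pr a l u \<cdot> y"
proof (induction u rule: eig_induct)
  case (eig k u)
  then show ?case
    using assms fusion_different[of u k y l] by (auto simp: ev_of_mem pr_of_mem)
qed (simp add: mul_simps ev_add pr_add algebra_simps)

text \<open>Products of two even or two odd eigenvectors are even, so an odd component of a product
  arises only from an even factor times an odd one. This identity later turns relations in the
  algebra into relations between components.\<close>

lemma pr_mul:
  assumes l: "l \<noteq> 0" "l \<noteq> 1"
  shows "pr a l (x \<cdot> y) = ev a x \<cdot> pr a l y + ev a y \<cdot> pr a l x"
proof (induction x arbitrary: y rule: eig_induct)
  case (eig k x)
  note x = eig
  show ?case
  proof (induction y rule: eig_induct)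
    case (eig j y)
    note y = eig
    consider "k = 0 \<or> k = 1" "j = 0 \<or> j = 1" | "k = 0 \<or> k = 1" "j \<noteq> 0" "j \<noteq> 1"
      | "k \<noteq> 0" "k \<noteq> 1" "j = 0 \<or> j = 1" | "k \<noteq> 0" "k \<noteq> 1" "j \<noteq> 0" "j \<noteq> 1" by blast
    then show ?case
    proof cases
      case 1
      then have "x \<in> eig01 a" "y \<in> eig01 a"
        using x y eig_le_eig01 by blast+
      then have "pr a l (x \<cdot> y) = 0"
        by (intro pr_eig01 fusion_even_even l)
      then show ?thesis
        using 1 l by (auto simp: pr_of_mem[OF x] pr_of_mem[OF y])
    next
      case 2
      then have "x \<in> eig01 a"
        using x eig_le_eig01 by blast
      then have "x \<cdot> y \<in> eig a j"
        using y 2 by (intro fusion_even_odd)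
      then show ?thesis
        using 2 l by (auto simp: pr_of_mem[of "x \<cdot> y"] pr_of_mem[OF x] pr_of_mem[OF y] ev_of_mem[OF x] ev_of_mem[OF y])
    next
      case 3
      then have "y \<in> eig01 a"
        using y eig_le_eig01 by blast
      then have "y \<cdot> x \<in> eig a k"
        using x 3 by (intro fusion_even_odd)
      then show ?thesis
        using 3 l mul_commute[of x y]
        by (auto simp: pr_of_mem[of "y \<cdot> x"] pr_of_mem[OF x] pr_of_mem[OF y] ev_of_mem[OF x] ev_of_mem[OF y])
    next
      case 4
      have "pr a l (x \<cdot> y) = 0"
      proof (cases "j = k")
        case True
        then show ?thesis
          using x y 4 l by (intro pr_eig01 fusion_same[of x k]) auto
      qed (use x y 4 fusion_different[of x k y j] in \<open>auto simp: pr_zero\<close>)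
      then show ?thesis
        using 4 by (simp add: ev_of_mem[OF x] ev_of_mem[OF y])
    qed
  qed (simp add: mul_simps pr_add ev_add algebra_simps)
qed (simp add: mul_simps pr_add ev_add algebra_simps)

lemma sum_pr_odd: "x = ev a x + (\<Sum>l | l \<noteq> 0 \<and> l \<noteq> 1 \<and> pr a l x \<noteq> 0. pr a l x)"
proof -
  let ?P = "{l. l \<noteq> 0 \<and> l \<noteq> 1 \<and> pr a l x \<noteq> 0}"
  have fin: "finite ?P"
    by (rule finite_subset[OF _ finite_pr[of x]]) blast
  have "(\<Sum>l\<in>insert 1 (insert 0 ?P). pr a l x) = x"
    unfolding pr_def using fin[unfolded pr_def]
    by (intro sum_dcomponent_superset[OF direct_sum_eig]) blast+
  moreover have "(\<Sum>l\<in>insert 1 (insert 0 ?P). pr a l x) = ev a x + (\<Sum>l\<in>?P. pr a l x)"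
    using fin by (simp add: ev_def add.assoc)
  ultimately show ?thesis by (rule trans[OF sym])
qed

lemma finite_pr_odd: "finite {l. l \<noteq> 0 \<and> l \<noteq> 1 \<and> pr a l x \<noteq> 0}"
  by (rule finite_subset[OF _ finite_pr[of x]]) blast

lemma mul_axis_expand: "a \<cdot> x = coef a x *s a + (\<Sum>l | l \<noteq> 0 \<and> l \<noteq> 1 \<and> pr a l x \<noteq> 0. l *s pr a l x)"
proof -
  have "a \<cdot> x = a \<cdot> (ev a x + (\<Sum>l | l \<noteq> 0 \<and> l \<noteq> 1 \<and> pr a l x \<noteq> 0. pr a l x))"
    by (rule arg_cong[OF sum_pr_odd])
  also have "\<dots> = coef a x *s a + (\<Sum>l | l \<noteq> 0 \<and> l \<noteq> 1 \<and> pr a l x \<noteq> 0. l *s pr a l x)"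
    by (simp add: ev_def mul_simps mul_sum_right mul_pr pr_one[symmetric])
  finally show ?thesis .
qed

lemma pr_mem_subspace:
  assumes "subspace J" "\<And>u. u \<in> J \<Longrightarrow> a \<cdot> u \<in> J" "x \<in> J"
  shows "pr a l x \<in> J"
proof -
  have "\<forall>l\<in>{l. pr a l x \<noteq> 0}. pr a l x \<in> J"
    by (rule eigen_sum_mem[OF linear_mul_left[of a] finite_pr])
      (use assms sum_pr mul_pr in simp_all)
  then show ?thesis
    using subspace_0[OF assms(1)] by (cases "pr a l x = 0") auto
qed

text \<open>In the expansion the product \<open>w\<close> of the two \<open>l\<close>-parts cancels,
  and the remaining correction \<open>u + v\<close> is the \<open>l\<close>-part of
  \<open>x \<cdot> y\<close> by \<open>pr_mul\<close>. The map involved is the Miyamoto reflection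
  negating \<open>eig a l\<close>.\<close>

lemma reflect_mul:
  assumes l: "l \<noteq> 0" "l \<noteq> 1"
  shows "(x - 2 *s pr a l x) \<cdot> (y - 2 *s pr a l y) = x \<cdot> y - 2 *s pr a l (x \<cdot> y)"
proof -
  define u v w where "u = ev a x \<cdot> pr a l y" "v = ev a y \<cdot> pr a l x" "w = pr a l x \<cdot> pr a l y"
  have "x \<cdot> pr a l y = u + w" "pr a l x \<cdot> y = v + w"
    using mul_odd[OF pr_mem l, of x y] mul_odd[OF pr_mem l, of y x]
      mul_commute[of "pr a l y" "pr a l x"] mul_commute[of "pr a l x" y]
    unfolding u_v_w_def by simp_all
  then have "(x - 2 *s pr a l x) \<cdot> (y - 2 *s pr a l y)
      = (x \<cdot> y - 2 *s (v + w)) - (2 *s (u + w) - 2 *s (2 *s w))"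
    by (simp only: mul_diff_left mul_diff_right mul_scale_left mul_scale_right
        scale_right_diff_distrib u_v_w_def(3))
  also have "2 *s (2 *s w) = 2 *s w + 2 *s w"
    by (simp add: scale_left_distrib[symmetric])
  also have "(x \<cdot> y - 2 *s (v + w)) - (2 *s (u + w) - (2 *s w + 2 *s w)) = x \<cdot> y - 2 *s (u + v)"
    by (simp add: scale_right_distrib)
  also have "u + v = pr a l (x \<cdot> y)"
    unfolding u_v_w_def by (rule pr_mul[OF l, symmetric])
  finally show ?thesis .
qed

text \<open>Comparing \<open>l\<close>-parts in \<open>b \<cdot> b = b\<close> by
  \<open>pr_mul\<close> produces the product twice, hence the factor 1/2.\<close>

lemma ev_mul_idem:
  assumes "b \<cdot> b = b" "l \<noteq> 0" "l \<noteq> 1"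
  shows "ev a b \<cdot> pr a l b = (1/2) *s pr a l b"
proof -
  have "ev a b \<cdot> pr a l b + ev a b \<cdot> pr a l b = pr a l b"
    using pr_mul[OF assms(2,3), of b b] assms(1) by simp
  then show ?thesis
    using half_double[of "ev a b \<cdot> pr a l b"] by simp
qed

lemma idem_mul_pr:
  assumes "b \<cdot> b = b" "l \<noteq> 0" "l \<noteq> 1"
  shows "b \<cdot> pr a l b = (1/2) *s pr a l b + pr a l b \<cdot> pr a l b"
  using mul_odd[OF pr_mem assms(2,3), of b b] ev_mul_idem[OF assms] by simp

end

section \<open>The subalgebra generated by two axes\<close>

definition thin :: "'a \<Rightarrow> 'a \<Rightarrow> bool" where
  "thin b a \<longleftrightarrow> (\<forall>u\<in>generated_subalgebra {a, b} \<inter> eig b 0.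
     \<forall>v\<in>generated_subalgebra {a, b} \<inter> eig b 0. v \<noteq> 0 \<longrightarrow> (\<exists>c. u = c *s v))"

lemma span_pairE:
  assumes "z \<in> span {a, b}"
  obtains r s where "z = r *s a + s *s b"
proof -
  obtain r where "z - r *s a \<in> span {b}"
    using assms by (auto simp only: span_breakdown_eq[of z])
  then obtain s where "z - r *s a = s *s b"
    unfolding span_singleton by (rule rangeE)
  then have "z = r *s a + s *s b"
    by (simp only: diff_eq_eq add.commute)
  then show thesis by (rule that)
qed

lemma pr_mem_generated:
  "fusion_axis b \<Longrightarrow> b \<in> Y \<Longrightarrow> u \<in> generated_subalgebra Y \<Longrightarrow> pr b l u \<in> generated_subalgebra Y"
  using generated_superset
  by (intro pr_mem_subspace subspace_generated) (blast intro: mul_mem_generated)+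

text \<open>Thinness leaves at most one direction in the 0-eigenspace of \<open>b\<close> inside the
  generated subalgebra. If the 0-part of \<open>a\<close> is nonzero, it spans this direction, so
  every even part is a combination of \<open>b\<close> and that vector, and both act on
  \<open>pr b q a\<close> as scalars. If it is zero, the subalgebra is just the span of
  \<open>a\<close> and \<open>b\<close>.\<close>

lemma pair_scalars_mem:
  assumes fb: "fusion_axis b" and idem: "a \<cdot> a = a" and thin: "thin b a"
    and u: "u \<in> generated_subalgebra {a, b}" and q: "q \<noteq> 0" "q \<noteq> 1"
  shows "(\<exists>c. pr b q u = c *s pr b q a) \<and> (\<exists>m. ev b u \<cdot> pr b q a = m *s pr b q a)"
proof -
  let ?G = "generated_subalgebra {a, b}" and ?\<psi> = "coef b a"
  have ab: "a \<in> ?G" "b \<in> ?G"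
    using generated_superset by blast+
  have half: "ev b a \<cdot> pr b l a = (1/2) *s pr b l a" if "l \<noteq> 0" "l \<noteq> 1" for l
    by (rule ev_mul_idem[OF fb idem that])
  show ?thesis
  proof (cases "pr b 0 a = 0")
    case True
    have ev_a: "ev b a = ?\<psi> *s b"
      by (simp add: ev_def True pr_one[OF fb])
    \<comment> \<open>Here \<open>ev b a = \<psi> b\<close>, so \<open>ev_mul_idem\<close> reads
      \<open>\<psi> l = 1/2\<close>: only one odd eigenvalue can occur in \<open>a\<close>. Hence
      \<open>b \<cdot> a\<close> is a combination of \<open>b\<close> and
      \<open>a - \<psi> b\<close>.\<close>
    define t where "t = 1 / (2 * ?\<psi>)"
    have t: "l = t" if "l \<noteq> 0" "l \<noteq> 1" "pr b l a \<noteq> 0" for l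
    proof -
      have "(?\<psi> * l) *s pr b l a = (1/2) *s pr b l a"
        using half[OF that(1,2)] by (simp add: ev_a mul_simps mul_pr[OF fb])
      then have "?\<psi> * l = 1/2"
        using that(3) by simp
      moreover from this have "?\<psi> \<noteq> 0"
        using two_nonzero by auto
      ultimately show ?thesis
        unfolding t_def using two_nonzero by (simp add: field_simps)
    qed
    have "b \<cdot> a = ?\<psi> *s b + (\<Sum>l | l \<noteq> 0 \<and> l \<noteq> 1 \<and> pr b l a \<noteq> 0. l *s pr b l a)"
      by (rule mul_axis_expand[OF fb])
    also have "(\<Sum>l | l \<noteq> 0 \<and> l \<noteq> 1 \<and> pr b l a \<noteq> 0. l *s pr b l a)
        = t *s (\<Sum>l | l \<noteq> 0 \<and> l \<noteq> 1 \<and> pr b l a \<noteq> 0. pr b l a)"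
      unfolding scale_sum_right using t by (intro sum.cong) auto
    also have "(\<Sum>l | l \<noteq> 0 \<and> l \<noteq> 1 \<and> pr b l a \<noteq> 0. pr b l a) = a - ?\<psi> *s b"
      using sum_pr_odd[OF fb, of a, unfolded ev_a] by (simp only: eq_diff_eq add.commute)
    finally have ba: "b \<cdot> a \<in> span {a, b}"
      by (simp add: span_add span_diff span_scale span_base)
    have "subalgebra (span {a, b})"
      unfolding subalgebra_def
    proof (intro conjI ballI)
      fix x y assume xy: "x \<in> span {a, b}" "y \<in> span {a, b}"
      obtain r s where "x = r *s a + s *s b"
        using span_pairE[OF xy(1)] .
      moreover obtain r' s' where "y = r' *s a + s' *s b"
        using span_pairE[OF xy(2)] .
      ultimately have "x \<cdot> y = (r * r') *s a + (r * s') *s (b \<cdot> a) + ((s * r') *s (b \<cdot> a) + (s * s') *s b)"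
        by (simp add: mul_simps idem fusion_axis_idem[OF fb] mul_commute[of a b] scale_right_distrib
            mult.commute add.assoc)
      then show "x \<cdot> y \<in> span {a, b}"
        using ba by (simp add: span_add span_scale span_base)
    qed simp
    then have "?G \<subseteq> span {a, b}"
      by (intro generated_minimal span_superset)
    with u have "u \<in> span {a, b}" by blast
    then obtain r s where u: "u = r *s a + s *s b"
      by (rule span_pairE)
    have "pr b q u = r *s pr b q a"
      using q by (simp add: u pr_add[OF fb] pr_scale[OF fb] pr_axis[OF fb])
    moreover have "ev b u \<cdot> pr b q a = (r * (1/2) + s * q) *s pr b q a"
      using half[OF q] by (simp add: u ev_add[OF fb] ev_scale[OF fb] ev_axis[OF fb] mul_simps mul_pr[OF fb]
          scale_left_distrib)
    ultimately show ?thesis by blast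
  next
    case False
    \<comment> \<open>\<open>ev_mul_idem\<close> gives the action of the whole even part of
      \<open>a\<close>; removing the contribution of \<open>\<psi> b\<close> leaves that of the
      0-part.\<close>
    have a0: "pr b 0 a \<cdot> pr b l a = (1/2 - ?\<psi> * l) *s pr b l a" if "l \<noteq> 0" "l \<noteq> 1" for l
      using half[OF that] by (simp add: ev_def pr_one[OF fb] mul_simps mul_pr[OF fb] scale_left_diff_distrib
          eq_diff_eq add.commute)
    have ev: "\<exists>m. ev b v \<cdot> pr b l a = m *s pr b l a" if "v \<in> ?G" "l \<noteq> 0" "l \<noteq> 1" for v l
    proof -
      have "pr b 0 v \<in> ?G \<inter> eig b 0" "pr b 0 a \<in> ?G \<inter> eig b 0"
        using that(1) ab pr_mem_generated[OF fb] pr_mem[OF fb] by simp_all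
      then obtain d where d: "pr b 0 v = d *s pr b 0 a"
        using thin False unfolding thin_def by blast
      have "ev b v \<cdot> pr b l a = (coef b v * l + d * (1/2 - ?\<psi> * l)) *s pr b l a"
        by (simp add: ev_def pr_one[OF fb] d mul_simps mul_pr[OF fb] a0[OF that(2,3)] scale_left_distrib)
      then show ?thesis by blast
    qed
    \<comment> \<open>By \<open>pr_mul\<close> this set is closed under products, because even parts
      act as scalars by \<open>ev\<close>. As it contains \<open>a\<close> and \<open>b\<close>, it
      is all of \<open>?G\<close>.\<close>
    let ?K = "{v \<in> ?G. \<forall>l. l \<noteq> 0 \<longrightarrow> l \<noteq> 1 \<longrightarrow> (\<exists>c. pr b l v = c *s pr b l a)}"
    have "subalgebra ?K"
      unfolding subalgebra_def
    proof (intro conjI ballI)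
      show "subspace ?K"
      proof (rule subspaceI)
        show "0 \<in> ?K"
          using subspace_0[OF subspace_generated] by (auto simp: pr_zero[OF fb] intro: exI[of _ 0])
        show "x + y \<in> ?K" if "x \<in> ?K" "y \<in> ?K" for x y
          using that subspace_add[OF subspace_generated]
          by (auto simp: pr_add[OF fb]) (metis scale_left_distrib)
        show "r *s x \<in> ?K" if "x \<in> ?K" for r x
          using that subspace_scale[OF subspace_generated]
          by (auto simp: pr_scale[OF fb])
      qed
      fix x y assume x: "x \<in> ?K" and y: "y \<in> ?K"
      have "\<exists>c. pr b l (x \<cdot> y) = c *s pr b l a" if l: "l \<noteq> 0" "l \<noteq> 1" for l
      proof -
        obtain c d where cd: "pr b l x = c *s pr b l a" "pr b l y = d *s pr b l a"
          using x y l by blast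
        obtain m n where mn: "ev b x \<cdot> pr b l a = m *s pr b l a" "ev b y \<cdot> pr b l a = n *s pr b l a"
          using ev x y l by blast
        have "pr b l (x \<cdot> y) = (d * m + c * n) *s pr b l a"
          unfolding pr_mul[OF fb l] cd by (simp add: mul_simps mn scale_left_distrib)
        then show ?thesis by blast
      qed
      then show "x \<cdot> y \<in> ?K"
        using x y by (simp add: mul_mem_generated)
    qed
    moreover have "{a, b} \<subseteq> ?K"
      using ab by (auto simp: pr_axis[OF fb] intro: exI[of _ 1] exI[of _ 0])
    ultimately have "?G \<subseteq> ?K"
      by (rule generated_minimal[rotated])
    with u q have "\<exists>c. pr b q u = c *s pr b q a" by blast
    then show ?thesis
      using ev[OF u q] by blast
  qed
qed

text \<open>Let \<open>C u\<close> be the coefficient of the \<open>q\<close>-part of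
  \<open>u\<close> along \<open>pr b q a\<close>, and \<open>M u\<close> the scalar by which the
  even part of \<open>u\<close> acts on that vector. Then \<open>pr_mul\<close> becomes
  \<open>C (u \<cdot> v) = M u * C v + M v * C u\<close>, and every relation in the generated
  subalgebra yields a scalar equation. The witnesses \<open>c p\<close> and \<open>m p\<close> are
  the values of \<open>C\<close> and \<open>M\<close> at \<open>pr a p b\<close>.\<close>

lemma pair_column:
  assumes fa: "fusion_axis a" and fb: "fusion_axis b" and thin: "thin b a"
    and q: "q \<noteq> 0" "q \<noteq> 1" and y0: "pr b q a \<noteq> 0"
  defines "P \<equiv> {p. p \<noteq> 0 \<and> p \<noteq> 1 \<and> pr a p b \<noteq> 0}"
  shows "\<exists>c m. (\<forall>p\<in>P. pr b q (pr a p b) = c p *s pr b q a \<and> m p = (p - 1/2) * c p \<and>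
             c p * (q - 1/2 - 2 * m p) = 0) \<and>
           (\<forall>p\<in>P. \<forall>p'\<in>P. p \<noteq> p' \<longrightarrow> m p * c p' + m p' * c p = 0) \<and>
           (\<Sum>p\<in>P. p * c p) = q - coef a b \<and> (\<Sum>p\<in>P. p * m p) = coef b a * q - coef a b / 2"
proof -
  let ?G = "generated_subalgebra {a, b}" and ?y = "pr b q a"
  have ab: "a \<in> ?G" "b \<in> ?G"
    using generated_superset by blast+
  note idem = fusion_axis_idem[OF fa]
  have ex: "\<forall>u\<in>?G. \<exists>c. pr b q u = c *s ?y" "\<forall>u\<in>?G. \<exists>m. ev b u \<cdot> ?y = m *s ?y"
    using pair_scalars_mem[OF fb idem thin _ q] by blast+
  obtain C where "\<forall>u\<in>?G. pr b q u = C u *s ?y"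
    using bchoice[OF ex(1)] ..
  then have C: "\<And>u. u \<in> ?G \<Longrightarrow> pr b q u = C u *s ?y" by (rule bspec)
  obtain M where "\<forall>u\<in>?G. ev b u \<cdot> ?y = M u *s ?y"
    using bchoice[OF ex(2)] ..
  then have M: "\<And>u. u \<in> ?G \<Longrightarrow> ev b u \<cdot> ?y = M u *s ?y" by (rule bspec)
  have C_eq: "C u = k" if "u \<in> ?G" "pr b q u = k *s ?y" for u k
    using C[OF that(1)] that(2) y0 by simp
  have M_eq: "M u = k" if "u \<in> ?G" "ev b u \<cdot> ?y = k *s ?y" for u k
    using M[OF that(1)] that(2) y0 by simp
  have C_a: "C a = 1" and C_b: "C b = 0"
    using ab q by (auto intro!: C_eq simp: pr_axis[OF fb])
  have M_a: "M a = 1/2"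
    by (rule M_eq[OF ab(1) ev_mul_idem[OF fb idem q]])
  have M_b: "M b = q"
    by (rule M_eq[OF ab(2)]) (simp add: ev_axis[OF fb] mul_pr[OF fb])
  have C_mul: "C (u \<cdot> v) = M u * C v + M v * C u" if "u \<in> ?G" "v \<in> ?G" for u v
    using that by (intro C_eq mul_mem_generated)
      (simp_all add: pr_mul[OF fb q] C mul_simps M scale_left_distrib mult.commute)
  have x_mem: "pr a p b \<in> ?G" for p
    using pr_mem_generated[OF fa] ab by blast
  \<comment> \<open>This is \<open>a \<cdot> x = p x\<close> for \<open>x = pr a p b\<close>, read
    through \<open>C\<close> with \<open>C a = 1\<close> and \<open>M a = 1/2\<close>.\<close>
  have m: "M (pr a p b) = (p - 1/2) * C (pr a p b)" for p
  proof -
    have "C (a \<cdot> pr a p b) = p * C (pr a p b)"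
      by (rule C_eq[OF mul_mem_generated[OF ab(1) x_mem]])
        (simp add: mul_pr[OF fa] pr_scale[OF fb] C[OF x_mem])
    then show ?thesis
      using C_mul[OF ab(1) x_mem[of p]] by (simp add: M_a C_a algebra_simps)
  qed
  \<comment> \<open>This is \<open>b \<cdot> x = x/2 + x \<cdot> x\<close>, read through
    \<open>C\<close> with \<open>C b = 0\<close> and \<open>M b = q\<close>.\<close>
  have c: "C (pr a p b) * (q - 1/2 - 2 * M (pr a p b)) = 0" if "p \<noteq> 0" "p \<noteq> 1" for p
  proof -
    let ?x = "pr a p b"
    have xx: "?x \<cdot> ?x \<in> ?G"
      by (rule mul_mem_generated[OF x_mem x_mem])
    have "C (b \<cdot> ?x) = (1/2) * C ?x + C (?x \<cdot> ?x)"
      by (rule C_eq[OF mul_mem_generated[OF ab(2) x_mem]])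
        (simp add: idem_mul_pr[OF fa fusion_axis_idem[OF fb] that] pr_add[OF fb] pr_scale[OF fb]
          C[OF x_mem] C[OF xx] scale_left_distrib)
    then show ?thesis
      using C_mul[OF ab(2) x_mem[of p]] C_mul[OF x_mem[of p] x_mem[of p]]
      by (simp add: M_b C_b algebra_simps)
  qed
  have cm: "M (pr a p b) * C (pr a p' b) + M (pr a p' b) * C (pr a p b) = 0"
    if "p \<noteq> 0" "p \<noteq> 1" "p' \<noteq> 0" "p' \<noteq> 1" "p \<noteq> p'" for p p'
  proof -
    have "pr a p b \<cdot> pr a p' b = 0"
      using fusion_different[OF fa pr_mem[OF fa] pr_mem[OF fa] that(1-4)] that(5) by blast
    then have "C (pr a p b \<cdot> pr a p' b) = 0"
      by (intro C_eq mul_mem_generated x_mem) (simp add: pr_zero[OF fb])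
    then show ?thesis
      by (simp add: C_mul[OF x_mem x_mem])
  qed
  \<comment> \<open>The two sums arise by comparing the expansion of \<open>a \<cdot> b\<close>
    along \<open>a\<close> with what is known of it relative to \<open>b\<close>, first through
    \<open>C\<close> and then through \<open>M\<close>.\<close>
  have expand: "a \<cdot> b = coef a b *s a + (\<Sum>p\<in>P. p *s pr a p b)"
    unfolding P_def by (rule mul_axis_expand[OF fa])
  have "q *s ?y = pr b q (a \<cdot> b)"
    using C_mul[OF ab] C[OF mul_mem_generated[OF ab]] by (simp add: M_b C_a M_a C_b)
  also have "\<dots> = (coef a b + (\<Sum>p\<in>P. p * C (pr a p b))) *s ?y"
    unfolding expand
    by (simp add: pr_add[OF fb] pr_scale[OF fb] pr_sum[OF fb] C[OF x_mem] scale_left_distrib scale_sum_left)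
  finally have sum1: "(\<Sum>p\<in>P. p * C (pr a p b)) = q - coef a b"
    using y0 by (simp add: eq_diff_eq add.commute)
  have "ev b (b \<cdot> a) = coef b a *s b"
    unfolding mul_axis_expand[OF fb, of a]
    by (simp add: ev_add[OF fb] ev_scale[OF fb] ev_axis[OF fb] ev_sum[OF fb] ev_of_mem[OF fb pr_mem[OF fb]])
  then have "(coef b a * q) *s ?y = ev b (a \<cdot> b) \<cdot> ?y"
    by (simp add: mul_commute[of a b] mul_simps mul_pr[OF fb])
  also have "\<dots> = (coef a b * (1/2) + (\<Sum>p\<in>P. p * M (pr a p b))) *s ?y"
    unfolding expand
    by (simp add: ev_add[OF fb] ev_scale[OF fb] ev_sum[OF fb] mul_simps mul_sum_left M[OF x_mem] M[OF ab(1)] M_a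
        scale_left_distrib scale_sum_left)
  finally have sum2: "(\<Sum>p\<in>P. p * M (pr a p b)) = coef b a * q - coef a b / 2"
    using y0 by (simp add: eq_diff_eq add.commute)
  show ?thesis
    by (rule exI[of _ "\<lambda>p. C (pr a p b)"], rule exI[of _ "\<lambda>p. M (pr a p b)"])
      (use C[OF x_mem] m c cm sum1 sum2 in \<open>auto simp: P_def\<close>)
qed

end

section \<open>Pairs of axes\<close>

text \<open>In the application, \<open>c p\<close> is the coefficient of \<open>y\<^sub>q\<close> in \<open>x\<^sub>p\<close>, and \<open>m p\<close> is the scalar by which the
  even part of \<open>x\<^sub>p\<close> acts on \<open>y\<^sub>q\<close>.\<close>

lemma column_cases:
  fixes P :: "'f::field set" and c m :: "'f \<Rightarrow> 'f"
  assumes two: "(2::'f) \<noteq> 0" and fin: "finite P" and q: "q \<noteq> 0"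
    and m: "\<And>p. p \<in> P \<Longrightarrow> m p = (p - 1/2) * c p"
    and c: "\<And>p. p \<in> P \<Longrightarrow> c p * (q - 1/2 - 2 * m p) = 0"
    and cm: "\<And>p p'. p \<in> P \<Longrightarrow> p' \<in> P \<Longrightarrow> p \<noteq> p' \<Longrightarrow> m p * c p' + m p' * c p = 0"
    and s1: "(\<Sum>p\<in>P. p * c p) = q - \<phi>" and s2: "(\<Sum>p\<in>P. p * m p) = \<psi> * q - \<phi> / 2"
  shows "\<phi> = \<psi> \<or> 2 * q \<noteq> 1 \<and> (\<phi> = q \<and> 2 * \<psi> = 1 \<or>
    (\<exists>p\<in>P. (2 * p - 1) * (2 * \<phi> - 1) = (2 * q - 1) * (p - 1) \<and> q * (2 * \<psi> - 1) = p * (2 * \<phi> - 1)))"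
proof (cases "2 * q = 1")
  case True
  then have q_half: "q = 1/2"
    using two by (simp add: field_simps)
  \<comment> \<open>Now \<open>c p * m p = 0\<close> because \<open>q - 1/2 = 0\<close>, and
    \<open>m p\<close> is a multiple of \<open>c p\<close>; either way it vanishes.\<close>
  have "m p = 0" if "p \<in> P" for p
    using m[OF that] c[OF that] two by (auto simp: q_half)
  then have "\<psi> * q = \<phi> / 2"
    using s2 by simp
  then show ?thesis
    using two by (simp add: q_half field_simps)
next
  case False
  \<comment> \<open>Only indices with nonzero \<open>c p\<close> contribute to the sums. On them
    \<open>m p\<close> equals \<open>(2 * q - 1) / 4\<close>, independently of
    \<open>p\<close>.\<close>
  define N where "N = {p \<in> P. c p \<noteq> 0}"
  have N: "2 * (2 * m p) = 2 * q - 1" "2 * ((2 * p - 1) * c p) = 2 * q - 1" "c p \<noteq> 0" "p \<in> P" if "p \<in> N" for p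
  proof -
    show *: "c p \<noteq> 0" "p \<in> P"
      using that by (auto simp: N_def)
    have "2 * m p = q - 1/2"
      using c[OF *(2)] *(1) by simp
    then show *: "2 * (2 * m p) = 2 * q - 1"
      using two by (simp add: field_simps)
    have "2 * m p = (2 * p - 1) * c p"
      using m[OF \<open>p \<in> P\<close>] two by (simp add: field_simps)
    with * show "2 * ((2 * p - 1) * c p) = 2 * q - 1"
      by simp
  qed
  \<comment> \<open>Since \<open>m\<close> is constant and nonzero on \<open>N\<close>, the mixed
    relation gives \<open>c p + c p' = 0\<close>. Then \<open>m p = (p - 1/2) * c p\<close> forces
    \<open>p - 1/2\<close> to change sign too. A third index would have a coefficient opposite to
    two opposite numbers, so \<open>N\<close> has at most two elements.\<close>
  have neg: "c p' = - c p" "p + p' = 1" if "p \<in> N" "p' \<in> N" "p \<noteq> p'" for p p'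
  proof -
    have "m p * c p' + m p' * c p = 0"
      using cm N(4) that by blast
    then have "(2 * q - 1) * (c p + c p') = 0"
      using N(1)[OF that(1)] N(1)[OF that(2)] by algebra
    then have "c p + c p' = 0"
      using False by simp
    then show "c p' = - c p"
      by (simp add: eq_neg_iff_add_eq_0 add.commute)
    then have "2 * (2 * (p + p' - 1) * c p) = 0"
      using N(2)[OF that(1)] N(2)[OF that(2)] by algebra
    then have "p + p' - 1 = 0"
      using two N(3)[OF that(1)] by (simp only: mult_eq_0_iff simp_thms)
    then show "p + p' = 1"
      by (simp only: right_minus_eq)
  qed
  have fin_N: "finite N" "N \<subseteq> P"
    using fin by (auto simp: N_def)
  have sum1: "(\<Sum>p\<in>N. p * c p) = q - \<phi>"
    using s1 sum.mono_neutral_right[OF fin fin_N(2), of "\<lambda>p. p * c p"] by (auto simp: N_def)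
  have sum2: "(\<Sum>p\<in>N. p * m p) = \<psi> * q - \<phi> / 2"
    using s2 m sum.mono_neutral_right[OF fin fin_N(2), of "\<lambda>p. p * m p"] by (auto simp: N_def)
  have sum2': "2 * (\<Sum>p\<in>N. p * m p) = 2 * \<psi> * q - \<phi>"
    unfolding sum2 using two by (simp add: field_simps)
  consider "N = {}" | p where "N = {p}" | p p' where "p \<in> N" "p' \<in> N" "p \<noteq> p'"
    by blast
  then show ?thesis
  proof cases
    case 1
    then have "\<phi> = q" "2 * \<psi> * q = \<phi>"
      using sum1 sum2' by simp_all
    then have "2 * \<psi> = 1"
      using q by simp
    then show ?thesis
      using False \<open>\<phi> = q\<close> by blast
  next
    case (2 p)
    then have "p \<in> N" by blast
    note N = N[OF this]
    have "p * c p = q - \<phi>" "2 * (p * m p) = 2 * \<psi> * q - \<phi>"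
      using sum1 sum2' 2 by simp_all
    then have "(2 * p - 1) * (2 * \<phi> - 1) = (2 * q - 1) * (p - 1)"
      and "2 * (q * (2 * \<psi> - 1)) = 2 * (p * (2 * \<phi> - 1))"
      using N(1,2) by algebra+
    then show ?thesis
      using False N(4) two by auto
  next
    case (3 p p')
    have "N = {p, p'}"
    proof (rule ccontr)
      assume "N \<noteq> {p, p'}"
      then obtain r where "r \<in> N" "r \<noteq> p" "r \<noteq> p'"
        using 3 by blast
      then have "c r = - c p" "c r = - c p'" "c p' = - c p"
        using neg 3 by metis+
      then have "2 * c p = 0" by simp
      then show False
        using two N(3)[OF 3(1)] by simp
    qed
    then have "p * c p + p' * c p' = q - \<phi>" "2 * (p * m p + p' * m p') = 2 * \<psi> * q - \<phi>"
      using sum1 sum2' 3 by simp_all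
    \<comment> \<open>With \<open>p' = 1 - p\<close> and opposite coefficients, the first sum is
      \<open>(2 * p - 1) * c p = q - 1/2\<close>, hence \<phi> = 1/2. The second sum then gives
      \<psi> = 1/2.\<close>
    then have "2 * \<phi> = 1" "2 * (2 * (\<psi> * q) - \<phi>) = 2 * q - 1"
      using N(1,2)[OF 3(1)] N(1,2)[OF 3(2)] neg[OF 3] by algebra+
    then have \<phi>: "2 * \<phi> = 1" and "(2 * (2 * \<psi>) - 2) * q = 0"
      by algebra+
    then have "2 * (2 * \<psi>) = 2 * 1"
      using q by simp
    then have "2 * \<psi> = 2 * \<phi>"
      using two \<phi> by (metis mult_left_cancel)
    then show ?thesis
      using two by simp
  qed
qed

text \<open>The alternatives of \<open>column_cases\<close> are imposed for both orders of the pair.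
  They link each \<open>p\<close> to some \<open>q\<close> and conversely; multiplying the equations
  of a link gives \<open>(p - q) * (p + q - 1) = 0\<close>. As \<open>p = q\<close> would force
  \<phi> = \<psi>, every link has \<open>p + q = 1\<close>, and then
  \<open>p = 2 - 2 * \<phi>\<close> is determined.\<close>

lemma pair_rigid:
  fixes P Q :: "'f::field set" and \<phi> \<psi> :: 'f
  assumes two: "(2::'f) \<noteq> 0" and "P \<noteq> {}" "Q \<noteq> {}" "0 \<notin> P" "1 \<notin> P" "0 \<notin> Q" "1 \<notin> Q" "\<phi> \<noteq> \<psi>"
    and Q: "\<And>q. q \<in> Q \<Longrightarrow> 2 * q \<noteq> 1 \<and> (\<phi> = q \<and> 2 * \<psi> = 1 \<or>
      (\<exists>p\<in>P. (2 * p - 1) * (2 * \<phi> - 1) = (2 * q - 1) * (p - 1) \<and> q * (2 * \<psi> - 1) = p * (2 * \<phi> - 1)))"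
    and P: "\<And>p. p \<in> P \<Longrightarrow> 2 * p \<noteq> 1 \<and> (\<psi> = p \<and> 2 * \<phi> = 1 \<or>
      (\<exists>q\<in>Q. (2 * q - 1) * (2 * \<psi> - 1) = (2 * p - 1) * (q - 1) \<and> p * (2 * \<phi> - 1) = q * (2 * \<psi> - 1)))"
  shows "\<exists>p q. P = {p} \<and> Q = {q} \<and> p + q = 1 \<and> p \<noteq> q \<and> 2 * p \<noteq> 1 \<and> 2 * q \<noteq> 1"
proof -
  have not_both: "\<not> (2 * \<phi> = 1 \<and> 2 * \<psi> = 1)"
    using two \<open>\<phi> \<noteq> \<psi>\<close> by (metis mult_left_cancel)
  \<comment> \<open>If 2\<psi> = 1, the equation attached to any \<open>p\<close> has left side zero
    and would give \<open>q = 1\<close> for some \<open>q\<close> in \<open>Q\<close>. The argument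
    for \<phi> is the mirror image.\<close>
  have \<psi>: "2 * \<psi> \<noteq> 1"
  proof
    assume \<psi>: "2 * \<psi> = 1"
    obtain p where "p \<in> P" using \<open>P \<noteq> {}\<close> by blast
    then obtain q where "q \<in> Q" "(2 * q - 1) * (2 * \<psi> - 1) = (2 * p - 1) * (q - 1)" "2 * p \<noteq> 1"
      using P not_both \<psi> by blast
    then show False
      using \<psi> \<open>1 \<notin> Q\<close> by auto
  qed
  have \<phi>: "2 * \<phi> \<noteq> 1"
  proof
    assume \<phi>: "2 * \<phi> = 1"
    obtain q where "q \<in> Q" using \<open>Q \<noteq> {}\<close> by blast
    then obtain p where "p \<in> P" "(2 * p - 1) * (2 * \<phi> - 1) = (2 * q - 1) * (p - 1)" "2 * q \<noteq> 1"
      using Q not_both \<phi> by blast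
    then show False
      using \<phi> \<open>1 \<notin> P\<close> by auto
  qed
  have edge: "q \<in> Q \<and> p + q = 1 \<and> p = 2 - 2 * \<phi> \<and> p \<noteq> q"
    if pP: "p \<in> P" and qQ: "q \<in> Q" and 1: "(2 * q - 1) * (2 * \<psi> - 1) = (2 * p - 1) * (q - 1)"
      and 2: "p * (2 * \<phi> - 1) = q * (2 * \<psi> - 1)" for p q
  proof -
    obtain p' where "p' \<in> P" and 3: "(2 * p' - 1) * (2 * \<phi> - 1) = (2 * q - 1) * (p' - 1)"
      and 4: "q * (2 * \<psi> - 1) = p' * (2 * \<phi> - 1)"
      using Q[OF qQ] \<psi> by blast
    \<comment> \<open>Both are determined by \<open>q * (2 * \<psi> - 1)\<close> because 2\<phi> is
      not 1, so the link from \<open>q\<close> leads back to \<open>p\<close>.\<close>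
    have "p' = p"
      using 2 4 \<phi> by simp
    note 3 = 3[unfolded this]
    have nz: "p \<noteq> 0" "q \<noteq> 0" "2 * p - 1 \<noteq> 0" "2 * q - 1 \<noteq> 0"
      using P[OF pP] Q[OF qQ] pP qQ assms by auto
    \<comment> \<open>Eliminating \<phi> and \<psi> from the three equations. Since
      \<open>(2 * q - 1)\<close> squared is \<open>4 * q * (q - 1) + 1\<close>, the mixed terms on
      the two sides cancel.\<close>
    have "p * (2 * q - 1) * (2 * q - 1) * (p - 1) = q * (2 * p - 1) * (2 * p - 1) * (q - 1)"
      using 1 2 3 by algebra
    then have "(p - q) * (p + q - 1) = 0"
      by algebra
    then consider "p = q" | "p + q = 1"
      by auto
    then show ?thesis
    proof cases
      case 1
      then have "2 * \<phi> - 1 = 2 * \<psi> - 1"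
        using 2 nz by simp
      then show ?thesis
        using two \<open>\<phi> \<noteq> \<psi>\<close> by simp
    next
      case 2
      then have "(2 * p - 1) * (2 * \<phi> - 1) = (2 * p - 1) * (1 - p)"
        using 3 by algebra
      then have "2 * \<phi> - 1 = 1 - p"
        using nz by simp
      then have "p = 2 - 2 * \<phi>" by algebra
      moreover have "p \<noteq> q"
        using 2 nz(3) by auto
      ultimately show ?thesis
        using 2 qQ by blast
    qed
  qed
  have all_P: "\<exists>q\<in>Q. p + q = 1 \<and> p = 2 - 2 * \<phi> \<and> p \<noteq> q" if pP: "p \<in> P" for p
  proof -
    obtain q where "q \<in> Q" "(2 * q - 1) * (2 * \<psi> - 1) = (2 * p - 1) * (q - 1)" "p * (2 * \<phi> - 1) = q * (2 * \<psi> - 1)"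
      using P[OF pP] \<phi> by blast
    then show ?thesis
      using edge[OF pP] by blast
  qed
  obtain p where p: "p \<in> P"
    using \<open>P \<noteq> {}\<close> by blast
  obtain q where q: "q \<in> Q" "p + q = 1" "p = 2 - 2 * \<phi>" "p \<noteq> q"
    using all_P[OF p] by blast
  have PP: "P = {p}"
    using all_P p q(3) by blast
  \<comment> \<open>With \<open>P = {p}\<close>, the value \<open>(2 * q' - 1) * (p - 1)\<close> is
    the same for all \<open>q'\<close> in \<open>Q\<close>.\<close>
  have "q' = q" if "q' \<in> Q" for q'
  proof -
    have "(2 * q' - 1) * (p - 1) = (2 * q - 1) * (p - 1)"
      using Q[OF that] Q[OF q(1)] \<psi> unfolding PP by auto
    moreover have "p - 1 \<noteq> 0"
      using p assms by auto
    ultimately have "2 * q' = 2 * q" by simp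
    then show ?thesis
      using two by simp
  qed
  then have "Q = {q}"
    using q(1) by blast
  then show ?thesis
    using PP q P[OF p] Q[OF q(1)] by blast
qed

section \<open>The numerical constraints applied to two axes\<close>

context comm_algebra
begin

lemma pair_column_cases:
  assumes fa: "fusion_axis a" and fb: "fusion_axis b" and thin: "thin b a"
    and q: "q \<noteq> 0" "q \<noteq> 1" and y0: "pr b q a \<noteq> 0"
  defines "P \<equiv> {p. p \<noteq> 0 \<and> p \<noteq> 1 \<and> pr a p b \<noteq> 0}"
  shows "coef a b = coef b a \<or> 2 * q \<noteq> 1 \<and> (coef a b = q \<and> 2 * coef b a = 1 \<or>
    (\<exists>p\<in>P. (2 * p - 1) * (2 * coef a b - 1) = (2 * q - 1) * (p - 1) \<and>
      q * (2 * coef b a - 1) = p * (2 * coef a b - 1)))"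
proof -
  obtain c m where cm: "\<forall>p\<in>P. pr b q (pr a p b) = c p *s pr b q a \<and> m p = (p - 1/2) * c p \<and>
             c p * (q - 1/2 - 2 * m p) = 0"
    "\<forall>p\<in>P. \<forall>p'\<in>P. p \<noteq> p' \<longrightarrow> m p * c p' + m p' * c p = 0"
    "(\<Sum>p\<in>P. p * c p) = q - coef a b" "(\<Sum>p\<in>P. p * m p) = coef b a * q - coef a b / 2"
    using pair_column[OF fa fb thin q y0, folded P_def] by (elim exE conjE) (rule that)
  have m: "m p = (p - 1/2) * c p" and c: "c p * (q - 1/2 - 2 * m p) = 0" if "p \<in> P" for p
    using cm(1) that by blast+
  have mc: "m p * c p' + m p' * c p = 0" if "p \<in> P" "p' \<in> P" "p \<noteq> p'" for p p'
    using cm(2) that by blast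
  have "finite P"
    unfolding P_def by (rule finite_pr_odd[OF fa])
  from column_cases[OF two_nonzero this q(1) m c mc cm(3,4)] show ?thesis .
qed

text \<open>In \<open>pair_column\<close> the coefficient \<open>c\<close> is nonzero here, so its
  quadratic relation can be divided by it and gives \<open>2 * q - 1 = 2 * (2 * p - 1) * c\<close>.
  In this form, the \<open>q\<close>-part of \<open>a\<close> can be compared for different axes
  \<open>a\<close> sharing the same \<open>pr a p b\<close>.\<close>

lemma pair_coefficient:
  assumes fa: "fusion_axis a" and fb: "fusion_axis b" and thin: "thin b a"
    and p: "p \<noteq> 0" "p \<noteq> 1" and q: "q \<noteq> 0" "q \<noteq> 1" and x0: "pr b q (pr a p b) \<noteq> 0"
  shows "(2 * q - 1) *s pr b q a = (2 * (2 * p - 1)) *s pr b q (pr a p b)"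
proof -
  have y0: "pr b q a \<noteq> 0"
  proof
    assume "pr b q a = 0"
    moreover have "pr a p b \<in> generated_subalgebra {a, b}"
      using pr_mem_generated[OF fa] generated_superset by blast
    ultimately show False
      using pair_scalars_mem[OF fb fusion_axis_idem[OF fa] thin _ q] x0 by fastforce
  qed
  have "pr a p b \<noteq> 0"
    using x0 by (auto simp: pr_zero[OF fb])
  then obtain c m :: 'f where cm: "pr b q (pr a p b) = c *s pr b q a" "m = (p - 1/2) * c" "c * (q - 1/2 - 2 * m) = 0"
    using pair_column[OF fa fb thin q y0] p by blast
  then have "c \<noteq> 0"
    using x0 by auto
  then have "q - 1/2 = 2 * m"
    using cm(3) by simp
  moreover have "2 * m = (2 * p - 1) * c" "2 * (q - 1/2) = 2 * q - 1"
    using two_nonzero by (simp_all add: cm(2) field_simps)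
  ultimately have "2 * q - 1 = 2 * (2 * p - 1) * c"
    by (simp only: mult.assoc)
  then show ?thesis
    by (simp add: cm(1))
qed

text \<open>Without odd parts, \<open>b \<cdot> a = \<psi> b\<close>, so \<open>b\<close> is an
  eigenvector of \<open>a\<close>. Eigenvalue 0 gives \<phi> = 0; eigenvalue 1 makes
  \<open>b\<close> an idempotent multiple of \<open>a\<close>, hence \<phi> = 1. For any other
  eigenvalue \<open>b\<close> would have no even part, and \<open>ev_mul_idem\<close> would give
  \<open>b = 0\<close>.\<close>

lemma coef_eq_of_no_odd_part:
  assumes fa: "fusion_axis a" and fb: "fusion_axis b"
    and odd: "\<And>q. q \<noteq> 0 \<Longrightarrow> q \<noteq> 1 \<Longrightarrow> pr b q a = 0"
  shows "coef a b = coef b a"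
proof -
  let ?\<phi> = "coef a b" and ?\<psi> = "coef b a"
  have "{q. q \<noteq> 0 \<and> q \<noteq> 1 \<and> pr b q a \<noteq> 0} = {}"
    using odd by blast
  then have "b \<cdot> a = ?\<psi> *s b"
    using mul_axis_expand[OF fb, of a] by (simp only: sum.empty add_0_right)
  then have ab: "a \<cdot> b = ?\<psi> *s b"
    by (simp only: mul_commute[of a b])
  have pr_ab: "l *s pr a l b = ?\<psi> *s pr a l b" for l
    using pr_mul_axis[OF fa, of l b] by (simp only: ab pr_scale[OF fa])
  show ?thesis
  proof (cases "?\<psi> = 0 \<or> ?\<psi> = 1")
    case True
    then show ?thesis
    proof
      assume "?\<psi> = 0"
      then show ?thesis
        using pr_ab[of 1] fusion_axis_nonzero[OF fa] by (simp add: pr_one[OF fa])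
    next
      assume \<psi>: "?\<psi> = 1"
      have zero: "pr a l b = 0" if "l \<noteq> 1" for l
        using pr_ab[of l] that unfolding \<psi> by (simp only: scale_cancel_right simp_thms)
      then have "b = ?\<phi> *s a"
        using sum_pr_odd[OF fa, of b] by (simp add: ev_def pr_one[OF fa])
      then have "(?\<phi> *s a) \<cdot> (?\<phi> *s a) = ?\<phi> *s a"
        using fusion_axis_idem[OF fb] by simp
      then have "?\<phi> * ?\<phi> = ?\<phi>"
        using fusion_axis_nonzero[OF fa] by (simp add: mul_simps fusion_axis_idem[OF fa])
      moreover have "?\<phi> \<noteq> 0"
        using \<open>b = ?\<phi> *s a\<close> fusion_axis_nonzero[OF fb] by auto
      ultimately show ?thesis
        using \<psi> by simp
    qed
  next
    case False
    then have "pr a 1 b = 0" "pr a 0 b = 0"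
      using pr_ab[of 1] pr_ab[of 0] False by (simp_all only: scale_cancel_right) auto
    then have ev: "ev a b = 0"
      by (simp add: ev_def)
    have "pr a l b = 0" if "l \<noteq> 0" "l \<noteq> 1" for l
      using ev_mul_idem[OF fa fusion_axis_idem[OF fb] that] two_nonzero by (simp add: ev)
    then have "b = 0"
      using sum_pr_odd[OF fa, of b] by (simp add: ev)
    then show ?thesis
      using fusion_axis_nonzero[OF fb] by simp
  qed
qed

lemma pair_dichotomy:
  assumes fa: "fusion_axis a" and fb: "fusion_axis b" and "thin b a" "thin a b"
    and neq: "coef a b \<noteq> coef b a"
  shows "\<exists>p q. {p. p \<noteq> 0 \<and> p \<noteq> 1 \<and> pr a p b \<noteq> 0} = {p} \<and> {q. q \<noteq> 0 \<and> q \<noteq> 1 \<and> pr b q a \<noteq> 0} = {q} \<and>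
    p + q = 1 \<and> p \<noteq> q \<and> 2 * p \<noteq> 1 \<and> 2 * q \<noteq> 1"
proof (rule pair_rigid[OF two_nonzero _ _ _ _ _ _ neq])
  show "{p. p \<noteq> 0 \<and> p \<noteq> 1 \<and> pr a p b \<noteq> 0} \<noteq> {}"
    using coef_eq_of_no_odd_part[OF fb fa] neq by auto
  show "{q. q \<noteq> 0 \<and> q \<noteq> 1 \<and> pr b q a \<noteq> 0} \<noteq> {}"
    using coef_eq_of_no_odd_part[OF fa fb] neq by auto
next
  fix q assume "q \<in> {q. q \<noteq> 0 \<and> q \<noteq> 1 \<and> pr b q a \<noteq> 0}"
  then show "2 * q \<noteq> 1 \<and> (coef a b = q \<and> 2 * coef b a = 1 \<or>
      (\<exists>p\<in>{p. p \<noteq> 0 \<and> p \<noteq> 1 \<and> pr a p b \<noteq> 0}.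
        (2 * p - 1) * (2 * coef a b - 1) = (2 * q - 1) * (p - 1) \<and>
        q * (2 * coef b a - 1) = p * (2 * coef a b - 1)))"
    using pair_column_cases[OF fa fb \<open>thin b a\<close>, of q] neq by blast
next
  fix p assume "p \<in> {p. p \<noteq> 0 \<and> p \<noteq> 1 \<and> pr a p b \<noteq> 0}"
  then show "2 * p \<noteq> 1 \<and> (coef b a = p \<and> 2 * coef a b = 1 \<or>
      (\<exists>q\<in>{q. q \<noteq> 0 \<and> q \<noteq> 1 \<and> pr b q a \<noteq> 0}.
        (2 * q - 1) * (2 * coef b a - 1) = (2 * p - 1) * (q - 1) \<and>
        p * (2 * coef a b - 1) = q * (2 * coef b a - 1)))"
    using pair_column_cases[OF fb fa \<open>thin a b\<close>, of p] neq by auto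
qed simp_all

text \<open>Otherwise \<open>b\<close> and its mirror image \<open>b' = b - 2 x\<close> are orthogonal idempotents and \<open>b + b'\<close> is
  a multiple of \<open>a\<close>, which leaves no room for \<open>x\<close>.\<close>

lemma row_nonzero:
  assumes fa: "fusion_axis a" and fb: "fusion_axis b" and thin: "thin b a"
    and p: "p \<noteq> 0" "p \<noteq> 1" "2 * p \<noteq> 1" and x0: "pr a p b \<noteq> 0"
  shows "\<exists>q. q \<noteq> 0 \<and> q \<noteq> 1 \<and> pr b q (pr a p b) \<noteq> 0"
proof (rule ccontr)
  define x where "x = pr a p b"
  define b' where "b' = b - 2 *s x"
  let ?\<psi> = "coef b a"
  assume "\<not> ?thesis"
  then have odd: "pr b l x = 0" if "l \<noteq> 0" "l \<noteq> 1" for l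
    using that by (auto simp: x_def)
  define \<xi> where "\<xi> = coef b x"
  have ax: "a \<cdot> x = p *s x"
    by (simp add: x_def mul_pr[OF fa])
  have "{l. l \<noteq> 0 \<and> l \<noteq> 1 \<and> pr b l x \<noteq> 0} = {}"
    using odd by blast
  then have bx: "b \<cdot> x = \<xi> *s b" and x: "x = ev b x"
    using mul_axis_expand[OF fb, of x] sum_pr_odd[OF fb, of x] by (simp_all only: sum.empty add_0_right \<xi>_def)
  have prx: "pr a p x = x"
    by (simp add: x_def pr_pr[OF fa])
  \<comment> \<open>The product \<open>b' \<cdot> x\<close> is computed twice: by reflecting
    \<open>b \<cdot> x = \<xi> b\<close>, and from the formula of \<open>idem_mul_pr\<close>. The
    comparison gives \<open>x = 2 \<xi> x\<close>.\<close>
  have "b' \<cdot> (x - 2 *s x) = b \<cdot> x - 2 *s pr a p (b \<cdot> x)"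
    using reflect_mul[OF fa p(1,2), of b x] by (simp add: prx b'_def x_def[symmetric])
  also have "\<dots> = \<xi> *s b - 2 *s (\<xi> *s x)"
    by (simp add: bx pr_scale[OF fa] x_def[symmetric])
  also have "x - 2 *s x = - x"
    using scale_left_distrib[of 1 1 x] by simp
  finally have 1: "b' \<cdot> x = 2 *s (\<xi> *s x) - \<xi> *s b"
    by (simp add: mul_simps minus_equation_iff[of "b' \<cdot> x"])
  have "b \<cdot> x = (1/2) *s x + x \<cdot> x"
    unfolding x_def by (rule idem_mul_pr[OF fa fusion_axis_idem[OF fb] p(1,2)])
  then have "2 *s (b \<cdot> x) = 2 *s ((1/2) *s x) + 2 *s (x \<cdot> x)"
    by (simp only: scale_right_distrib)
  then have "2 *s (x \<cdot> x) = 2 *s (\<xi> *s b) - x"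
    using two_nonzero by (simp add: bx)
  then have "b' \<cdot> x = \<xi> *s b - (2 *s (\<xi> *s b) - x)"
    by (simp add: b'_def mul_simps bx)
  also have "\<dots> = x - \<xi> *s b"
    using scale_left_distrib[of 1 1 "\<xi> *s b"] by simp
  finally have "x = 2 *s (\<xi> *s x)"
    using 1 by simp
  then have "(2 * \<xi>) *s x = 1 *s x"
    by simp
  then have \<xi>: "2 * \<xi> = 1"
    using x0 unfolding x_def[symmetric] by (simp only: scale_cancel_right) simp
  have "2 *s x = 2 *s (\<xi> *s b + pr b 0 x)"
    using arg_cong[OF x, of "\<lambda>z. 2 *s z"] by (simp only: ev_def pr_one[OF fb] \<xi>_def)
  then have x2: "2 *s x = b + 2 *s pr b 0 x"
    using \<xi> by (simp add: scale_right_distrib)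
  \<comment> \<open>Because 2\<xi> = 1, the 1-part of \<open>2 x\<close> is exactly
    \<open>b\<close>, so \<open>b - 2 x\<close> lies in the 0-eigenspace of
    \<open>b\<close>.\<close>
  have "b' = - (2 *s pr b 0 x)"
    unfolding b'_def x2 by simp
  then have b'_eig: "b' \<in> eig b 0"
    by (simp add: subspace_neg[OF subspace_eig] subspace_scale[OF subspace_eig] pr_mem[OF fb])
  then have bb': "b \<cdot> b' = 0" "b' \<cdot> b = 0"
    by (simp_all add: mem_eig)
  have "pr a p b' = x - 2 *s x"
    by (simp add: b'_def pr_diff[OF fa] pr_scale[OF fa] prx x_def[symmetric])
  then have b'0: "b' \<noteq> 0"
    using x0 scale_left_distrib[of 1 1 x] by (auto simp: pr_zero[OF fa] x_def[symmetric])
  have b'_idem: "b' \<cdot> b' = b'"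
    using reflect_mul[OF fa p(1,2), of b b] by (simp add: fusion_axis_idem[OF fb] b'_def x_def)
  have diff: "b - b' = 2 *s x"
    by (simp add: b'_def)
  let ?G = "generated_subalgebra {a, b}"
  have ab: "a \<in> ?G" "b \<in> ?G"
    using generated_superset by blast+
  have "x \<in> ?G"
    unfolding x_def by (rule pr_mem_generated[OF fa _ ab(2)]) simp
  then have "b' \<in> ?G"
    unfolding b'_def using ab by (intro subspace_diff subspace_scale subspace_generated)
  \<comment> \<open>The nonzero vector \<open>b'\<close> spans the thin 0-eigenspace of
    \<open>b\<close>, which contains the 0-part of \<open>a\<close>.\<close>
  then obtain c where c: "pr b 0 a = c *s b'"
    using thin b'_eig b'0 pr_mem_generated[OF fb _ ab(1)] pr_mem[OF fb, of 0 a] unfolding thin_def by blast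
  let ?L = "{l. l \<noteq> 0 \<and> l \<noteq> 1 \<and> pr b l a \<noteq> 0}"
  define Y where "Y = (\<Sum>l\<in>?L. pr b l a)"
  define Z where "Z = (\<Sum>l\<in>?L. l *s pr b l a)"
  have a: "a = ?\<psi> *s b + c *s b' + Y"
    using sum_pr_odd[OF fb, of a] by (simp only: ev_def pr_one[OF fb] c Y_def)
  have a_b: "a \<cdot> b = ?\<psi> *s b + Z"
    unfolding Z_def mul_commute[of a b] by (rule mul_axis_expand[OF fb])
  \<comment> \<open>Both \<open>x\<close> and \<open>a \<cdot> x = p x\<close> are even for
    \<open>b\<close>. The \<open>l\<close>-part of \<open>a \<cdot> x\<close> is therefore zero, and
    \<open>pr_mul\<close> identifies it with \<open>x \<cdot> pr b l a\<close>. Hence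
    \<open>b\<close> and \<open>b' = b - 2 x\<close> act alike on \<open>pr b l a\<close>.\<close>
  have b'y: "b' \<cdot> pr b l a = l *s pr b l a" if l: "l \<noteq> 0" "l \<noteq> 1" for l
  proof -
    have "pr b l (a \<cdot> x) = x \<cdot> pr b l a"
      using pr_mul[OF fb l, of a x] x odd[OF l] by simp
    then have "2 *s (x \<cdot> pr b l a) = 0"
      by (simp add: ax pr_scale[OF fb] odd[OF l])
    then have "(b - b') \<cdot> pr b l a = 0"
      by (simp only: diff mul_scale_left)
    then show ?thesis
      by (simp add: mul_diff_left mul_pr[OF fb])
  qed
  have "b' \<cdot> a = b' \<cdot> (?\<psi> *s b + c *s b' + Y)"
    by (rule arg_cong[OF a])
  also have "\<dots> = c *s b' + Z"
    by (simp add: mul_simps bb' b'_idem Y_def Z_def mul_sum_right b'y)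
  finally have a_b': "a \<cdot> b' = c *s b' + Z"
    by (simp only: mul_commute[of a b'])
  \<comment> \<open>\<open>b - b' = 2 x\<close> is an eigenvector of \<open>a\<close> for
    \<open>p\<close>, while the odd contributions \<open>Z\<close> cancel. Comparing coefficients of
    \<open>b\<close> and \<open>b'\<close> gives \<psi> = c = p.\<close>
  have "p *s (b - b') = a \<cdot> (b - b')"
    unfolding diff by (simp add: mul_simps ax mult.commute)
  also have "\<dots> = ?\<psi> *s b - c *s b'"
    by (simp add: mul_diff_right a_b a_b')
  finally have "(?\<psi> - p) *s b = (c - p) *s b'"
    by (simp add: scale_left_diff_distrib scale_right_diff_distrib algebra_simps)
  moreover have "pr b 1 b' = 0"
    using pr_of_mem[OF fb b'_eig] by simp
  ultimately have "pr b 1 ((?\<psi> - p) *s b) = 0"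
    by (simp add: pr_scale[OF fb])
  then have \<psi>: "?\<psi> = p"
    using fusion_axis_nonzero[OF fb] by (simp add: pr_scale[OF fb] pr_axis[OF fb])
  then have c_p: "c = p"
    using \<open>(?\<psi> - p) *s b = (c - p) *s b'\<close> b'0 by simp
  have a: "a = p *s (b + b') + Y"
    using a unfolding \<psi> c_p by (simp only: scale_right_distrib)
  have ev_a: "ev b a = p *s b + p *s b'"
    by (simp add: ev_def pr_one[OF fb] c c_p \<psi>)
  \<comment> \<open>The even part \<open>p (b + b')\<close> acts on \<open>pr b l a\<close> as
    \<open>2 p l\<close>, which must be 1/2 by \<open>ev_mul_idem\<close>. Hence
    \<open>4 p Z = Y\<close>, and eliminating \<open>Y\<close> and \<open>Z\<close> leaves the
    relation \<open>key\<close> between \<open>a\<close> and \<open>b + b'\<close>.\<close>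
  have y: "(2 * (2 * (p * l))) *s pr b l a = pr b l a" if l: "l \<noteq> 0" "l \<noteq> 1" for l
  proof -
    have "(p * l) *s pr b l a + (p * l) *s pr b l a = (1/2) *s pr b l a"
      using ev_mul_idem[OF fb fusion_axis_idem[OF fa] l] by (simp add: ev_a mul_simps mul_pr[OF fb] b'y[OF l])
    then have "2 *s ((p * l + p * l) *s pr b l a) = 2 *s ((1/2) *s pr b l a)"
      by (simp only: scale_left_distrib)
    then show ?thesis
      using two_nonzero by (simp add: distrib_left mult_ac)
  qed
  have "(2 * (2 * p)) *s Z = (\<Sum>l\<in>?L. (2 * (2 * (p * l))) *s pr b l a)"
    by (simp add: Z_def scale_sum_right mult.assoc)
  also have "\<dots> = Y"
    unfolding Y_def using y by (intro sum.cong) auto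
  finally have Z: "(2 * (2 * p)) *s Z = Y" .
  have "a \<cdot> (b + b') = p *s (b + b') + (Z + Z)"
    by (simp add: mul_add_right a_b a_b' \<psi> c_p scale_right_distrib algebra_simps)
  then have "(2 * p) *s (a \<cdot> (b + b')) = (2 * p * p) *s (b + b') + (2 * (2 * p)) *s Z"
    by (simp add: scale_right_distrib scale_left_distrib[symmetric])
  also have "\<dots> = (2 * p * p) *s (b + b') + (a - p *s (b + b'))"
    using a unfolding Z by (simp only: add_diff_cancel_left')
  finally have key: "(2 * p) *s (a \<cdot> (b + b')) = (2 * p * p - p) *s (b + b') + a"
    by (simp add: scale_left_diff_distrib)
  have pr_b': "pr a l b' = pr a l b" if "l \<noteq> p" for l
    using pr_of_mem[OF fa pr_mem[OF fa, of p b], of l] that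
    by (simp add: b'_def pr_diff[OF fa] pr_scale[OF fa] x_def)
  \<comment> \<open>The 0-part of \<open>key\<close> relative to \<open>a\<close>: the reflection
    does not change 0-parts, and \<open>a\<close> has none.\<close>
  have "(2 * p * p - p) *s (pr a 0 b + pr a 0 b) = 0"
    using arg_cong[OF key, of "pr a 0"] p(1)
    by (simp add: pr_add[OF fa] pr_scale[OF fa] pr_mul_axis[OF fa] pr_axis[OF fa] pr_b')
  moreover have "2 * p * p - p \<noteq> 0"
    using p by (metis mult.commute mult_cancel_left1 right_minus_eq)
  ultimately have "pr a 0 b + pr a 0 b = 0"
    by simp
  then have b0: "pr a 0 b = 0"
    using half_double[of "pr a 0 b"] by simp
  let ?\<phi> = "coef a b"
  \<comment> \<open>With no 0-part, \<open>ev a b = \<phi> a\<close>, so the odd eigenvalues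
    \<open>k\<close> occurring in \<open>b\<close> all satisfy \<open>\<phi> k = 1/2\<close>. Thus
    \<open>p\<close> is the only one and \<open>b = \<phi> a + x\<close>.\<close>
  have k: "2 * (?\<phi> * k) = 1" if "k \<noteq> 0" "k \<noteq> 1" "pr a k b \<noteq> 0" for k
  proof -
    have "(?\<phi> * k) *s pr a k b = (1/2) *s pr a k b"
      using ev_mul_idem[OF fa fusion_axis_idem[OF fb] that(1,2)]
      by (simp add: ev_def b0 pr_one[OF fa] mul_simps mul_pr[OF fa])
    then have "?\<phi> * k = 1/2"
      using that(3) by simp
    then show ?thesis
      using two_nonzero by (simp only: times_divide_eq_right mult_1_right) simp
  qed
  have \<phi>p: "2 * (?\<phi> * p) = 1"
    using k p x0 by blast
  have "pr a k b = 0" if "k \<noteq> 1" "k \<noteq> p" for k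
  proof (rule ccontr)
    assume "pr a k b \<noteq> 0"
    then have "2 * (?\<phi> * k) = 2 * (?\<phi> * p)"
      using k[of k] b0 that \<phi>p by (cases "k = 0") auto
    moreover have "?\<phi> \<noteq> 0"
      using \<phi>p by auto
    ultimately show False
      using that two_nonzero by simp
  qed
  then have L: "pr a k (b - (?\<phi> *s a + x)) = 0" for k
    using p(2) by (cases "k = 1"; cases "k = p")
      (auto simp: pr_diff[OF fa] pr_add[OF fa] pr_scale[OF fa] pr_axis[OF fa] pr_one[OF fa] x_def pr_pr[OF fa])
  have "b - (?\<phi> *s a + x) = 0"
    by (rule pr_eqI[OF fa]) (simp only: L pr_zero[OF fa])
  then have "b = ?\<phi> *s a + x"
    by simp
  then have "b + b' = ?\<phi> *s a + x + (?\<phi> *s a + x - 2 *s x)"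
    unfolding b'_def by simp
  also have "\<dots> = (2 * ?\<phi>) *s a"
    using scale_left_distrib[of 1 1 x] scale_left_distrib[of ?\<phi> ?\<phi> a] by (simp add: algebra_simps)
  finally have "b + b' = (2 * ?\<phi>) *s a" .
  \<comment> \<open>Substituting \<open>b + b' = 2 \<phi> a\<close> into \<open>key\<close> and
    using \<open>2 \<phi> p = 1\<close> leads to \<open>p = 1\<close>.\<close>
  then have "(2 * p * (2 * ?\<phi>)) *s a = ((2 * p * p - p) * (2 * ?\<phi>) + 1) *s a"
    using key by (simp add: mul_simps fusion_axis_idem[OF fa] scale_left_distrib)
  then have "2 * p * (2 * ?\<phi>) = (2 * p * p - p) * (2 * ?\<phi>) + 1"
    using fusion_axis_nonzero[OF fa] by (simp only: scale_cancel_right) simp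
  then have "2 * (p - 1) = 0"
    using \<phi>p by algebra
  then show False
    using p(2) two_nonzero by simp
qed

section \<open>Commuting projections and common eigenvectors\<close>

lemma minus_double: "x - 2 *s x = - x"
  using scale_left_distrib[of 1 1 x] by simp

text \<open>Both sides equal \<open>ev a b \<cdot> pr a q z\<close>, by \<open>pr_mul\<close> and
  \<open>mul_odd\<close>.\<close>

lemma pr_commute_mul:
  assumes fa: "fusion_axis a" and q: "q \<noteq> 0" "q \<noteq> 1" and b: "pr a q b = 0"
  shows "pr a q (b \<cdot> z) = b \<cdot> pr a q z"
  using pr_mul[OF fa q, of b z] mul_odd[OF fa pr_mem[OF fa] q, of b] b by simp

text \<open>By \<open>pr_commute_mul\<close>, \<open>pr a q\<close> maps each eigenspace of
  \<open>b\<close> into itself, so it commutes with the projections onto these eigenspaces.\<close>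

lemma pr_commute_pr:
  assumes fa: "fusion_axis a" and fb: "fusion_axis b" and q: "q \<noteq> 0" "q \<noteq> 1" and b: "pr a q b = 0"
  shows "pr b r (pr a q z) = pr a q (pr b r z)"
proof (induction z rule: eig_induct[OF fb])
  case (1 k z)
  have "b \<cdot> pr a q z = k *s pr a q z"
    using pr_commute_mul[OF fa q b, of z] 1 by (simp add: mem_eig_iff pr_scale[OF fa])
  then have "pr a q z \<in> eig b k"
    by (simp add: mem_eig_iff)
  then show ?case
    using pr_of_mem[OF fb 1] pr_of_mem[OF fb, of "pr a q z" k] by (simp add: pr_zero[OF fa])
qed (simp add: pr_add[OF fa] pr_add[OF fb])

text \<open>The product \<open>a b\<close> acts on a common eigenvector \<open>v\<close> both as \<open>\<phi> s\<close> and as \<open>\<psi> r\<close>.\<close>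

lemma common_eigenvector:
  assumes fa: "fusion_axis a" and fb: "fusion_axis b"
    and P: "{p. p \<noteq> 0 \<and> p \<noteq> 1 \<and> pr a p b \<noteq> 0} = {p}" and Q: "{q. q \<noteq> 0 \<and> q \<noteq> 1 \<and> pr b q a \<noteq> 0} = {q}"
    and s: "s \<noteq> 0" "s \<noteq> 1" "s \<noteq> p" and v: "v \<in> eig a s" "v \<in> eig b r" "v \<noteq> 0"
  shows "r \<noteq> 1" "coef a b * s = coef b a * r"
proof -
  let ?x = "pr a p b" and ?y = "pr b q a"
  have p: "p \<noteq> 0" "p \<noteq> 1" and q: "q \<noteq> 0" "q \<noteq> 1"
    using P Q by blast+
  have b_s: "pr a s b = 0"
    using P s by blast
  show r: "r \<noteq> 1"
  proof
    assume r: "r = 1"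
    obtain c where c: "v = c *s b"
      using v(2)[unfolded r eig_one[OF fb]] by (rule rangeE)
    then have "pr a s v = 0"
      by (simp add: pr_scale[OF fa] b_s)
    then show False
      using pr_of_mem[OF fa v(1), of s] v(3) by simp
  qed
  have xv: "?x \<cdot> v = 0"
    using fusion_different[OF fa pr_mem[OF fa] v(1) p s(1,2)] s(3) by blast
  have av: "a \<cdot> v = s *s v" and bv: "b \<cdot> v = r *s v"
    using v by (simp_all add: mem_eig_iff)
  have a: "a = ev b a + ?y"
    using sum_pr_odd[OF fb, of a] unfolding Q by simp
  have "s *s v = ev b a \<cdot> v + ?y \<cdot> v"
    using arg_cong[OF a, of "\<lambda>z. z \<cdot> v"] by (simp only: av mul_add_left)
  then have yv': "?y \<cdot> v = s *s v - ev b a \<cdot> v"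
    by (simp only: eq_diff_eq add.commute)
  \<comment> \<open>For \<open>r = 0\<close> or \<open>r = q\<close> the product has two parities at
    once: the fusion rules for \<open>?y \<cdot> v\<close> give one and the right side of
    \<open>yv'\<close> the other. For the remaining \<open>r\<close> the two odd eigenspaces
    annihilate each other.\<close>
  have yv: "?y \<cdot> v = 0"
  proof -
    consider "r = 0" | "r \<noteq> 0" "r = q" | "r \<noteq> 0" "r \<noteq> q" by blast
    then show ?thesis
    proof cases
      case 1
      then have "v \<in> eig01 b"
        using v(2) eig_le_eig01 by blast
      then have "?y \<cdot> v \<in> eig b q"
        using fusion_even_odd[OF fb _ pr_mem[OF fb] q, of v] by (simp add: mul_commute)
      moreover have "?y \<cdot> v \<in> eig01 b"
        unfolding yv' using \<open>v \<in> eig01 b\<close> fusion_even_even[OF fb ev_mem[OF fb]]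
        by (intro subspace_diff subspace_scale subspace_eig01)
      ultimately show ?thesis
        using pr_eig01[OF fb _ q] pr_of_mem[OF fb, of _ q q] by metis
    next
      case 2
      then have "?y \<cdot> v \<in> eig b q"
        unfolding yv' using v(2) fusion_even_odd[OF fb ev_mem[OF fb] _ q]
        by (intro subspace_diff subspace_scale subspace_eig) simp_all
      moreover have "?y \<cdot> v \<in> eig01 b"
        using fusion_same[OF fb pr_mem[OF fb] _ q] v(2) 2 by simp
      ultimately show ?thesis
        using pr_eig01[OF fb _ q] pr_of_mem[OF fb, of _ q q] by metis
    next
      case 3
      then show ?thesis
        using fusion_different[OF fb pr_mem[OF fb] v(2) q _ r] by simp
    qed
  qed
  have "(a \<cdot> b) \<cdot> v = (coef a b * s) *s v"
    using mul_axis_expand[OF fa, of b] unfolding P by (simp add: mul_simps av xv)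
  moreover have "(b \<cdot> a) \<cdot> v = (coef b a * r) *s v"
    using mul_axis_expand[OF fb, of a] unfolding Q by (simp add: mul_simps bv yv)
  ultimately show "coef a b * s = coef b a * r"
    using v(3) by (simp add: mul_commute[of b a])
qed

end

section \<open>Symmetry of the projections\<close>

text \<open>The situation obtained from the closure of \<open>X\<close> by passing to the Jordan
  product. Reflections and equality of eigenvalues are asked away from 1/2, since the Jordan
  eigenspace for 1/2 may combine several of the original two-sided eigenspaces.\<close>

locale axial = comm_algebra scale mul
  for scale :: "'f::field \<Rightarrow> 'a::ab_group_add \<Rightarrow> 'a" (infixr \<open>*s\<close> 75)
    and mul :: "'a \<Rightarrow> 'a \<Rightarrow> 'a" (infixl \<open>\<cdot>\<close> 77) +
  fixes C :: "'a set"
  assumes fusion_axis_C: "a \<in> C \<Longrightarrow> fusion_axis a"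
    and thin_C: "a \<in> C \<Longrightarrow> b \<in> C \<Longrightarrow> thin a b"
    and reflect_C: "a \<in> C \<Longrightarrow> b \<in> C \<Longrightarrow> q \<noteq> 0 \<Longrightarrow> q \<noteq> 1 \<Longrightarrow> 2 * q \<noteq> 1 \<Longrightarrow> b - 2 *s pr a q b \<in> C"
    and same_eigenvalues: "a \<in> C \<Longrightarrow> b \<in> C \<Longrightarrow> q \<noteq> 0 \<Longrightarrow> q \<noteq> 1 \<Longrightarrow> 2 * q \<noteq> 1 \<Longrightarrow>
      eig b q \<noteq> {0} \<Longrightarrow> eig a q \<noteq> {0}"
    and span_C: "span C = UNIV"
begin

text \<open>The reflection \<open>\<tau>\<close> of \<open>a\<close> is multiplicative, so the
  projection of \<open>\<tau> b\<close> is the conjugate of that of \<open>b\<close>. When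
  \<open>a\<close> has no \<open>s\<close>-part for \<open>b\<close>, the projection
  \<open>pr b s\<close> commutes with \<open>\<tau>\<close>, and conjugation changes
  nothing.\<close>

lemma pr_reflect:
  assumes "a \<in> C" "b \<in> C" and q: "q \<noteq> 0" "q \<noteq> 1" "2 * q \<noteq> 1" and s: "s \<noteq> 0" "s \<noteq> 1" and a: "pr b s a = 0"
  shows "pr (b - 2 *s pr a q b) s z = pr b s z"
proof -
  have fa: "fusion_axis a" and fb: "fusion_axis b"
    using assms fusion_axis_C by blast+
  let ?b = "b - 2 *s pr a q b"
  let ?\<tau> = "\<lambda>z. z - 2 *s pr a q z"
  have fb': "fusion_axis ?b"
    using assms reflect_C fusion_axis_C by blast
  have invol: "?\<tau> (?\<tau> z) = z" for z
  proof -
    have "pr a q (?\<tau> z) = - pr a q z"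
      by (simp add: pr_diff[OF fa] pr_scale[OF fa] pr_pr[OF fa] minus_double)
    then show ?thesis by simp
  qed
  have "pr ?b s (?\<tau> z) = ?\<tau> (pr b s z)" for z
  proof (induction z rule: eig_induct[OF fb])
    case (1 k z)
    have "?b \<cdot> ?\<tau> z = ?\<tau> (k *s z)"
      using reflect_mul[OF fa q(1,2), of b z] 1 by (simp add: mem_eig_iff)
    then have "?\<tau> z \<in> eig ?b k"
      by (simp add: mem_eig_iff pr_scale[OF fa] scale_right_diff_distrib mult.commute)
    then show ?case
      using pr_of_mem[OF fb 1, of s] pr_of_mem[OF fb', of "?\<tau> z" k s] by (simp add: pr_zero[OF fa])
  qed (simp add: pr_add[OF fa] pr_add[OF fb] pr_add[OF fb'] scale_right_distrib pr_diff[OF fb'] algebra_simps)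
  from this[of "?\<tau> z"] have "pr ?b s z = ?\<tau> (pr b s (?\<tau> z))"
    unfolding invol .
  also have "\<dots> = ?\<tau> (?\<tau> (pr b s z))"
    by (simp add: pr_diff[OF fb] pr_scale[OF fb] pr_commute_pr[OF fb fa s a])
  finally show ?thesis
    unfolding invol .
qed

theorem coef_symmetric:
  assumes ab: "a \<in> C" "b \<in> C"
  shows "coef a b = coef b a"
proof (rule ccontr)
  let ?\<phi> = "coef a b" and ?\<psi> = "coef b a"
  assume neq: "?\<phi> \<noteq> ?\<psi>"
  note fa = fusion_axis_C[OF ab(1)] and fb = fusion_axis_C[OF ab(2)]
  obtain p q where P: "{p. p \<noteq> 0 \<and> p \<noteq> 1 \<and> pr a p b \<noteq> 0} = {p}" and Q: "{q. q \<noteq> 0 \<and> q \<noteq> 1 \<and> pr b q a \<noteq> 0} = {q}"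
    and "p + q = 1" and "p \<noteq> q" and p2: "2 * p \<noteq> 1" and q2: "2 * q \<noteq> 1"
    using pair_dichotomy[OF fa fb thin_C[OF ab(2,1)] thin_C[OF ab] neq] by (elim exE conjE) (rule that)
  have p: "p \<noteq> 0" "p \<noteq> 1" "pr a p b \<noteq> 0" and q: "q \<noteq> 0" "q \<noteq> 1" "pr b q a \<noteq> 0"
    using P Q by blast+
  have only_p: "pr a l b = 0" if "l \<noteq> 0" "l \<noteq> 1" "l \<noteq> p" for l
    using equalityD1[OF P] that by auto
  have only_q: "pr b l a = 0" if "l \<noteq> 0" "l \<noteq> 1" "l \<noteq> q" for l
    using equalityD1[OF Q] that by auto
  have bq: "pr a q b = 0"
    by (rule only_p[OF q(1,2) \<open>p \<noteq> q\<close>[symmetric]])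
  have "eig b q \<noteq> {0}" "eig a p \<noteq> {0}"
    using pr_mem[OF fb, of q a] pr_mem[OF fa, of p b] p q by blast+
  \<comment> \<open>Homogeneity: \<open>q\<close> occurs for \<open>b\<close>, \<open>p\<close>
    occurs for \<open>a\<close>, and neither is 1/2, so each occurs for the other axis too.\<close>
  then have ne: "eig a q \<noteq> {0}" "eig b p \<noteq> {0}"
    using same_eigenvalues ab p q p2 q2 by blast+
  \<comment> \<open>As \<open>b\<close> has no \<open>q\<close>-part for \<open>a\<close>, the
    projections commute, so \<open>pr b r z\<close> is a common eigenvector of \<open>a\<close> and
    \<open>b\<close>.\<close>
  have common: "r \<noteq> 1 \<and> ?\<phi> * q = ?\<psi> * r" if "z \<in> eig a q" "pr b r z \<noteq> 0" for z r
  proof -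
    have "pr b r z \<in> eig a q"
      using pr_mem[OF fa, of q "pr b r z"] pr_commute_pr[OF fa fb q(1,2) bq, of r z] pr_of_mem[OF fa that(1), of q]
      by simp
    then show ?thesis
      using common_eigenvector[OF fa fb P Q q(1,2) \<open>p \<noteq> q\<close>[symmetric] _ pr_mem[OF fb] that(2)] by blast
  qed
  have common': "r \<noteq> 1 \<and> ?\<psi> * s = ?\<phi> * r" if "s \<noteq> 0" "s \<noteq> 1" "s \<noteq> q" "z \<in> eig b s" "pr a r z \<noteq> 0" for z r s
  proof -
    have as: "pr b s a = 0"
      by (rule only_q[OF that(1-3)])
    have "pr a r z \<in> eig b s"
      using pr_mem[OF fb, of s "pr a r z"] pr_commute_pr[OF fb fa that(1,2) as, of r z] pr_of_mem[OF fb that(4), of s]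
      by simp
    then show ?thesis
      using common_eigenvector[OF fb fa Q P that(1-3) _ pr_mem[OF fa] that(5)] by blast
  qed
  have exists_pr: "\<exists>r. pr d r z \<noteq> 0" if "fusion_axis d" "z \<noteq> 0" for d z
    using pr_eqI[OF that(1), of z 0] pr_zero[OF that(1)] that(2) by metis
  obtain z0 where z0: "z0 \<in> eig a q" "z0 \<noteq> 0"
    using ne(1) subspace_0[OF subspace_eig, of a q] by blast
  obtain z1 where z1: "z1 \<in> eig b p" "z1 \<noteq> 0"
    using ne(2) subspace_0[OF subspace_eig, of b p] by blast
  obtain r where r: "pr b r z0 \<noteq> 0"
    using exists_pr[OF fb z0(2)] by blast
  have r1: "r \<noteq> 1" and \<phi>q: "?\<phi> * q = ?\<psi> * r"
    using common[OF z0(1) r] by blast+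
  have \<psi>0: "?\<psi> \<noteq> 0"
    using \<phi>q q neq by auto
  obtain r' where "pr a r' z1 \<noteq> 0"
    using exists_pr[OF fa z1(2)] by blast
  then have "?\<psi> * p = ?\<phi> * r'"
    using common'[OF p(1,2) \<open>p \<noteq> q\<close> z1(1)] by blast
  then have \<phi>0: "?\<phi> \<noteq> 0"
    using \<psi>0 p by auto
  have r0: "r \<noteq> 0" and rq: "r \<noteq> q"
    using \<phi>q \<phi>0 q neq by auto
  have ar: "pr b r a = 0"
    by (rule only_q[OF r0 r1 rq])
  \<comment> \<open>The relation \<open>\<phi> q = \<psi> r\<close> with nonzero \<phi> and \<psi>
    determines \<open>r\<close> from \<open>q\<close> and \<open>q\<close> from \<open>r\<close>. So
    each of the two projections fixes the image of the other; as they commute, they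
    coincide.\<close>
  have pr_eq: "pr a q z = pr b r z" for z
  proof -
    have "pr b s (pr a q z) = 0" if "s \<noteq> r" for s
    proof (rule ccontr)
      assume "pr b s (pr a q z) \<noteq> 0"
      then have "?\<psi> * s = ?\<psi> * r"
        using common[OF pr_mem[OF fa]] \<phi>q by metis
      then show False
        using that \<psi>0 by simp
    qed
    then have "pr b s (pr a q z) = pr b s (pr b r (pr a q z))" for s
      by (simp add: pr_pr[OF fb])
    then have 1: "pr a q z = pr b r (pr a q z)"
      by (rule pr_eqI[OF fb])
    have "pr a s (pr b r z) = 0" if "s \<noteq> q" for s
    proof (rule ccontr)
      assume "pr a s (pr b r z) \<noteq> 0"
      then have "?\<phi> * s = ?\<phi> * q"
        using common'[OF r0 r1 rq pr_mem[OF fb]] \<phi>q by metis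
      then show False
        using that \<phi>0 by simp
    qed
    then have "pr a s (pr b r z) = pr a s (pr a q (pr b r z))" for s
      by (simp add: pr_pr[OF fa])
    then have 2: "pr b r z = pr a q (pr b r z)"
      by (rule pr_eqI[OF fa])
    show ?thesis
      using 1 2 pr_commute_pr[OF fa fb q(1,2) bq, of r z] by simp
  qed
  have "\<exists>e\<in>C. pr a q e \<noteq> 0"
  proof (rule ccontr)
    assume "\<not> ?thesis"
    then have "span C \<subseteq> {z. pr a q z = 0}"
      by (intro span_minimal subspaceI) (auto simp: pr_zero[OF fa] pr_add[OF fa] pr_scale[OF fa])
    then have "pr a q z0 = 0"
      unfolding span_C by blast
    then show False
      using pr_of_mem[OF fa z0(1), of q] z0(2) by simp
  qed
  then obtain e where e: "e \<in> C" "pr a q e \<noteq> 0" by blast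
  note fe = fusion_axis_C[OF e(1)]
  obtain t where t: "t \<noteq> 0" "t \<noteq> 1" "pr e t (pr a q e) \<noteq> 0"
    using row_nonzero[OF fa fe thin_C[OF e(1) ab(1)] q(1,2) q2 e(2)] by blast
  let ?x = "pr e t (pr a q e)"
  \<comment> \<open>By \<open>pair_coefficient\<close>, the \<open>t\<close>-part of any axis
    \<open>d\<close> whose projection of \<open>e\<close> is \<open>pr a q e\<close> depends only on
    the eigenvalue \<open>s\<close>. This applies to four axes: \<open>a\<close>, \<open>b\<close>
    and their reflections in each other.\<close>
  have coef_t: "(2 * t - 1) *s pr e t d = (2 * (2 * s - 1)) *s ?x"
    if "d \<in> C" "s \<noteq> 0" "s \<noteq> 1" "pr d s e = pr a q e" for d s
    using pair_coefficient[OF fusion_axis_C[OF that(1)] fe thin_C[OF e(1) that(1)] that(2,3) t(1,2)] t(3)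
    unfolding that(4) by blast
  let ?a = "a - 2 *s pr b q a" and ?b = "b - 2 *s pr a p b"
  have a't: "(2 * t - 1) *s pr e t ?a = (2 * (2 * q - 1)) *s ?x"
    using pr_reflect[OF ab(2,1) q(1,2) q2 q(1,2) bq, of e] by (intro coef_t reflect_C ab q q2) simp
  have b't: "(2 * t - 1) *s pr e t ?b = (2 * (2 * r - 1)) *s ?x"
    using pr_reflect[OF ab p(1,2) p2 r0 r1 ar, of e] by (intro coef_t reflect_C ab p p2 r0 r1) (simp add: pr_eq)
  have at: "(2 * t - 1) *s pr e t a = (2 * (2 * q - 1)) *s ?x"
    by (rule coef_t[OF ab(1) q(1,2) refl])
  have bt: "(2 * t - 1) *s pr e t b = (2 * (2 * r - 1)) *s ?x"
    by (rule coef_t[OF ab(2) r0 r1 pr_eq[symmetric]])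
  have t2: "2 * t - 1 \<noteq> 0"
  proof
    assume "2 * t - 1 = 0"
    then have "(2 * (2 * q - 1)) *s ?x = 0"
      using at by simp
    then show False
      using q2 two_nonzero t(3) by (simp only: scale_eq_0_iff mult_eq_0_iff right_minus_eq simp_thms)
  qed
  \<comment> \<open>An axis and its reflection have the same \<open>t\<close>-part for
    \<open>e\<close>, so their difference, twice an odd part, has none.\<close>
  have "pr e t ?a = pr e t a" "pr e t ?b = pr e t b"
    using a't b't at bt t2 by (metis scale_cancel_left)+
  then have y: "pr e t (pr b q a) = 0" and x: "pr e t (pr a p b) = 0"
    using two_nonzero by (simp_all add: pr_diff[OF fe] pr_scale[OF fe])
  have "a \<cdot> b = ?\<phi> *s a + p *s pr a p b" "b \<cdot> a = ?\<psi> *s b + q *s pr b q a"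
    using mul_axis_expand[OF fa, of b] mul_axis_expand[OF fb, of a] unfolding P Q by simp_all
  \<comment> \<open>Equating the two expansions of \<open>a \<cdot> b\<close>: after taking
    \<open>t\<close>-parts only the multiples of \<open>a\<close> and \<open>b\<close> survive,
    giving \<open>\<phi> (2q - 1) = \<psi> (2r - 1)\<close>.\<close>
  then have "?\<phi> *s a + p *s pr a p b = ?\<psi> *s b + q *s pr b q a"
    by (simp add: mul_commute[of b a])
  then have "pr e t (?\<phi> *s a + p *s pr a p b) = pr e t (?\<psi> *s b + q *s pr b q a)"
    by (simp only:)
  then have "?\<phi> *s pr e t a = ?\<psi> *s pr e t b"
    by (simp add: pr_add[OF fe] pr_scale[OF fe] x y)
  then have "?\<phi> *s ((2 * t - 1) *s pr e t a) = ?\<psi> *s ((2 * t - 1) *s pr e t b)"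
    by (metis scale_left_commute)
  then have "?\<phi> * (2 * (2 * q - 1)) = ?\<psi> * (2 * (2 * r - 1))"
    unfolding at bt using t(3) by simp
  then have "2 * ?\<phi> = 2 * ?\<psi>"
    using \<phi>q by algebra
  then show False
    using neq two_nonzero by simp
qed

end

section \<open>Special axes and Miyamoto maps\<close>

lemma (in vector_space) is_direct_sum_image:
  assumes ds: "is_direct_sum I V" and sub: "\<And>i. i \<in> I \<Longrightarrow> subspace (V i)"
    and lin: "Vector_Spaces.linear scale scale g" and "bij g"
    and W: "\<And>i x. i \<in> I \<Longrightarrow> g x \<in> W i \<longleftrightarrow> x \<in> V i"
  shows "is_direct_sum I W"
proof (rule is_direct_sumI)
  interpret g: Vector_Spaces.linear scale scale g by fact
  have surj: "\<exists>x. y = g x" for y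
    using bij_is_surj[OF \<open>bij g\<close>] by (rule surjD)
  have W_eq: "W i = g ` V i" if "i \<in> I" for i
    using W[OF that] surj by (auto simp: image_iff) metis
  show "subspace (W i)" if "i \<in> I" for i
    unfolding W_eq[OF that] by (rule g.subspace_image[OF sub[OF that]])
  show "\<exists>M h. finite M \<and> M \<subseteq> I \<and> (\<forall>i\<in>M. h i \<in> W i) \<and> y = (\<Sum>i\<in>M. h i)" for y
  proof -
    obtain x where x: "y = g x"
      using surj by blast
    let ?M = "{i. dcomponent I V x i \<noteq> 0}"
    have M: "?M \<subseteq> I"
      using dcomponent_outside[OF ds] by blast
    have "y = (\<Sum>i\<in>?M. g (dcomponent I V x i))"
      unfolding x by (simp only: g.sum[symmetric] sum_dcomponent[OF ds])
    moreover have "\<forall>i\<in>?M. g (dcomponent I V x i) \<in> W i"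
      using M W dcomponent_mem[OF ds] by blast
    ultimately show ?thesis
      using finite_dcomponent[OF ds] M
      by (intro exI[of _ ?M] exI[of _ "\<lambda>i. g (dcomponent I V x i)"] conjI)
  qed
  show "h i = 0" if M: "finite M" "M \<subseteq> I" and h: "\<forall>i\<in>M. h i \<in> W i" and zero: "(\<Sum>i\<in>M. h i) = 0" and i: "i \<in> M"
    for M h i
  proof -
    have inv: "g (inv_into UNIV g y) = y" for y
      using bij_is_surj[OF \<open>bij g\<close>] by (rule surj_f_inv_f)
    let ?k = "\<lambda>i. inv_into UNIV g (h i)"
    have "g (\<Sum>i\<in>M. ?k i) = g 0"
      by (simp add: g.sum inv zero)
    then have "(\<Sum>i\<in>M. ?k i) = 0"
      using bij_is_inj[OF \<open>bij g\<close>] by (simp only: inj_eq)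
    moreover have "?k i \<in> V i" if "i \<in> M" for i
      using h M(2) that W[of i "?k i"] inv by auto
    ultimately have "dcomponent I V 0 = (\<lambda>i. if i \<in> M then ?k i else 0)"
      using M by (intro dcomponent_sum[OF ds sub]) simp_all
    moreover have "dcomponent I V 0 = (\<lambda>i. if i \<in> {} then 0 else 0)"
      by (rule dcomponent_sum[OF ds sub]) simp_all
    ultimately have "(if i \<in> M then ?k i else 0) = 0"
      by (metis (no_types, lifting))
    then have "?k i = 0"
      using i by simp
    then show ?thesis
      using inv[of "h i"] by simp
  qed
qed

section \<open>Joint eigenspaces of left and right multiplication\<close>

context nonassoc_algebra
begin

abbreviation axis_index :: "'a \<Rightarrow> ('f \<times> 'f) set" where
  "axis_index a \<equiv> {(1, 1), (0, 0)} \<union> S a"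

text \<open>\<open>eigen_sum_mem\<close> is used twice: the summands are first grouped by left
  eigenvalue, and within a group the right eigenvalues are distinct.\<close>

lemma eig2_sum_mem:
  assumes fin: "finite M" and g: "\<And>p. p \<in> M \<Longrightarrow> g p \<in> eig2 a p"
    and J: "subspace J" "\<And>x. x \<in> J \<Longrightarrow> a \<cdot> x \<in> J" "\<And>x. x \<in> J \<Longrightarrow> x \<cdot> a \<in> J"
    and sum: "(\<Sum>p\<in>M. g p) \<in> J"
  shows "\<forall>p\<in>M. g p \<in> J"
proof
  fix p assume p: "p \<in> M"
  let ?h = "\<lambda>m. \<Sum>p\<in>{p \<in> M. fst p = m}. g p"
  have g': "a \<cdot> g p = fst p *s g p" "g p \<cdot> a = snd p *s g p" if "p \<in> M" for p
    using g[OF that] by (simp_all add: mem_eig2)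
  have "\<forall>m\<in>fst ` M. ?h m \<in> J"
  proof (rule eigen_sum_mem[OF linear_mul_left[of a] _ _ J(1,2)])
    show "a \<cdot> ?h m = m *s ?h m" for m
      by (simp add: mul_sum_right g' scale_sum_right)
    show "(\<Sum>m\<in>fst ` M. ?h m) \<in> J"
      using sum sum.image_gen[OF fin, of g fst] by simp
  qed (use fin in simp_all)
  then have h: "?h (fst p) \<in> J"
    using p by blast
  let ?N = "{q \<in> M. fst q = fst p}"
  have inj: "inj_on snd ?N"
    by (auto intro!: inj_onI prod_eqI)
  let ?k = "\<lambda>n. g (fst p, n)"
  have "(\<Sum>n\<in>snd ` ?N. ?k n) = (\<Sum>q\<in>?N. ?k (snd q))"
    by (simp add: sum.reindex[OF inj])
  also have "\<dots> = ?h (fst p)"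
    by (intro sum.cong) (auto simp: prod_eq_iff)
  finally have "(\<Sum>n\<in>snd ` ?N. ?k n) \<in> J"
    using h by simp
  moreover have "?k n \<cdot> a = n *s ?k n" if "n \<in> snd ` ?N" for n
    using that g'(2) by auto
  ultimately have "\<forall>n\<in>snd ` ?N. ?k n \<in> J"
    using fin by (intro eigen_sum_mem[OF linear_mul_right[of a] _ _ J(1,3)]) simp_all
  then show "g p \<in> J"
    using p by (metis (mono_tags, lifting) imageI mem_Collect_eq prod.collapse)
qed

lemma eig2_nonzero_index: "z \<in> eig2 a p \<Longrightarrow> z \<noteq> 0 \<Longrightarrow> p \<in> axis_index a"
  by (cases p) (auto simp: S_def S_L_def S_R_def eigenvalues_def eigenspace_def left_mul_def right_mul_def mem_eig2)

text \<open>Simultaneous diagonalisation: an element is split by left eigenvalues, and each piece by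
  right eigenvalues. Because the two multiplications commute, the left eigenspaces are invariant
  under right multiplication, so the finer pieces remain left eigenvectors.\<close>

lemma axis_direct_sum:
  assumes "axis a"
  shows "is_direct_sum (axis_index a) (eig2 a)"
proof (rule is_direct_sumI)
  note ax = assms[unfolded axis_def idempotent_def]
  have dsL: "is_direct_sum (S_L a) (eigenspace (left_mul a))" and dsR: "is_direct_sum (S_R a) (eigenspace (right_mul a))"
    unfolding S_L_def S_R_def using ax by simp_all
  have comm: "a \<cdot> (z \<cdot> a) = (a \<cdot> z) \<cdot> a" for z
    using ax unfolding left_mul_def right_mul_def by (metis comp_apply)
  show "\<exists>M g. finite M \<and> M \<subseteq> axis_index a \<and> (\<forall>i\<in>M. g i \<in> eig2 a i) \<and> x = (\<Sum>i\<in>M. g i)" for x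
  proof -
    define u where "u = dcomponent (S_L a) (eigenspace (left_mul a)) x"
    define w where "w m = dcomponent (S_R a) (eigenspace (right_mul a)) (u m)" for m
    define M1 where "M1 = {m. u m \<noteq> 0}"
    define M2 where "M2 m = {n. w m n \<noteq> 0}" for m
    have fin: "finite M1" "finite (M2 m)" for m
      unfolding M1_def M2_def u_def w_def by (rule finite_dcomponent[OF dsL], rule finite_dcomponent[OF dsR])
    have u: "m \<in> S_L a" "a \<cdot> u m = m *s u m" if "m \<in> M1" for m
    proof -
      show *: "m \<in> S_L a"
        using that dcomponent_outside[OF dsL] unfolding M1_def u_def by blast
      show "a \<cdot> u m = m *s u m"
        using dcomponent_mem[OF dsL *, of x] by (simp add: u_def eigenspace_def left_mul_def)
    qed
    have w: "n \<in> S_R a" "w m n \<cdot> a = n *s w m n" if "n \<in> M2 m" for m n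
    proof -
      show *: "n \<in> S_R a"
        using that dcomponent_outside[OF dsR] unfolding M2_def w_def by blast
      show "w m n \<cdot> a = n *s w m n"
        using dcomponent_mem[OF dsR *, of "u m"] by (simp add: w_def eigenspace_def right_mul_def)
    qed
    have sum_w: "(\<Sum>n\<in>M2 m. w m n) = u m" for m
      unfolding M2_def w_def by (rule sum_dcomponent[OF dsR])
    have sum_u: "(\<Sum>m\<in>M1. u m) = x"
      unfolding M1_def u_def by (rule sum_dcomponent[OF dsL])
    have wL: "a \<cdot> w m n = m *s w m n" if m: "m \<in> M1" and n: "n \<in> M2 m" for m n
    proof -
      let ?J = "{z. a \<cdot> z = m *s z}"
      have "\<forall>n\<in>M2 m. w m n \<in> ?J"
      proof (rule eigen_sum_mem[OF linear_mul_right[of a] fin(2)])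
        show "subspace ?J"
          by (rule subspaceI) (auto simp: mul_simps scale_right_distrib mult.commute)
        show "z \<cdot> a \<in> ?J" if "z \<in> ?J" for z
          using that by (simp add: comm mul_scale_left)
        show "(\<Sum>n\<in>M2 m. w m n) \<in> ?J"
          unfolding sum_w using u[OF m] by simp
      qed (rule w)
      then show ?thesis
        using n by blast
    qed
    let ?M = "Sigma M1 M2" and ?g = "\<lambda>p. w (fst p) (snd p)"
    have "finite ?M"
      using fin by (rule finite_SigmaI)
    moreover have "?M \<subseteq> axis_index a"
      using u(1) w(1) by (auto simp: S_def)
    moreover have "\<forall>p\<in>?M. ?g p \<in> eig2 a p"
      using wL w(2) by (auto simp: mem_eig2)
    moreover have "x = (\<Sum>p\<in>?M. ?g p)"
      using sum.Sigma[of M1 M2 w] fin sum_w sum_u by (simp add: case_prod_beta')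
    ultimately show ?thesis
      by (intro exI[of _ ?M] exI[of _ ?g] conjI)
  qed
  show "g i = 0" if M: "finite M" and g: "\<forall>i\<in>M. g i \<in> eig2 a i" and "(\<Sum>i\<in>M. g i) = 0" and "i \<in> M" for M g i
    using eig2_sum_mem[of M g a "{0}"] that by simp
qed (rule subspace_eig2)

text \<open>The properties of a special axis that are used, in a form that passes to its images under
  automorphisms.\<close>

definition good_axis :: "'a \<Rightarrow> bool" where
  "good_axis a \<longleftrightarrow> a \<noteq> 0 \<and> a \<cdot> a = a \<and> is_direct_sum (axis_index a) (eig2 a) \<and>
     (\<forall>z. a \<cdot> (z \<cdot> a) = (a \<cdot> z) \<cdot> a) \<and> eig a 1 = range (\<lambda>c. c *s a) \<and> fusion_rules a \<and>
     (\<forall>b. idempotent b \<longrightarrow> (\<forall>u\<in>generated_subalgebra {a, b} \<inter> eig a 0.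
        \<forall>v\<in>generated_subalgebra {a, b} \<inter> eig a 0. v \<noteq> 0 \<longrightarrow> (\<exists>c. u = c *s v)))"

lemma dim_le_one_proportional:
  assumes "dim_le V 1" "u \<in> V" "v \<in> V" "v \<noteq> 0"
  shows "\<exists>c. u = c *s v"
proof (rule ccontr)
  assume no: "\<not> ?thesis"
  obtain D where D: "finite D" "V \<subseteq> span D" and dim: "dim V \<le> 1"
    using assms(1) unfolding dim_le_def by blast
  obtain B where B: "B \<subseteq> V" "independent B" "V \<subseteq> span B" "card B = dim V"
    using basis_exists by blast
  have "finite B"
    using independent_span_bound[OF D(1) B(2)] B(1) D(2) by blast
  have "u \<notin> span {v}"
    using no unfolding span_singleton by blast
  then have ind: "independent {u, v}"
    using assms(4) by (intro independent_insertI independent_empty) simp_all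
  have "u \<noteq> v"
    using no scale_one[of v] by metis
  have "card {u, v} \<le> card B"
    using independent_span_bound[OF \<open>finite B\<close> ind] assms(2,3) B(3) by blast
  then show False
    using \<open>u \<noteq> v\<close> dim B(4) by simp
qed

lemma special_good:
  assumes "special a"
  shows "good_axis a"
proof -
  note sp = assms[unfolded special_def weakly_primitive_def]
  have ax: "axis a"
    using sp by simp
  have "a \<cdot> (z \<cdot> a) = (a \<cdot> z) \<cdot> a" for z
    using ax[unfolded axis_def] unfolding left_mul_def right_mul_def by (metis comp_apply)
  moreover have "a \<noteq> 0" "a \<cdot> a = a"
    using ax by (simp_all add: axis_def idempotent_def)
  moreover have "\<exists>c. u = c *s v" if "idempotent b" "u \<in> generated_subalgebra {a, b} \<inter> eig a 0"
    "v \<in> generated_subalgebra {a, b} \<inter> eig a 0" "v \<noteq> 0" for b u v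
    using sp that by (intro dim_le_one_proportional[OF _ that(2-4)]) simp
  ultimately show ?thesis
    unfolding good_axis_def using axis_direct_sum[OF ax] sp by (intro conjI) auto
qed

section \<open>Components and \<open>phi\<close> with respect to a single axis\<close>

context
  fixes a assumes ga: "good_axis a"
begin

lemma good_nonzero: "a \<noteq> 0"
  and good_idem: "a \<cdot> a = a"
  and good_direct_sum: "is_direct_sum (axis_index a) (eig2 a)"
  and good_commute: "a \<cdot> (z \<cdot> a) = (a \<cdot> z) \<cdot> a"
  and good_eig_one: "eig a 1 = range (\<lambda>c. c *s a)"
  and good_fusion: "fusion_rules a"
  by (insert ga[unfolded good_axis_def], elim conjE, (assumption | simp; fail)+)

lemma good_thin:
  assumes "b \<cdot> b = b" "u \<in> generated_subalgebra {a, b}" "u \<in> eig a 0"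
    "v \<in> generated_subalgebra {a, b}" "v \<in> eig a 0" "v \<noteq> 0"
  shows "\<exists>c. u = c *s v"
  using ga assms unfolding good_axis_def idempotent_def by simp

lemma component_eig: "a \<cdot> component a y p = fst p *s component a y p" "component a y p \<cdot> a = snd p *s component a y p"
proof -
  have "component a y p \<in> eig2 a p"
  proof (cases "p \<in> axis_index a")
    case True
    then show ?thesis
      unfolding component_def by (rule dcomponent_mem[OF good_direct_sum])
  next
    case False
    show ?thesis
      unfolding component_def dcomponent_outside[OF good_direct_sum False] by (rule subspace_0[OF subspace_eig2])
  qed
  then show "a \<cdot> component a y p = fst p *s component a y p" "component a y p \<cdot> a = snd p *s component a y p"
    by (simp_all add: mem_eig2)
qed

lemma component_mem: "component a y p \<in> eig2 a p"
  using component_eig by (simp add: mem_eig2)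

lemma component_outside: "p \<notin> axis_index a \<Longrightarrow> component a y p = 0"
  unfolding component_def by (rule dcomponent_outside[OF good_direct_sum])

lemma finite_component: "finite {p. component a y p \<noteq> 0}"
  unfolding component_def by (rule finite_dcomponent[OF good_direct_sum])

lemma sum_component: "(\<Sum>p | component a y p \<noteq> 0. component a y p) = y"
  unfolding component_def by (rule sum_dcomponent[OF good_direct_sum])

lemma sum_component_superset:
  assumes "finite M" "{p. component a y p \<noteq> 0} \<subseteq> M"
  shows "(\<Sum>p\<in>M. component a y p) = y"
  using assms unfolding component_def by (rule sum_dcomponent_superset[OF good_direct_sum])

lemma linear_component: "Vector_Spaces.linear scale scale (\<lambda>y. component a y p)"
  unfolding component_def by (rule linear_dcomponent[OF good_direct_sum subspace_eig2])

lemma component_add: "component a (x + y) p = component a x p + component a y p"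
  and component_scale: "component a (c *s x) p = c *s component a x p"
  using linear_component[of p] unfolding Vector_Spaces.linear_iff by blast+

lemma component_zero: "component a 0 p = 0"
  using component_scale[of 0 0] by simp

lemma component_diff: "component a (x - y) p = component a x p - component a y p"
  using component_add[of "x - y" y] by (simp add: algebra_simps)

lemma component_of_mem:
  assumes "z \<in> eig2 a p"
  shows "component a z q = (if q = p then z else 0)"
proof (cases "z = 0")
  case False
  then have "p \<in> axis_index a"
    using assms eig2_nonzero_index by blast
  then show ?thesis
    unfolding component_def using assms by (intro dcomponent_of_mem[OF good_direct_sum subspace_eig2])
qed (simp add: component_zero)

lemma component_induct [consumes 0]:
  assumes "\<And>p x. p \<in> axis_index a \<Longrightarrow> x \<in> eig2 a p \<Longrightarrow> P x" "\<And>x y. P x \<Longrightarrow> P y \<Longrightarrow> P (x + y)"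
  shows "P x"
proof (rule direct_sum_induct[OF good_direct_sum, of P])
  show "P 0"
    by (rule assms(1)[of "(1, 1)"]) (simp_all add: subspace_0[OF subspace_eig2])
qed (use assms in blast)+

lemma component_one: "component a y (1, 1) = phi a y *s a"
proof -
  have "component a y (1, 1) \<in> eig a 1"
    unfolding eig_def by (rule component_mem)
  then obtain c where c: "component a y (1, 1) = c *s a"
    unfolding good_eig_one by (rule rangeE)
  have "phi a y = c"
    unfolding phi_def c using good_nonzero by simp
  with c show ?thesis by simp
qed

lemma phi_eq: "component a y (1, 1) = c *s a \<Longrightarrow> phi a y = c"
  using component_one[of y] good_nonzero by simp

lemma phi_add: "phi a (x + y) = phi a x + phi a y"
  by (rule phi_eq) (simp only: component_add, simp only: component_one scale_left_distrib)

lemma phi_scale: "phi a (c *s x) = c * phi a x"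
  by (rule phi_eq) (simp only: component_scale, simp only: component_one scale_scale)

lemma good_mem: "a \<in> eig2 a (1, 1)"
  by (simp add: mem_eig2 good_idem)

lemma phi_self: "phi a a = 1"
  by (rule phi_eq) (simp add: component_of_mem[OF good_mem])

lemma mul_component_sum:
  "a \<cdot> y = (\<Sum>p | component a y p \<noteq> 0. fst p *s component a y p)"
  "y \<cdot> a = (\<Sum>p | component a y p \<noteq> 0. snd p *s component a y p)"
  using arg_cong[OF sum_component[of y], of "\<lambda>z. a \<cdot> z"] arg_cong[OF sum_component[of y], of "\<lambda>z. z \<cdot> a"]
  by (simp_all add: mul_sum_right mul_sum_left component_eig)

lemma component_mul_axis:
  "component a (a \<cdot> y) p = fst p *s component a y p"
  "component a (y \<cdot> a) p = snd p *s component a y p"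
proof -
  have "component a (a \<cdot> y) p = fst p *s component a y p \<and> component a (y \<cdot> a) p = snd p *s component a y p"
  proof (induction y rule: component_induct)
    case (1 q y)
    then show ?case
      using component_of_mem[OF 1(2), of p] by (simp add: mem_eig2 component_scale)
  qed (simp add: mul_simps component_add scale_right_distrib)
  then show "component a (a \<cdot> y) p = fst p *s component a y p" "component a (y \<cdot> a) p = snd p *s component a y p"
    by blast+
qed

lemma good_eig01: "subalgebra (eig01 a)"
  and good_fusion_even: "p \<in> S a \<Longrightarrow> x \<in> eig01 a \<Longrightarrow> y \<in> eig2 a p \<Longrightarrow> x \<cdot> y \<in> eig2 a p \<and> y \<cdot> x \<in> eig2 a p"
  and good_fusion_same: "p \<in> S a \<Longrightarrow> x \<in> eig2 a p \<Longrightarrow> y \<in> eig2 a p \<Longrightarrow> x \<cdot> y \<in> eig01 a"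
  and good_fusion_different: "p \<in> S a \<Longrightarrow> q \<in> S a \<Longrightarrow> p \<noteq> q \<Longrightarrow> x \<in> eig2 a p \<Longrightarrow> y \<in> eig2 a q \<Longrightarrow> x \<cdot> y = 0"
  using good_fusion unfolding fusion_rules_def by fastforce+

lemma eig2_in_eig01: "p = (1, 1) \<or> p = (0, 0) \<Longrightarrow> x \<in> eig2 a p \<Longrightarrow> x \<in> eig01 a"
  using eig_le_eig01[of a] by (auto simp: eig_def)

lemma component_eig01: "x \<in> eig01 a \<Longrightarrow> p \<in> S a \<Longrightarrow> component a x p = 0"
proof -
  assume x: "x \<in> eig01 a" and p: "p \<in> S a"
  obtain u v where "x = u + v" "u \<in> eig2 a (1, 1)" "v \<in> eig2 a (0, 0)"
    using x unfolding eig01_def eig_def by blast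
  moreover have "p \<noteq> (1, 1)" "p \<noteq> (0, 0)"
    using p by (auto simp: S_def)
  ultimately show "component a x p = 0"
    by (simp only: component_add component_of_mem) simp
qed

text \<open>The two-sided version of \<open>pr_mul\<close>: by the fusion rules only an even part
  times a \<open>p\<close>-part, in either order, contributes to the \<open>p\<close>-part of a
  product.\<close>

lemma component_mul_odd:
  assumes p: "p \<in> S a"
  shows "component a (x \<cdot> y) p =
    (component a x (1, 1) + component a x (0, 0)) \<cdot> component a y p +
    component a x p \<cdot> (component a y (1, 1) + component a y (0, 0))"
proof (induction x arbitrary: y rule: component_induct)
  case (1 q x)
  note x = this
  show ?case
  proof (induction y rule: component_induct)
    case (1 r y)
    note y = this
    have even: "(1, 1) \<notin> S a" "(0, 0) \<notin> S a"
      by (simp_all add: S_def)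
    show ?case
    proof (cases "q \<in> S a"; cases "r \<in> S a")
      assume qr: "q \<in> S a" "r \<in> S a"
      have "component a (x \<cdot> y) p = 0"
      proof (cases "q = r")
        case True
        then show ?thesis
          using x y qr p by (intro component_eig01 good_fusion_same) auto
      next
        case False
        then show ?thesis
          using good_fusion_different[OF qr False x(2) y(2)] by (simp add: component_zero)
      qed
      moreover have "component a x (1, 1) = 0" "component a x (0, 0) = 0"
        "component a y (1, 1) = 0" "component a y (0, 0) = 0"
        using qr even by (auto simp: component_of_mem[OF x(2)] component_of_mem[OF y(2)])
      ultimately show ?thesis by simp
    next
      assume qr: "q \<in> S a" "r \<notin> S a"
      then have "x \<cdot> y \<in> eig2 a q"
        using x y eig2_in_eig01[of r y] good_fusion_even[of q y x] by auto
      moreover have "y = component a y (1, 1) + component a y (0, 0)"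
        using qr y(1) by (auto simp: component_of_mem[OF y(2)])
      moreover have "component a y p = 0"
        using qr p by (auto simp: component_of_mem[OF y(2)])
      ultimately show ?thesis
        using component_of_mem[of "x \<cdot> y" q p] component_of_mem[OF x(2), of p] by simp
    next
      assume qr: "q \<notin> S a" "r \<in> S a"
      then have "x \<cdot> y \<in> eig2 a r"
        using x y eig2_in_eig01[of q x] good_fusion_even[of r x y] by auto
      moreover have "x = component a x (1, 1) + component a x (0, 0)"
        using qr x(1) by (auto simp: component_of_mem[OF x(2)])
      moreover have "component a x p = 0"
        using qr p by (auto simp: component_of_mem[OF x(2)])
      ultimately show ?thesis
        using component_of_mem[of "x \<cdot> y" r p] component_of_mem[OF y(2), of p] by simp
    next
      assume qr: "q \<notin> S a" "r \<notin> S a"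
      then have "x \<in> eig01 a" "y \<in> eig01 a"
        using x y eig2_in_eig01 by auto
      then have "x \<cdot> y \<in> eig01 a"
        using good_eig01 unfolding subalgebra_def by blast
      moreover have "component a x p = 0" "component a y p = 0"
        using qr p by (auto simp: component_of_mem[OF x(2)] component_of_mem[OF y(2)])
      ultimately show ?thesis
        using component_eig01[of "x \<cdot> y" p] p by simp
    qed
  qed (simp add: mul_simps component_add algebra_simps)
qed (simp add: mul_simps component_add algebra_simps)

end

section \<open>Transport of structure by automorphisms\<close>

context
  fixes g assumes aut: "algebra_automorphism g"
begin

lemma automorphism_linear: "Vector_Spaces.linear scale scale g"
  and automorphism_bij: "bij g"
  and automorphism_mul: "g (x \<cdot> y) = g x \<cdot> g y"
  using aut by (simp_all add: algebra_automorphism_def)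

lemma automorphism_add: "g (x + y) = g x + g y"
  and automorphism_scale: "g (c *s x) = c *s g x"
  using automorphism_linear unfolding Vector_Spaces.linear_iff by blast+

lemma automorphism_zero: "g 0 = 0"
  using automorphism_scale[of 0 0] by simp

lemma automorphism_minus: "g (- x) = - g x"
  using automorphism_add[of x "- x"] by (simp add: automorphism_zero minus_unique)

lemma automorphism_sum: "g (\<Sum>i\<in>M. f i) = (\<Sum>i\<in>M. g (f i))"
  by (induction M rule: infinite_finite_induct) (simp_all add: automorphism_zero automorphism_add)

lemma automorphism_eq_iff: "g x = g y \<longleftrightarrow> x = y"
  by (rule inj_eq[OF bij_is_inj[OF automorphism_bij]])

lemma automorphism_eq_zero_iff: "g x = 0 \<longleftrightarrow> x = 0"
  using automorphism_eq_iff[of x 0] by (simp add: automorphism_zero)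

lemma automorphism_surjE:
  obtains x where "y = g x"
  using bij_is_surj[OF automorphism_bij] by (rule surjE)

lemma automorphism_eig2: "g z \<in> eig2 (g a) p \<longleftrightarrow> z \<in> eig2 a p"
  by (simp add: mem_eig2 automorphism_mul[symmetric] automorphism_scale[symmetric] automorphism_eq_iff)

lemma automorphism_eig: "g z \<in> eig (g a) l \<longleftrightarrow> z \<in> eig a l"
  by (simp add: eig_def automorphism_eig2)

lemma automorphism_S_L: "S_L (g a) = S_L a"
proof -
  have "m \<in> S_L (g a) \<longleftrightarrow> m \<in> S_L a" for m
  proof -
    have "(\<exists>z. z \<noteq> 0 \<and> g a \<cdot> z = m *s z) \<longleftrightarrow> (\<exists>z. g z \<noteq> 0 \<and> g a \<cdot> g z = m *s g z)"
      by (metis automorphism_surjE)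
    then show ?thesis
      by (simp add: S_L_def eigenvalues_def eigenspace_def left_mul_def automorphism_mul[symmetric]
          automorphism_scale[symmetric] automorphism_eq_iff automorphism_eq_zero_iff)
  qed
  then show ?thesis by blast
qed

lemma automorphism_S_R: "S_R (g a) = S_R a"
proof -
  have "m \<in> S_R (g a) \<longleftrightarrow> m \<in> S_R a" for m
  proof -
    have "(\<exists>z. z \<noteq> 0 \<and> z \<cdot> g a = m *s z) \<longleftrightarrow> (\<exists>z. g z \<noteq> 0 \<and> g z \<cdot> g a = m *s g z)"
      by (metis automorphism_surjE)
    then show ?thesis
      by (simp add: S_R_def eigenvalues_def eigenspace_def right_mul_def automorphism_mul[symmetric]
          automorphism_scale[symmetric] automorphism_eq_iff automorphism_eq_zero_iff)
  qed
  then show ?thesis by blast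
qed

lemma automorphism_S: "S (g a) = S a"
  by (simp add: S_def automorphism_S_L automorphism_S_R)

lemma eig2_nonzero_iff: "eig2 a p \<noteq> {0} \<longleftrightarrow> (\<exists>z\<in>eig2 a p. z \<noteq> 0)"
  using subspace_0[OF subspace_eig2, of a p] by blast

lemma automorphism_S_circ: "S_circ (g a) = S_circ a"
proof -
  have "(\<exists>z\<in>eig2 (g a) p. z \<noteq> 0) \<longleftrightarrow> (\<exists>z\<in>eig2 a p. z \<noteq> 0)" for p
    by (metis automorphism_eig2 automorphism_eq_zero_iff automorphism_surjE)
  then show ?thesis
    by (simp add: S_circ_def automorphism_S eig2_nonzero_iff)
qed

lemma automorphism_eig01: "g z \<in> eig01 (g a) \<longleftrightarrow> z \<in> eig01 a"
proof
  assume "z \<in> eig01 a"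
  then obtain x y where "z = x + y" "x \<in> eig a 1" "y \<in> eig a 0"
    unfolding eig01_def by blast
  then have "g z = g x + g y" "g x \<in> eig (g a) 1" "g y \<in> eig (g a) 0"
    by (simp_all add: automorphism_add automorphism_eig)
  then show "g z \<in> eig01 (g a)"
    unfolding eig01_def by blast
next
  assume "g z \<in> eig01 (g a)"
  then obtain x y where xy: "g z = x + y" "x \<in> eig (g a) 1" "y \<in> eig (g a) 0"
    unfolding eig01_def by blast
  obtain x' where x': "x = g x'" by (rule automorphism_surjE)
  obtain y' where y': "y = g y'" by (rule automorphism_surjE)
  have "z = x' + y'" "x' \<in> eig a 1" "y' \<in> eig a 0"
    using xy by (simp_all add: x' y' automorphism_add[symmetric] automorphism_eq_iff automorphism_eig)
  then show "z \<in> eig01 a"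
    unfolding eig01_def by blast
qed

lemma automorphism_fusion_rules:
  assumes "fusion_rules a"
  shows "fusion_rules (g a)"
proof -
  note f = assms[unfolded fusion_rules_def]
  have 1: "x \<cdot> y \<in> eig01 (g a)" if "x \<in> eig01 (g a)" "y \<in> eig01 (g a)" for x y
  proof -
    obtain x' where x: "x = g x'" by (rule automorphism_surjE)
    obtain y' where y: "y = g y'" by (rule automorphism_surjE)
    show ?thesis
      using f[THEN conjunct1] that unfolding subalgebra_def x y automorphism_mul[symmetric] automorphism_eig01 by blast
  qed
  have 2: "x \<cdot> y \<in> eig2 (g a) p \<and> y \<cdot> x \<in> eig2 (g a) p" if "p \<in> S a" "x \<in> eig01 (g a)" "y \<in> eig2 (g a) p" for p x y
  proof -
    obtain x' where x: "x = g x'" by (rule automorphism_surjE)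
    obtain y' where y: "y = g y'" by (rule automorphism_surjE)
    show ?thesis
      using f[THEN conjunct2, THEN conjunct1] that
      unfolding x y automorphism_mul[symmetric] automorphism_eig01 automorphism_eig2 by blast
  qed
  have 3: "if p = q then x \<cdot> y \<in> eig01 (g a) else x \<cdot> y = 0"
    if "p \<in> S a" "q \<in> S a" "x \<in> eig2 (g a) p" "y \<in> eig2 (g a) q" for p q x y
  proof -
    obtain x' where x: "x = g x'" by (rule automorphism_surjE)
    obtain y' where y: "y = g y'" by (rule automorphism_surjE)
    show ?thesis
      using f[THEN conjunct2, THEN conjunct2] that
      unfolding x y automorphism_mul[symmetric] automorphism_eig01 automorphism_eig2 automorphism_eq_zero_iff by blast
  qed
  show ?thesis
    unfolding fusion_rules_def automorphism_S subalgebra_def using 1 2 3 subspace_eig01 by blast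
qed

lemma automorphism_generated:
  assumes "x \<in> generated_subalgebra {g a, g b}"
  shows "x \<in> g ` generated_subalgebra {a, b}"
proof -
  have "subalgebra (g ` generated_subalgebra {a, b})"
  proof -
    interpret g: Vector_Spaces.linear scale scale g
      by (rule automorphism_linear)
    show ?thesis
      unfolding subalgebra_def using g.subspace_image[OF subspace_generated[of "{a, b}"]] mul_mem_generated[of _ "{a, b}"]
      by (auto simp: automorphism_mul[symmetric])
  qed
  moreover have "{g a, g b} \<subseteq> g ` generated_subalgebra {a, b}"
    using generated_superset[of "{a, b}"] by blast
  ultimately show ?thesis
    using generated_minimal assms by blast
qed

lemma automorphism_good:
  assumes ga: "good_axis a"
  shows "good_axis (g a)"
  unfolding good_axis_def
proof (intro conjI allI impI ballI)
  show "g a \<noteq> 0" "g a \<cdot> g a = g a"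
    using good_nonzero[OF ga] good_idem[OF ga] by (simp_all add: automorphism_eq_zero_iff automorphism_mul[symmetric])
  show "is_direct_sum (axis_index (g a)) (eig2 (g a))"
    unfolding automorphism_S
    by (rule is_direct_sum_image[OF good_direct_sum[OF ga] subspace_eig2 automorphism_linear automorphism_bij
          automorphism_eig2])
  show "g a \<cdot> (z \<cdot> g a) = (g a \<cdot> z) \<cdot> g a" for z
  proof -
    obtain z' where z: "z = g z'" by (rule automorphism_surjE)
    show ?thesis
      unfolding z automorphism_mul[symmetric] by (simp only: good_commute[OF ga])
  qed
  show "eig (g a) 1 = range (\<lambda>c. c *s g a)"
  proof -
    have "z \<in> eig (g a) 1 \<longleftrightarrow> (\<exists>c. z = c *s g a)" for z
    proof -
      obtain z' where z: "z = g z'" by (rule automorphism_surjE)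
      show ?thesis
        unfolding z automorphism_eig good_eig_one[OF ga] automorphism_scale[symmetric] automorphism_eq_iff by blast
    qed
    then show ?thesis by blast
  qed
  show "fusion_rules (g a)"
    by (rule automorphism_fusion_rules[OF good_fusion[OF ga]])
  show "\<exists>c. u = c *s v" if b: "idempotent b" and u: "u \<in> generated_subalgebra {g a, b} \<inter> eig (g a) 0"
    and v: "v \<in> generated_subalgebra {g a, b} \<inter> eig (g a) 0" "v \<noteq> 0" for b u v
  proof -
    obtain b' where b': "b = g b'" by (rule automorphism_surjE)
    obtain u' where u': "u = g u'" "u' \<in> generated_subalgebra {a, b'}"
      using u automorphism_generated unfolding b' by blast
    obtain v' where v': "v = g v'" "v' \<in> generated_subalgebra {a, b'}"
      using v automorphism_generated unfolding b' by blast
    have "b' \<cdot> b' = b'"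
      using b unfolding idempotent_def b' automorphism_mul[symmetric] automorphism_eq_iff .
    then have "\<exists>c. u' = c *s v'"
      using u v u'(2) v'(2) unfolding u'(1) v'(1)
      by (intro good_thin[OF ga]) (simp_all add: automorphism_eig automorphism_eq_zero_iff)
    then show ?thesis
      unfolding u'(1) v'(1) automorphism_scale[symmetric] automorphism_eq_iff .
  qed
qed

lemma automorphism_component:
  assumes ga: "good_axis a"
  shows "component (g a) (g y) p = g (component a y p)"
  using dcomponent_hom[OF good_direct_sum[OF ga] good_direct_sum[OF automorphism_good[OF ga], unfolded automorphism_S]
      subspace_eig2 automorphism_linear, of y p]
  unfolding component_def automorphism_S by (simp add: automorphism_eig2)

lemma automorphism_phi:
  assumes ga: "good_axis a"
  shows "phi (g a) (g y) = phi a y"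
  by (rule phi_eq[OF automorphism_good[OF ga]])
    (simp add: automorphism_component[OF ga] component_one[OF ga] automorphism_scale)

lemma automorphism_miyamoto:
  assumes ga: "good_axis a"
  shows "miyamoto (g a) S' (g y) = g (miyamoto a S' y)"
  unfolding miyamoto_def automorphism_component[OF ga] automorphism_eq_zero_iff automorphism_sum
  by (intro sum.cong) (simp_all add: automorphism_minus)

end

section \<open>Miyamoto maps as involutive automorphisms\<close>

lemma miyamoto_superset:
  assumes "finite M" "{p. component a y p \<noteq> 0} \<subseteq> M"
  shows "miyamoto a S' y = (\<Sum>p\<in>M. if p \<in> S' then - component a y p else component a y p)"
  unfolding miyamoto_def using assms by (intro sum.mono_neutral_left) auto

context
  fixes a assumes ga: "good_axis a"
begin

lemma miyamoto_linear: "Vector_Spaces.linear scale scale (miyamoto a S')"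
  unfolding Vector_Spaces.linear_iff
proof (intro conjI allI)
  show "miyamoto a S' (x + y) = miyamoto a S' x + miyamoto a S' y" for x y
  proof -
    let ?M = "{p. component a x p \<noteq> 0} \<union> {p. component a y p \<noteq> 0}"
    have fin: "finite ?M"
      using finite_component[OF ga] by simp
    have "{p. component a (x + y) p \<noteq> 0} \<subseteq> ?M"
      by (auto simp: component_add[OF ga])
    then have "miyamoto a S' (x + y) = (\<Sum>p\<in>?M. (if p \<in> S' then - component a x p else component a x p) +
        (if p \<in> S' then - component a y p else component a y p))"
      unfolding miyamoto_superset[OF fin \<open>{p. component a (x + y) p \<noteq> 0} \<subseteq> ?M\<close>]
      by (intro sum.cong) (simp_all add: component_add[OF ga])
    then show ?thesis
      using miyamoto_superset[OF fin Un_upper1] miyamoto_superset[OF fin Un_upper2] by (simp add: sum.distrib)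
  qed
  show "miyamoto a S' (c *s x) = c *s miyamoto a S' x" for c x
  proof -
    have sub: "{p. component a (c *s x) p \<noteq> 0} \<subseteq> {p. component a x p \<noteq> 0}"
      by (auto simp: component_scale[OF ga])
    show ?thesis
      unfolding miyamoto_superset[OF finite_component[OF ga] sub]
        miyamoto_superset[OF finite_component[OF ga, of x] subset_refl] scale_sum_right
      by (intro sum.cong) (simp_all add: component_scale[OF ga])
  qed
qed (use vector_space_axioms in simp_all)

lemma miyamoto_add: "miyamoto a S' (x + y) = miyamoto a S' x + miyamoto a S' y"
  using miyamoto_linear unfolding Vector_Spaces.linear_iff by blast

lemma miyamoto_of_mem:
  assumes "x \<in> eig2 a p"
  shows "miyamoto a S' x = (if p \<in> S' then - x else x)"
proof -
  have "{q. component a x q \<noteq> 0} \<subseteq> {p}"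
    by (auto simp: component_of_mem[OF ga assms])
  then have "miyamoto a S' x = (\<Sum>q\<in>{p}. if q \<in> S' then - component a x q else component a x q)"
    by (intro miyamoto_superset) simp_all
  then show ?thesis
    by (simp add: component_of_mem[OF ga assms])
qed

lemma miyamoto_miyamoto: "miyamoto a S' (miyamoto a S' x) = x"
proof (induction x rule: component_induct[OF ga])
  case (1 p x)
  have "- x \<in> eig2 a p"
    using 1(2) by (rule subspace_neg[OF subspace_eig2])
  then show ?case
    using miyamoto_of_mem[OF 1(2)] miyamoto_of_mem[of "- x" p] by simp
qed (simp add: miyamoto_add)

lemma miyamoto_eig01:
  assumes "S' \<subseteq> S a" "x \<in> eig01 a"
  shows "miyamoto a S' x = x"
proof -
  obtain u v where "x = u + v" "u \<in> eig2 a (1, 1)" "v \<in> eig2 a (0, 0)"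
    using assms(2) unfolding eig01_def eig_def by blast
  moreover have "(1, 1) \<notin> S'" "(0, 0) \<notin> S'"
    using assms(1) by (auto simp: S_def)
  ultimately show ?thesis
    by (simp only: miyamoto_add miyamoto_of_mem if_False)
qed

text \<open>On joint eigenvectors the signs match: an even factor preserves the index of an odd one,
  equal odd indices give an even product with sign \<open>(-1)(-1) = 1\<close>, and different odd
  indices give zero.\<close>

lemma miyamoto_mul:
  assumes S': "S' \<subseteq> S a"
  shows "miyamoto a S' (x \<cdot> y) = miyamoto a S' x \<cdot> miyamoto a S' y"
proof (induction x arbitrary: y rule: component_induct[OF ga])
  case (1 p x)
  note x = this
  show ?case
  proof (induction y rule: component_induct[OF ga])
    case (1 q y)
    note y = this
    note [simp] = miyamoto_of_mem[OF x(2)] miyamoto_of_mem[OF y(2)] mul_minus_left mul_minus_right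
    show ?case
    proof (cases "p \<in> S a"; cases "q \<in> S a")
      assume pq: "p \<in> S a" "q \<in> S a"
      show ?thesis
      proof (cases "p = q")
        case True
        then have "x \<cdot> y \<in> eig01 a"
          using good_fusion_same[OF ga pq(1) x(2)] y(2) by simp
        then show ?thesis
          using True miyamoto_eig01[OF S'] by simp
      next
        case False
        then have "x \<cdot> y = 0"
          using good_fusion_different[OF ga pq False x(2) y(2)] by simp
        then show ?thesis
          using miyamoto_of_mem[of 0 p] subspace_0[OF subspace_eig2, of a p] by simp
      qed
    next
      assume pq: "p \<in> S a" "q \<notin> S a"
      then have "y \<in> eig01 a"
        using y eig2_in_eig01[OF ga _ y(2)] by auto
      then have "x \<cdot> y \<in> eig2 a p"
        using good_fusion_even[OF ga pq(1) _ x(2)] by simp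
      moreover have "q \<notin> S'"
        using pq S' by blast
      ultimately show ?thesis
        using miyamoto_of_mem by simp
    next
      assume pq: "p \<notin> S a" "q \<in> S a"
      then have "x \<in> eig01 a"
        using x eig2_in_eig01[OF ga _ x(2)] by auto
      then have "x \<cdot> y \<in> eig2 a q"
        using good_fusion_even[OF ga pq(2) _ y(2)] by simp
      moreover have "p \<notin> S'"
        using pq S' by blast
      ultimately show ?thesis
        using miyamoto_of_mem by simp
    next
      assume pq: "p \<notin> S a" "q \<notin> S a"
      then have "x \<in> eig01 a" "y \<in> eig01 a"
        using x y eig2_in_eig01[OF ga _ x(2)] eig2_in_eig01[OF ga _ y(2)] by auto
      then have "x \<cdot> y \<in> eig01 a"
        using good_eig01[OF ga] unfolding subalgebra_def by blast
      moreover have "p \<notin> S'" "q \<notin> S'"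
        using pq S' by blast+
      ultimately show ?thesis
        using miyamoto_eig01[OF S'] by simp
    qed
  qed (simp add: mul_simps miyamoto_add)
qed (simp add: mul_simps miyamoto_add)

lemma miyamoto_automorphism: "S' \<subseteq> S a \<Longrightarrow> algebra_automorphism (miyamoto a S')"
  unfolding algebra_automorphism_def
  using miyamoto_linear miyamoto_mul by (auto intro: o_bij[of "miyamoto a S'"] simp: fun_eq_iff miyamoto_miyamoto)

lemma miyamoto_singleton:
  "miyamoto a {p} x = x - 2 *s component a x p"
proof (induction x rule: component_induct[OF ga])
  case (1 q x)
  have "x - 2 *s x = - x"
    using scale_left_distrib[of 1 1 x] by simp
  then show ?case
    using miyamoto_of_mem[OF 1(2), of "{p}"] component_of_mem[OF ga 1(2), of p] by auto
qed (simp add: miyamoto_add component_add[OF ga] scale_right_distrib)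

end

section \<open>The Miyamoto group and the span of the closure\<close>

lemma group_automorphism: "group automorphism_group"
proof (rule groupI)
  let ?A = automorphism_group
  show "f \<otimes>\<^bsub>?A\<^esub> h \<in> carrier ?A" if "f \<in> carrier ?A" "h \<in> carrier ?A" for f h
    using that unfolding automorphism_group_def algebra_automorphism_def Vector_Spaces.linear_iff
    by (auto intro: bij_comp)
  show "\<one>\<^bsub>?A\<^esub> \<in> carrier ?A"
    unfolding automorphism_group_def algebra_automorphism_def Vector_Spaces.linear_iff
    using vector_space_axioms by simp
  show "\<exists>h\<in>carrier ?A. h \<otimes>\<^bsub>?A\<^esub> f = \<one>\<^bsub>?A\<^esub>" if "f \<in> carrier ?A" for f
  proof -
    have f: "algebra_automorphism f"
      using that by (simp add: automorphism_group_def)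
    let ?h = "inv_into UNIV f"
    have h: "?h (f x) = x" "f (?h x) = x" for x
      using automorphism_bij[OF f] by (simp_all add: bij_is_inj bij_is_surj surj_f_inv_f)
    have "algebra_automorphism ?h"
      unfolding algebra_automorphism_def Vector_Spaces.linear_iff
    proof (intro conjI allI)
      show "bij ?h"
        by (rule bij_imp_bij_inv[OF automorphism_bij[OF f]])
      show "?h (x + y) = ?h x + ?h y" for x y
        by (subst automorphism_eq_iff[OF f, symmetric]) (simp add: automorphism_add[OF f] h)
      show "?h (c *s x) = c *s ?h x" for c x
        by (subst automorphism_eq_iff[OF f, symmetric]) (simp add: automorphism_scale[OF f] h)
      show "?h (x \<cdot> y) = ?h x \<cdot> ?h y" for x y
        by (subst automorphism_eq_iff[OF f, symmetric]) (simp add: automorphism_mul[OF f] h)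
    qed (use vector_space_axioms in simp_all)
    then show ?thesis
      using h by (intro bexI[of _ ?h]) (auto simp: automorphism_group_def fun_eq_iff)
  qed
qed (auto simp: automorphism_group_def comp_assoc)

context
  fixes X assumes X: "\<And>x. x \<in> X \<Longrightarrow> good_axis x"
begin

lemma miyamoto_generators: "{miyamoto x S' |x S'. x \<in> X \<and> S' \<subseteq> S x} \<subseteq> carrier automorphism_group"
  using X miyamoto_automorphism by (auto simp: automorphism_group_def)

lemma miyamoto_group_automorphism: "g \<in> miyamoto_group X \<Longrightarrow> algebra_automorphism g"
  using group.generate_in_carrier[OF group_automorphism miyamoto_generators]
  unfolding miyamoto_group_def by (simp add: automorphism_group_def)

lemma miyamoto_group_comp: "g \<in> miyamoto_group X \<Longrightarrow> h \<in> miyamoto_group X \<Longrightarrow> g \<circ> h \<in> miyamoto_group X"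
  unfolding miyamoto_group_def using generate.eng[of g automorphism_group] by (simp add: automorphism_group_def)

lemma miyamoto_group_inverse:
  assumes "g \<in> miyamoto_group X"
  obtains h where "h \<in> miyamoto_group X" "\<And>x. g (h x) = x"
proof -
  let ?h = "inv\<^bsub>automorphism_group\<^esub> g"
  have "?h \<in> miyamoto_group X"
    using group.generate_m_inv_closed[OF group_automorphism miyamoto_generators] assms
    unfolding miyamoto_group_def by blast
  moreover have "g \<in> carrier automorphism_group"
    using miyamoto_group_automorphism[OF assms] by (simp add: automorphism_group_def)
  then have "g \<otimes>\<^bsub>automorphism_group\<^esub> ?h = \<one>\<^bsub>automorphism_group\<^esub>"
    by (rule group.r_inv[OF group_automorphism])
  then have "g \<circ> ?h = id"
    by (simp add: automorphism_group_def)
  then have "g (?h x) = x" for x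
    by (metis comp_apply id_apply)
  ultimately show thesis by (rule that)
qed

lemma Cl_superset: "X \<subseteq> Cl X"
proof
  fix x assume "x \<in> X"
  moreover have "id \<in> miyamoto_group X"
    unfolding miyamoto_group_def using generate.one[of automorphism_group] by (simp add: automorphism_group_def)
  ultimately show "x \<in> Cl X"
    unfolding Cl_def by (auto intro!: exI[of _ x] exI[of _ id])
qed

lemma Cl_good: "a \<in> Cl X \<Longrightarrow> good_axis a"
  unfolding Cl_def using automorphism_good miyamoto_group_automorphism X by blast

lemma Cl_S_circ:
  assumes "a \<in> Cl X"
  obtains x where "x \<in> X" "S_circ a = S_circ x"
  using assms automorphism_S_circ miyamoto_group_automorphism unfolding Cl_def by blast

text \<open>The Miyamoto map of \<open>g x\<close> is the conjugate by \<open>g\<close> of the one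
  of \<open>x\<close>. Applied to \<open>b = h y\<close>, it is therefore a product of elements of
  the group, evaluated at \<open>y\<close>.\<close>

lemma Cl_miyamoto:
  assumes a: "a \<in> Cl X" and b: "b \<in> Cl X" and S': "S' \<subseteq> S a"
  shows "miyamoto a S' b \<in> Cl X"
proof -
  obtain x g where g: "a = g x" "x \<in> X" "g \<in> miyamoto_group X"
    using a unfolding Cl_def by blast
  obtain y h where h: "b = h y" "y \<in> X" "h \<in> miyamoto_group X"
    using b unfolding Cl_def by blast
  obtain k where k: "k \<in> miyamoto_group X" "\<And>z. g (k z) = z"
    using miyamoto_group_inverse[OF g(3)] by blast
  note aut = miyamoto_group_automorphism[OF g(3)]
  have "S' \<subseteq> S x"
    using S' automorphism_S[OF aut] by (simp add: g(1))
  then have "miyamoto x S' \<in> miyamoto_group X"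
    unfolding miyamoto_group_def using g(2) by (intro generate.incl) blast
  then have "g \<circ> (miyamoto x S' \<circ> (k \<circ> h)) \<in> miyamoto_group X"
    using g(3) h(3) k(1) by (intro miyamoto_group_comp)
  moreover have "miyamoto a S' b = (g \<circ> (miyamoto x S' \<circ> (k \<circ> h))) y"
    using automorphism_miyamoto[OF aut X[OF g(2)], of S' "k b"] by (simp add: g(1) h(1) k(2))
  ultimately show ?thesis
    unfolding Cl_def using h(2) by blast
qed

text \<open>The difference of \<open>b\<close> and its image under the Miyamoto map for
  \<open>{p}\<close> is twice the component, and 2 is invertible.\<close>

lemma component_in_span_Cl:
  assumes two: "(2::'f) \<noteq> 0" and a: "a \<in> Cl X" and b: "b \<in> Cl X" and p: "p \<in> S a"
  shows "component a b p \<in> span (Cl X)"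
proof -
  have "miyamoto a {p} b \<in> Cl X"
    using p by (intro Cl_miyamoto[OF a b]) blast
  then have "b - (b - 2 *s component a b p) \<in> span (Cl X)"
    unfolding miyamoto_singleton[OF Cl_good[OF a]] using b by (intro span_diff span_base)
  then have "2 *s component a b p \<in> span (Cl X)"
    by simp
  then have "(1/2) *s (2 *s component a b p) \<in> span (Cl X)"
    by (rule span_scale)
  then show ?thesis
    using two by simp
qed

text \<open>For \<open>a\<close> and \<open>b\<close> in the closure, \<open>a \<cdot> b\<close> is
  a combination of \<open>a\<close> and odd components of \<open>b\<close>, the 0-part being killed
  by \<open>a\<close>. So the span is closed under products and contains the generators.\<close>

lemma span_Cl:
  assumes two: "(2::'f) \<noteq> 0" and gen: "generated_subalgebra X = UNIV"
  shows "span (Cl X) = UNIV"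
proof -
  have ab: "a \<cdot> b \<in> span (Cl X)" if a: "a \<in> Cl X" and b: "b \<in> Cl X" for a b
  proof -
    note ga = Cl_good[OF a]
    have "fst p *s component a b p \<in> span (Cl X)" for p
    proof (cases "p \<in> axis_index a")
      case True
      then consider "p = (1, 1)" | "p = (0, 0)" | "p \<in> S a" by blast
      then show ?thesis
      proof cases
        case 1
        then show ?thesis
          using a by (simp add: component_one[OF ga] span_scale span_base)
      next
        case 2
        then show ?thesis by (simp add: span_zero)
      next
        case 3
        then show ?thesis
          by (intro span_scale component_in_span_Cl[OF two a b])
      qed
    qed (simp add: component_outside[OF ga] span_zero)
    then show ?thesis
      unfolding mul_component_sum(1)[OF ga] by (intro span_sum)
  qed
  have mul: "x \<cdot> b \<in> span (Cl X)" if "x \<in> span (Cl X)" "b \<in> Cl X" for x b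
    using that(1)
    by (induction x rule: span_induct_alt) (use ab[OF _ that(2)] in \<open>simp_all add: mul_simps span_zero span_add span_scale\<close>)
  have "x \<cdot> y \<in> span (Cl X)" if "x \<in> span (Cl X)" "y \<in> span (Cl X)" for x y
    using that(2)
    by (induction y rule: span_induct_alt) (use mul[OF that(1)] in \<open>simp_all add: mul_simps span_zero span_add span_scale\<close>)
  then have "subalgebra (span (Cl X))"
    unfolding subalgebra_def by simp
  moreover have "X \<subseteq> span (Cl X)"
    using Cl_superset span_superset by blast
  ultimately have "generated_subalgebra X \<subseteq> span (Cl X)"
    by (rule generated_minimal[rotated])
  then show ?thesis
    using gen by blast
qed

end

section \<open>The Jordan product\<close>

lemma good_mul_odd:
  assumes ga: "good_axis a" and z: "z \<in> eig2 a p" and p: "p \<in> S a"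
  shows "u \<cdot> z = (component a u (1, 1) + component a u (0, 0)) \<cdot> z + component a u p \<cdot> z"
    and "z \<cdot> u = z \<cdot> (component a u (1, 1) + component a u (0, 0)) + z \<cdot> component a u p"
proof -
  have "u \<cdot> z = (component a u (1, 1) + component a u (0, 0)) \<cdot> z + component a u p \<cdot> z \<and>
    z \<cdot> u = z \<cdot> (component a u (1, 1) + component a u (0, 0)) + z \<cdot> component a u p"
  proof (induction u rule: component_induct[OF ga])
    case (1 q u)
    have "(1, 1) \<notin> S a" "(0, 0) \<notin> S a"
      by (simp_all add: S_def)
    then show ?case
      using 1 p good_fusion_different[OF ga _ p _ 1(2) z] good_fusion_different[OF ga p _ _ z 1(2)]
      by (auto simp: component_of_mem[OF ga 1(2)])
  qed (simp add: mul_simps component_add[OF ga] algebra_simps)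
  then show "u \<cdot> z = (component a u (1, 1) + component a u (0, 0)) \<cdot> z + component a u p \<cdot> z"
    "z \<cdot> u = z \<cdot> (component a u (1, 1) + component a u (0, 0)) + z \<cdot> component a u p"
    by blast+
qed

text \<open>The commutator \<open>d\<close> of \<open>a\<close> and \<open>c\<close> satisfies \<open>a d + d a = d\<close>; this is read off from the decomposition
  of \<open>a\<close> with respect to \<open>c\<close>, and then applied to the components of \<open>d\<close> with respect to \<open>a\<close>.\<close>

lemma nonsymmetric_eigenvalues:
  assumes ga: "good_axis a" and gc: "good_axis c"
    and p: "component a c p \<noteq> 0" "fst p \<noteq> snd p"
  shows "fst p + snd p = 1"
proof -
  define y where "y q = component c a q" for q
  define e where "e = y (1, 1) + y (0, 0)"
  define T where "T = {q \<in> S c. y q \<noteq> 0}"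
  define d where "d = a \<cdot> c - c \<cdot> a"
  have fin: "finite T"
    unfolding T_def y_def by (rule finite_subset[OF _ finite_component[OF gc, of a]]) blast
  have T: "q \<in> S c" "(1, 1) \<notin> T" "(0, 0) \<notin> T" if "q \<in> T" for q
    using that by (auto simp: T_def S_def)
  have notin: "(1, 1) \<notin> T" "(0, 0) \<notin> T"
    by (simp_all add: T_def S_def)
  have "{q. y q \<noteq> 0} \<subseteq> insert (1, 1) (insert (0, 0) T)"
    using component_outside[OF gc, of _ a] unfolding T_def y_def by blast
  then have "(\<Sum>q\<in>insert (1, 1) (insert (0, 0) T). y q) = a"
    unfolding y_def using fin by (intro sum_component_superset[OF gc]) simp_all
  then have a: "a = y (1, 1) + (y (0, 0) + (\<Sum>q\<in>T. y q))"
    using fin notin by simp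
  have cy: "c \<cdot> y q = fst q *s y q" "y q \<cdot> c = snd q *s y q" and y_mem: "y q \<in> eig2 c q" for q
    unfolding y_def by (rule component_eig[OF gc] component_mem[OF gc])+
  have ca: "c \<cdot> a = y (1, 1) + (\<Sum>q\<in>T. fst q *s y q)"
    using arg_cong[OF a, of "\<lambda>z. c \<cdot> z"] by (simp add: mul_add_right mul_sum_right cy)
  have ac: "a \<cdot> c = y (1, 1) + (\<Sum>q\<in>T. snd q *s y q)"
    using arg_cong[OF a, of "\<lambda>z. z \<cdot> c"] by (simp add: mul_add_left mul_sum_left cy)
  have d: "d = (\<Sum>q\<in>T. (snd q - fst q) *s y q)"
    by (simp add: d_def ca ac scale_left_diff_distrib sum_subtractf)
  define EV where "EV z = component c z (1, 1) + component c z (0, 0)" for z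
  have EV_add: "EV (u + v) = EV u + EV v" and EV_scale: "EV (r *s u) = r *s EV u" for u v r
    unfolding EV_def by (simp_all add: component_add[OF gc] component_scale[OF gc] scale_right_distrib)
  have EV_sum: "EV (\<Sum>q\<in>M. f q) = (\<Sum>q\<in>M. EV (f q))" for M and f :: "'f \<times> 'f \<Rightarrow> 'a"
    using EV_scale[of 0 0] by (induction M rule: infinite_finite_induct) (simp_all add: EV_add)
  have EV_eig01: "EV z = z" if z: "z \<in> eig01 c" for z
  proof -
    obtain u v where "z = u + v" "u \<in> eig2 c (1, 1)" "v \<in> eig2 c (0, 0)"
      using z unfolding eig01_def eig_def by blast
    then show ?thesis
      by (simp add: EV_add) (simp add: EV_def component_of_mem[OF gc])
  qed
  have EV_odd: "EV z = 0" if "z \<in> eig2 c q" "q \<in> S c" for z q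
    using that unfolding EV_def by (auto simp: component_of_mem[OF gc that(1)] S_def)
  have e_mem: "e \<in> eig01 c"
    unfolding e_def
    by (rule subspace_add[OF subspace_eig01 eig2_in_eig01[OF gc _ y_mem[of "(1, 1)"]]
          eig2_in_eig01[OF gc _ y_mem[of "(0, 0)"]]]) simp_all
  have ay: "a \<cdot> y q = e \<cdot> y q + y q \<cdot> y q" "y q \<cdot> a = y q \<cdot> e + y q \<cdot> y q" if "q \<in> T" for q
    using good_mul_odd[OF gc y_mem T(1)[OF that], of a] unfolding e_def y_def by blast+
  have EV_ay: "EV (a \<cdot> y q) = y q \<cdot> y q" "EV (y q \<cdot> a) = y q \<cdot> y q" if "q \<in> T" for q
    using good_fusion_even[OF gc T(1)[OF that] e_mem y_mem] good_fusion_same[OF gc T(1)[OF that] y_mem y_mem]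
    by (simp_all add: ay[OF that] EV_add EV_eig01 EV_odd[OF _ T(1)[OF that]])
  have y1: "y (1, 1) = phi c a *s c"
    unfolding y_def by (rule component_one[OF gc])
  have "EV (y (1, 1)) = y (1, 1)"
    using EV_eig01 eig2_in_eig01[OF gc _ y_mem] by blast
  then have "EV (a \<cdot> c) = y (1, 1)" "EV (c \<cdot> a) = y (1, 1)"
    using EV_odd[OF y_mem T(1)] by (simp_all add: ca ac EV_add EV_sum EV_scale)
  then have "EV (a \<cdot> y (1, 1)) = EV (y (1, 1) \<cdot> a)"
    by (simp add: y1 mul_simps EV_scale)
  \<comment> \<open>Even parts relative to \<open>c\<close> are compared in
    \<open>a (c a) = (a c) a\<close>. The terms with the 1-part of \<open>a\<close> agree, so the
    difference consists of the squares of the odd parts weighted by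
    \<open>snd q - fst q\<close>.\<close>
  moreover have "EV (a \<cdot> (c \<cdot> a)) = EV ((a \<cdot> c) \<cdot> a)"
    by (simp only: good_commute[OF ga])
  then have "EV (a \<cdot> y (1, 1)) + (\<Sum>q\<in>T. fst q *s (y q \<cdot> y q)) =
      EV (y (1, 1) \<cdot> a) + (\<Sum>q\<in>T. snd q *s (y q \<cdot> y q))"
    by (simp add: ca ac mul_add_left mul_add_right mul_sum_left mul_sum_right mul_scale_left mul_scale_right
        EV_add EV_sum EV_scale EV_ay)
  ultimately have squares: "(\<Sum>q\<in>T. (snd q - fst q) *s (y q \<cdot> y q)) = 0"
    by (simp add: scale_left_diff_distrib sum_subtractf)
  \<comment> \<open>Idempotency of \<open>a\<close> says that its even part \<open>e\<close> acts on
    \<open>y q\<close> from both sides with total 1.\<close>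
  have odd: "a \<cdot> y q + y q \<cdot> a = y q + (y q \<cdot> y q + y q \<cdot> y q)" if "q \<in> T" for q
  proof -
    have "e \<cdot> y q + y q \<cdot> e = y q"
      using component_mul_odd[OF gc T(1)[OF that], of a a] good_idem[OF ga] unfolding e_def y_def by simp
    then show ?thesis
      unfolding ay[OF that] by (metis (no_types, lifting) add.assoc add.commute)
  qed
  have "a \<cdot> d + d \<cdot> a = (\<Sum>q\<in>T. (snd q - fst q) *s (a \<cdot> y q + y q \<cdot> a))"
    by (simp add: d mul_sum_left mul_sum_right mul_scale_left mul_scale_right scale_right_distrib sum.distrib)
  also have "\<dots> = (\<Sum>q\<in>T. (snd q - fst q) *s (y q + (y q \<cdot> y q + y q \<cdot> y q)))"
    using odd by (intro sum.cong) simp_all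
  also have "\<dots> = d"
    using squares by (simp add: d scale_right_distrib sum.distrib)
  \<comment> \<open>On the \<open>p\<close>-part for \<open>a\<close>, the operator
    \<open>d \<mapsto> a d + d a\<close> is multiplication by \<open>fst p + snd p\<close>. That
    part of \<open>d\<close> is nonzero because \<open>fst p\<close> and \<open>snd p\<close>
    differ.\<close>
  finally have "component a (a \<cdot> d + d \<cdot> a) p = component a d p"
    by simp
  then have "(fst p + snd p) *s component a d p = 1 *s component a d p"
    by (simp add: component_add[OF ga] component_mul_axis[OF ga] scale_left_distrib)
  moreover have "component a d p = (fst p - snd p) *s component a c p"
    by (simp add: d_def component_diff[OF ga] component_mul_axis[OF ga] scale_left_diff_distrib)
  then have "component a d p \<noteq> 0"
    using p by simp
  ultimately show ?thesis
    by (simp only: scale_cancel_right simp_thms)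
qed

text \<open>The factor 1/2 keeps idempotents idempotent and turns a two-sided eigenvector into an
  eigenvector for the average of its eigenvalues.\<close>

definition jordan :: "'a \<Rightarrow> 'a \<Rightarrow> 'a" where
  "jordan x y = (1/2) *s (x \<cdot> y + y \<cdot> x)"

lemma jordan_comm_algebra:
  assumes "(2::'f) \<noteq> 0"
  shows "comm_algebra scale jordan"
proof (intro comm_algebra.intro nonassoc_algebra.intro nonassoc_algebra_axioms.intro comm_algebra_axioms.intro)
  show "Vector_Spaces.linear scale scale (\<lambda>z. jordan y z)" "Vector_Spaces.linear scale scale (\<lambda>z. jordan z y)" for y
    unfolding Vector_Spaces.linear_iff jordan_def
    using vector_space_axioms by (simp_all add: mul_simps scale_right_distrib mult.commute add_ac)
qed (use assms vector_space_axioms in \<open>simp_all add: jordan_def add.commute\<close>)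

end

text \<open>These are the properties of the closure of \<open>X\<close> from which the form is
  built. Homogeneity is stated for diagonal indices, which away from 1/2 correspond exactly to the
  Jordan eigenvalues.\<close>

locale good_axes = nonassoc_algebra scale mul
  for scale :: "'f::field \<Rightarrow> 'a::ab_group_add \<Rightarrow> 'a" (infixr \<open>*s\<close> 75)
    and mul :: "'a \<Rightarrow> 'a \<Rightarrow> 'a" (infixl \<open>\<cdot>\<close> 77) +
  fixes C :: "'a set"
  assumes two: "(2::'f) \<noteq> 0"
    and good_C: "a \<in> C \<Longrightarrow> good_axis a"
    and miyamoto_C: "a \<in> C \<Longrightarrow> b \<in> C \<Longrightarrow> p \<in> S a \<Longrightarrow> miyamoto a {p} b \<in> C"
    and homogeneous_C: "a \<in> C \<Longrightarrow> b \<in> C \<Longrightarrow> (q, q) \<in> S_circ b \<Longrightarrow> (q, q) \<in> S_circ a"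
    and span_good: "span C = UNIV"
begin

interpretation J: comm_algebra scale jordan
  by (rule jordan_comm_algebra[OF two])

definition avg :: "'f \<times> 'f \<Rightarrow> 'f" where
  "avg p = (fst p + snd p) / 2"

lemma avg_diag: "avg (l, l) = l"
  unfolding avg_def using two by (simp add: field_simps)

lemma two_neq_one: "(2::'f) \<noteq> 1"
proof
  assume "(2::'f) = 1"
  then have "1 + (1::'f) = 1 + 0"
    by (simp only: one_add_one add_0_right)
  then show False
    by (simp only: add_left_cancel one_neq_zero)
qed

section \<open>Eigenspaces and fusion rules for the Jordan product\<close>

context
  fixes a assumes aC: "a \<in> C"
begin

lemma ga: "good_axis a"
  by (rule good_C[OF aC])

text \<open>\<open>nonsymmetric_eigenvalues\<close> treats elements of \<open>C\<close>; if it
  failed for \<open>p\<close>, the linear map taking the \<open>p\<close>-part would vanish on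
  \<open>C\<close> and hence on its span.\<close>

lemma component_nonsymmetric:
  assumes "component a z p \<noteq> 0" "fst p \<noteq> snd p"
  shows "fst p + snd p = 1"
proof (rule ccontr)
  assume no: "\<not> ?thesis"
  have "span C \<subseteq> {z. component a z p = 0}"
  proof (rule span_minimal)
    show "C \<subseteq> {z. component a z p = 0}"
      using nonsymmetric_eigenvalues[OF ga good_C _ assms(2)] no by blast
    show "subspace {z. component a z p = 0}"
      by (rule subspaceI) (simp_all add: component_zero[OF ga] component_add[OF ga] component_scale[OF ga])
  qed
  then show False
    using assms(1) unfolding span_good by blast
qed

text \<open>An index with unequal entries has sum 1 and so average 1/2. Every other average, in
  particular 0 or 1, comes from a unique diagonal index.\<close>

lemma component_avg:
  assumes "component a z p \<noteq> 0"
  shows "avg p = 1 \<Longrightarrow> p = (1, 1)" "avg p = 0 \<Longrightarrow> p = (0, 0)" "2 * avg p \<noteq> 1 \<Longrightarrow> p = (avg p, avg p)"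
proof -
  have "2 * avg p = fst p + snd p"
    unfolding avg_def using two by simp
  then have half: "2 * avg p = 1" if "fst p \<noteq> snd p"
    using component_nonsymmetric[OF assms that] by simp
  have diag: "p = (avg p, avg p)" if "2 * avg p \<noteq> 1"
    using half that avg_diag[of "fst p"] by (metis prod.collapse)
  then show "2 * avg p \<noteq> 1 \<Longrightarrow> p = (avg p, avg p)" .
  have "(2::'f) * 1 \<noteq> 1"
    using two_neq_one by simp
  then show "avg p = 1 \<Longrightarrow> p = (1, 1)"
    using diag by metis
  show "avg p = 0 \<Longrightarrow> p = (0, 0)"
    using diag by (metis mult_zero_right zero_neq_one)
qed

lemma jordan_eig2: "z \<in> eig2 a p \<Longrightarrow> z \<in> J.eig a (avg p)"
  unfolding J.mem_eig_iff jordan_def avg_def by (simp add: mem_eig2 scale_left_distrib[symmetric])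

lemma jordan_eig_avg:
  assumes "z \<in> J.eig a l" "component a z p \<noteq> 0"
  shows "avg p = l"
proof -
  have "component a (jordan a z) p = avg p *s component a z p"
    unfolding jordan_def avg_def
    by (simp add: component_scale[OF ga] component_add[OF ga] component_mul_axis[OF ga] scale_left_distrib[symmetric])
  then have "avg p *s component a z p = l *s component a z p"
    using assms(1) by (simp only: J.mem_eig_iff component_scale[OF ga])
  then show ?thesis
    using assms(2) by (simp only: scale_cancel_right simp_thms)
qed

lemma jordan_eig_single:
  assumes z: "z \<in> J.eig a l" and single: "\<And>p. component a z p \<noteq> 0 \<Longrightarrow> avg p = l \<Longrightarrow> p = (l, l)"
  shows "z \<in> eig a l"
proof -
  have "(\<Sum>p\<in>{(l, l)}. component a z p) = z"
    using single jordan_eig_avg[OF z] by (intro sum_component_superset[OF ga]) auto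
  then show ?thesis
    using component_mem[OF ga, of z "(l, l)"] by (simp add: eig_def)
qed

lemma jordan_eig_one: "J.eig a 1 = eig a 1"
  and jordan_eig_zero: "J.eig a 0 = eig a 0"
proof -
  have sub: "eig a l \<subseteq> J.eig a l" for l
    using jordan_eig2[of _ "(l, l)"] by (auto simp: eig_def avg_diag)
  have "z \<in> eig a 1" if "z \<in> J.eig a 1" for z
    using that by (rule jordan_eig_single) (rule component_avg(1))
  with sub show "J.eig a 1 = eig a 1" by blast
  have "z \<in> eig a 0" if "z \<in> J.eig a 0" for z
    using that by (rule jordan_eig_single) (rule component_avg(2))
  with sub show "J.eig a 0 = eig a 0" by blast
qed

lemma jordan_eig01: "J.eig01 a = eig01 a"
  unfolding J.eig01_def eig01_def jordan_eig_one jordan_eig_zero by (rule refl)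

lemma jordan_mem: "x \<cdot> y \<in> V \<Longrightarrow> y \<cdot> x \<in> V \<Longrightarrow> subspace V \<Longrightarrow> jordan x y \<in> V"
  unfolding jordan_def by (intro subspace_scale subspace_add)

lemma jordan_odd:
  assumes z: "z \<in> J.eig a l" and l: "l \<noteq> 0" "l \<noteq> 1" and p: "component a z p \<noteq> 0"
  shows "p \<in> S a" "avg p = l"
proof -
  show avg: "avg p = l"
    by (rule jordan_eig_avg[OF z p])
  have "p \<in> axis_index a"
    using component_outside[OF ga] p by blast
  moreover have "p \<noteq> (1, 1)" "p \<noteq> (0, 0)"
    using avg l avg_diag by auto
  ultimately show "p \<in> S a" by blast
qed

lemma jordan_sum_right:
  assumes "\<And>p. component a y p \<noteq> 0 \<Longrightarrow> jordan x (component a y p) \<in> V" "subspace V"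
  shows "jordan x y \<in> V"
proof -
  have "jordan x (\<Sum>p | component a y p \<noteq> 0. component a y p) \<in> V"
    unfolding J.mul_sum_right using assms by (intro subspace_sum) auto
  then show ?thesis
    by (simp only: sum_component[OF ga])
qed

lemma jordan_fusion_0_l:
  assumes x: "x \<in> eig a 0" and y: "y \<in> J.eig a l" and l: "l \<noteq> 0" "l \<noteq> 1"
  shows "jordan x y \<in> J.eig a l"
proof (rule jordan_sum_right[OF _ J.subspace_eig])
  fix p assume p: "component a y p \<noteq> 0"
  note pS = jordan_odd[OF y l p]
  have "x \<in> eig01 a"
    using x eig_le_eig01 by blast
  then have "jordan x (component a y p) \<in> eig2 a p"
    using good_fusion_even[OF ga pS(1) _ component_mem[OF ga]] by (intro jordan_mem subspace_eig2) auto
  then show "jordan x (component a y p) \<in> J.eig a l"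
    using jordan_eig2 pS(2) by blast
qed

text \<open>A Jordan eigenspace may combine several two-sided ones, so both factors are split first.
  Pieces with equal index have even products; pieces with different index annihilate each
  other.\<close>

lemma jordan_fusion_same:
  assumes x: "x \<in> J.eig a l" and y: "y \<in> J.eig a l" and l: "l \<noteq> 0" "l \<noteq> 1"
  shows "jordan x y \<in> eig01 a"
proof (rule jordan_sum_right[OF _ subspace_eig01])
  fix p assume p: "component a y p \<noteq> 0"
  let ?y = "component a y p"
  have "jordan ?y x \<in> eig01 a"
  proof (rule jordan_sum_right[OF _ subspace_eig01])
    fix q assume q: "component a x q \<noteq> 0"
    note pq = jordan_odd(1)[OF y l p] jordan_odd(1)[OF x l q]
    show "jordan ?y (component a x q) \<in> eig01 a"
    proof (cases "p = q")
      case True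
      then show ?thesis
        using good_fusion_same[OF ga pq(1)] component_mem[OF ga] by (intro jordan_mem subspace_eig01) auto
    next
      case False
      then show ?thesis
        using good_fusion_different[OF ga pq(1,2) _ component_mem[OF ga] component_mem[OF ga]]
          good_fusion_different[OF ga pq(2,1) _ component_mem[OF ga] component_mem[OF ga]]
          subspace_0[OF subspace_eig01, of a]
        by (simp add: jordan_def)
    qed
  qed
  then show "jordan x ?y \<in> eig01 a"
    by (simp only: J.mul_commute[of ?y x])
qed

lemma jordan_fusion_different:
  assumes x: "x \<in> J.eig a l" and y: "y \<in> J.eig a k" and l: "l \<noteq> 0" "l \<noteq> 1" and k: "k \<noteq> 0" "k \<noteq> 1" "k \<noteq> l"
  shows "jordan x y = 0"
proof -
  have "jordan x y \<in> {0}"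
  proof (rule jordan_sum_right[OF _ subspace_single_0])
    fix p assume p: "component a y p \<noteq> 0"
    let ?y = "component a y p"
    have "jordan ?y x \<in> {0}"
    proof (rule jordan_sum_right[OF _ subspace_single_0])
      fix q assume q: "component a x q \<noteq> 0"
      note pq = jordan_odd[OF y k(1,2) p] jordan_odd[OF x l q]
      have "p \<noteq> q"
        using pq k(3) by auto
      then show "jordan ?y (component a x q) \<in> {0}"
        using good_fusion_different[OF ga pq(1,3) _ component_mem[OF ga] component_mem[OF ga]]
          good_fusion_different[OF ga pq(3,1) _ component_mem[OF ga] component_mem[OF ga]]
        by (simp add: jordan_def)
    qed
    then show "jordan x ?y \<in> {0}"
      by (simp only: J.mul_commute[of ?y x])
  qed
  then show ?thesis by simp
qed

lemma jordan_direct_sum: "is_direct_sum UNIV (J.eig a)"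
proof (rule is_direct_sumI)
  show "\<exists>M g. finite M \<and> M \<subseteq> UNIV \<and> (\<forall>l\<in>M. g l \<in> J.eig a l) \<and> x = (\<Sum>l\<in>M. g l)" for x
  proof -
    define P where "P = {p. component a x p \<noteq> 0}"
    define g where "g l = (\<Sum>p\<in>{p \<in> P. avg p = l}. component a x p)" for l
    have fin: "finite P"
      unfolding P_def by (rule finite_component[OF ga])
    have "g l \<in> J.eig a l" for l
      unfolding g_def
    proof (rule subspace_sum[OF J.subspace_eig])
      fix p assume "p \<in> {p \<in> P. avg p = l}"
      then show "component a x p \<in> J.eig a l"
        using jordan_eig2[OF component_mem[OF ga], of x p] by simp
    qed
    then have mem: "\<forall>l\<in>avg ` P. g l \<in> J.eig a l" by blast
    have "(\<Sum>p\<in>P. component a x p) = (\<Sum>l\<in>avg ` P. g l)"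
      unfolding g_def by (rule sum.image_gen[OF fin])
    moreover have "(\<Sum>p\<in>P. component a x p) = x"
      unfolding P_def by (rule sum_component[OF ga])
    ultimately have "x = (\<Sum>l\<in>avg ` P. g l)"
      by (rule trans[OF sym, rotated])
    then show ?thesis
      using finite_imageI[OF fin, of avg] mem by (metis subset_UNIV)
  qed
  show "g i = 0" if M: "finite M" "\<forall>l\<in>M. g l \<in> J.eig a l" "(\<Sum>l\<in>M. g l) = 0" "i \<in> M" for M g i
  proof -
    have "\<forall>l\<in>M. g l \<in> {0}"
      by (rule eigen_sum_mem[OF J.linear_mul_left[of a] M(1)]) (use M(2,3) in \<open>simp_all add: J.mem_eig_iff\<close>)
    then show ?thesis
      using M(4) by blast
  qed
qed (rule J.subspace_eig)

lemma jordan_fusion_axis: "J.fusion_axis a"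
  unfolding J.fusion_axis_def
proof (intro conjI allI impI ballI)
  show "a \<noteq> 0" "is_direct_sum UNIV (J.eig a)" "J.eig a 1 = range (\<lambda>c. c *s a)"
    using good_nonzero[OF ga] good_eig_one[OF ga] by (simp_all add: jordan_direct_sum jordan_eig_one)
  show "jordan x y \<in> J.eig01 a" if "x \<in> J.eig a 0" "y \<in> J.eig a 0" for x y
  proof -
    have "x \<in> eig01 a" "y \<in> eig01 a"
      using that eig_le_eig01 unfolding jordan_eig_zero by blast+
    then show ?thesis
      using good_eig01[OF ga] unfolding jordan_eig01 subalgebra_def by (intro jordan_mem) auto
  qed
next
  fix l :: 'f assume l: "l \<noteq> 0 \<and> l \<noteq> 1"
  show "jordan x y \<in> J.eig a l" if "x \<in> J.eig a 0" "y \<in> J.eig a l" for x y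
    using jordan_fusion_0_l that l unfolding jordan_eig_zero by blast
  show "jordan x y \<in> J.eig01 a" if "x \<in> J.eig a l" "y \<in> J.eig a l" for x y
    using jordan_fusion_same that l unfolding jordan_eig01 by blast
  show "jordan x y = 0" if "k \<noteq> 0 \<and> k \<noteq> 1 \<and> k \<noteq> l" "x \<in> J.eig a l" "y \<in> J.eig a k" for k x y
    using jordan_fusion_different that l by blast
qed

lemma jordan_pr:
  assumes "\<And>p z. component a z p \<noteq> 0 \<Longrightarrow> avg p = l \<Longrightarrow> p = (l, l)"
  shows "J.pr a l z = component a z (l, l)"
proof (induction z rule: component_induct[OF ga])
  case (1 p z)
  show ?case
  proof (cases "z = 0")
    case False
    then have "avg p = l \<longleftrightarrow> p = (l, l)"
      using assms[of z p] avg_diag by (auto simp: component_of_mem[OF ga 1(2)])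
    then show ?thesis
      unfolding J.pr_of_mem[OF jordan_fusion_axis jordan_eig2[OF 1(2)]] component_of_mem[OF ga 1(2)] by auto
  qed (simp add: J.pr_zero[OF jordan_fusion_axis] component_zero[OF ga])
qed (simp add: J.pr_add[OF jordan_fusion_axis] component_add[OF ga])

lemma jordan_coef: "J.coef a z = phi a z"
  using jordan_pr[of 1 z] component_avg(1) J.pr_one[OF jordan_fusion_axis, of z] component_one[OF ga, of z]
    good_nonzero[OF ga] by simp

end

text \<open>The original subalgebra is closed under the Jordan product, hence contains the Jordan
  one, while the 0-eigenspaces agree. So the bound coming from special axes carries over.\<close>

lemma jordan_thin:
  assumes a: "a \<in> C" and b: "b \<in> C"
  shows "J.thin a b"
  unfolding J.thin_def
proof (intro ballI impI)
  have "J.generated_subalgebra {b, a} \<subseteq> generated_subalgebra {a, b}"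
  proof (rule J.generated_minimal)
    show "J.subalgebra (generated_subalgebra {a, b})"
      unfolding J.subalgebra_def
      by (intro conjI ballI subspace_generated jordan_mem[OF a] mul_mem_generated)
  qed (use generated_superset in blast)
  then show "\<exists>c. u = c *s v"
    if "u \<in> J.generated_subalgebra {b, a} \<inter> J.eig a 0" "v \<in> J.generated_subalgebra {b, a} \<inter> J.eig a 0" "v \<noteq> 0" for u v
    using that good_thin[OF good_C[OF a] good_idem[OF good_C[OF b]], of u v] unfolding jordan_eig_zero[OF a] by blast
qed

lemma phi_symmetric:
  assumes "a \<in> C" "b \<in> C"
  shows "phi a b = phi b a"
proof -
  interpret J: axial scale jordan C
  proof unfold_locales
    show "J.fusion_axis a" if "a \<in> C" for a
      by (rule jordan_fusion_axis[OF that])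
    show "J.thin a b" if "a \<in> C" "b \<in> C" for a b
      by (rule jordan_thin[OF that])
    show "b - 2 *s J.pr a q b \<in> C" if a: "a \<in> C" and b: "b \<in> C" and q: "q \<noteq> 0" "q \<noteq> 1" "2 * q \<noteq> 1" for a b q
    proof -
      \<comment> \<open>Away from 1/2 the Jordan projection is the single component at
        \<open>(q, q)\<close>. The reflection is therefore a Miyamoto map, or fixes \<open>b\<close>
        if \<open>(q, q)\<close> is not an index of \<open>a\<close>.\<close>
      have pr: "J.pr a q b = component a b (q, q)"
        using component_avg(3)[OF a] q(3) by (intro jordan_pr[OF a]) metis
      show ?thesis
      proof (cases "(q, q) \<in> S a")
        case True
        then show ?thesis
          using miyamoto_C[OF a b] miyamoto_singleton[OF good_C[OF a]] unfolding pr by metis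
      next
        case False
        then show ?thesis
          unfolding pr using b q component_outside[OF good_C[OF a], of "(q, q)" b] by simp
      qed
    qed
    show "J.eig a q \<noteq> {0}" if a: "a \<in> C" and b: "b \<in> C" and q: "q \<noteq> 0" "q \<noteq> 1" "2 * q \<noteq> 1" and ne: "J.eig b q \<noteq> {0}"
      for a b q
    proof -
      obtain z where z: "z \<in> J.eig b q" "z \<noteq> 0"
        using ne subspace_0[OF J.subspace_eig, of b q] by blast
      have z': "z \<in> eig2 b (q, q)"
        using jordan_eig_single[OF b z(1)] component_avg(3)[OF b] q(3) unfolding eig_def by metis
      then have "(q, q) \<in> S b"
        using eig2_nonzero_index z(2) q by blast
      then have "(q, q) \<in> S_circ b"
        using z' z(2) by (auto simp: S_circ_def)
      then have "(q, q) \<in> S_circ a"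
        by (rule homogeneous_C[OF a b])
      then obtain w where "w \<in> eig2 a (q, q)" "w \<noteq> 0"
        using subspace_0[OF subspace_eig2, of a "(q, q)"] unfolding S_circ_def by blast
      then show ?thesis
        using jordan_eig2[OF a, of w "(q, q)"] by (auto simp: avg_diag)
    qed
  qed (rule span_good)
  show ?thesis
    using J.coef_symmetric[OF assms] jordan_coef assms by simp
qed

end

section \<open>The Frobenius form\<close>

context good_axes
begin

lemma phi_linear:
  assumes "a \<in> C"
  shows "Vector_Spaces.linear scale (*) (phi a)"
  unfolding Vector_Spaces.linear_iff
  using vector_space_axioms phi_add[OF good_C[OF assms]] phi_scale[OF good_C[OF assms]]
  by (simp add: vector_space_def algebra_simps)

lemma linear_ext:
  assumes f: "Vector_Spaces.linear scale (*) f" and g: "Vector_Spaces.linear scale (*) g"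
    and eq: "\<And>x. x \<in> D \<Longrightarrow> f x = g x" and D: "span D = UNIV"
  shows "f x = g x"
proof -
  have "x \<in> span D"
    unfolding D by simp
  then show ?thesis
    using f g eq unfolding Vector_Spaces.linear_iff
    by (induction x rule: span_induct_alt) (metis scale_zero_left mult_zero_left, metis)
qed

text \<open>A basis \<open>D\<close> is chosen inside \<open>C\<close>, and the functionals
  \<open>phi d\<close> are extended linearly in the first argument. Symmetry of \<open>phi\<close>
  shows that the second argument also gives \<open>phi c\<close> for every \<open>c\<close> in
  \<open>C\<close>, which makes the form symmetric and independent of the choice of
  \<open>D\<close>.\<close>

lemma form_exists:
  "\<exists>B. (\<forall>x. Vector_Spaces.linear scale (*) (\<lambda>y. B x y)) \<and> (\<forall>y. Vector_Spaces.linear scale (*) (\<lambda>x. B x y)) \<and>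
    (\<forall>x y. B x y = B y x) \<and> (\<forall>a\<in>C. \<forall>y. B a y = phi a y)"
proof -
  have vs: "vector_space ((*) :: 'f \<Rightarrow> 'f \<Rightarrow> 'f)"
    by unfold_locales (simp_all add: algebra_simps)
  interpret VP: vector_space_pair scale "(*) :: 'f \<Rightarrow> 'f \<Rightarrow> 'f"
    by (intro vector_space_pair.intro vector_space_axioms vs)
  obtain D where D: "D \<subseteq> C" "independent D" "C \<subseteq> span D"
    by (rule maximal_independent_subset[of C])
  have span_D: "span D = UNIV"
    using span_mono[OF D(3)] span_good by (simp add: span_span top.extremum_unique)
  define B where "B x y = VP.construct D (\<lambda>d. phi d y) x" for x y
  have lin1: "Vector_Spaces.linear scale (*) (\<lambda>x. B x y)" for y
    unfolding B_def by (rule VP.linear_construct[OF D(2)])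
  have D_phi: "B d y = phi d y" if "d \<in> D" for d y
    unfolding B_def by (rule VP.construct_basis[OF D(2) that])
  have C_phi: "B x c = phi c x" if c: "c \<in> C" for x c
  proof (rule linear_ext[OF lin1 phi_linear[OF c] _ span_D])
    show "B d c = phi c d" if "d \<in> D" for d
      using D_phi[OF that] phi_symmetric[of d c] that D(1) c by auto
  qed
  have lin2: "Vector_Spaces.linear scale (*) (\<lambda>y. B x y)" for x
  proof -
    have "x \<in> span D"
      unfolding span_D by simp
    then show ?thesis
    proof (induction x rule: span_induct_alt)
      case base
      have "B 0 y = 0" for y
        using VP.linear_0[OF lin1] .
      then show ?case
        by (simp add: VP.linear_zero)
    next
      case (step c d x)
      have "B (c *s d + x) y = c * phi d y + B x y" for y
        using lin1[of y] D_phi[OF step(1)] unfolding Vector_Spaces.linear_iff by simp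
      moreover have "d \<in> C"
        using step(1) D(1) by blast
      ultimately show ?case
        using VP.linear_compose_add[OF VP.linear_compose_scale_right[OF phi_linear] step(2), of d c] by simp
    qed
  qed
  have phi: "B a y = phi a y" if a: "a \<in> C" for a y
  proof (rule linear_ext[OF lin2 phi_linear[OF a] _ span_good])
    show "B a c = phi a c" if "c \<in> C" for c
      using C_phi[OF that] phi_symmetric[OF a that] by simp
  qed
  have "B x y = B y x" for x y
  proof (rule linear_ext[OF lin1 lin2 _ span_good])
    show "B a y = B y a" if "a \<in> C" for a
      using phi[OF that] C_phi[OF that] by simp
  qed
  then show ?thesis
    using lin1 lin2 phi by blast
qed

theorem frobenius_form_exists:
  "\<exists>B. frobenius_form B \<and> (\<forall>a\<in>C. \<forall>y. B a y = phi a y) \<and> (\<forall>x y z. B (x \<cdot> y) z = B (y \<cdot> x) z)"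
proof -
  obtain B where lin_right: "\<And>x. Vector_Spaces.linear scale (*) (\<lambda>y. B x y)"
    and lin_left: "\<And>y. Vector_Spaces.linear scale (*) (\<lambda>x. B x y)"
    and sym: "\<And>x y. B x y = B y x" and phi: "\<And>a y. a \<in> C \<Longrightarrow> B a y = phi a y"
    using form_exists by blast
  have add: "B (x + y) z = B x z + B y z" "B z (x + y) = B z x + B z y"
    and scale: "B (c *s x) z = c * B x z" "B z (c *s x) = c * B z x" for x y z c
    using lin_left[of z] lin_right[of z] unfolding Vector_Spaces.linear_iff by blast+
  have zero: "B 0 z = 0" "B z 0 = 0" for z
    using scale(1)[of 0 0 z] scale(2)[of z 0 0] by simp_all
  have minus: "B (- x) z = - B x z" "B z (- x) = - B z x" for x z
    using add(1)[of x "- x" z] add(2)[of z x "- x"] by (simp_all add: zero minus_unique)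
  have diff: "B (x - y) z = B x z - B y z" "B z (x - y) = B z x - B z y" for x y z
    using add(1)[of x "- y" z] add(2)[of z x "- y"] by (simp_all add: minus)
  have span_C: "x \<in> span C" for x
    unfolding span_good by simp
  \<comment> \<open>For \<open>x\<close> in \<open>C\<close> this is
    \<open>phi (\<tau> x) (\<tau> y) = phi x y\<close> with \<open>\<tau> x\<close> again in
    \<open>C\<close>; the general case follows because \<open>C\<close> spans.\<close>
  have invariant: "B (miyamoto a {p} x) (miyamoto a {p} y) = B x y" if a: "a \<in> C" and p: "p \<in> S a" for a p x y
  proof -
    let ?\<tau> = "miyamoto a {p}"
    have aut: "algebra_automorphism ?\<tau>"
      using p by (intro miyamoto_automorphism[OF good_C[OF a]]) simp
    show ?thesis
      using span_C[of x]
    proof (induction x rule: span_induct_alt)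
      case base
      then show ?case
        by (simp add: automorphism_zero[OF aut] zero)
    next
      case (step c b x)
      have "B (?\<tau> b) (?\<tau> y) = B b y"
        using phi[OF step(1)] phi[OF miyamoto_C[OF a step(1) p]] automorphism_phi[OF aut good_C[OF step(1)]] by simp
      then show ?case
        using step(2) by (simp add: automorphism_add[OF aut] automorphism_scale[OF aut] add scale)
    qed
  qed
  \<comment> \<open>The Miyamoto map for \<open>{p}\<close> negates \<open>x\<close>, fixes
    \<open>y\<close> and preserves the form.\<close>
  have orth_odd: "B x y = 0" if a: "a \<in> C" and p: "p \<in> S a" and pq: "p \<noteq> q" and x: "x \<in> eig2 a p" and y: "y \<in> eig2 a q"
    for a p q x y
  proof -
    have "B x y = - B x y"
      using invariant[OF a p, of x y] pq
      by (simp add: miyamoto_of_mem[OF good_C[OF a] x] miyamoto_of_mem[OF good_C[OF a] y] minus)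
    then have "2 * B x y = 0"
      by (simp only: mult_2 eq_neg_iff_add_eq_0)
    then show ?thesis
      using two by simp
  qed
  have orth_01: "B x y = 0" if a: "a \<in> C" and x: "x \<in> eig2 a (1, 1)" and y: "y \<in> eig2 a (0, 0)" for a x y
  proof -
    obtain c where "x = c *s a"
      using x good_eig_one[OF good_C[OF a]] unfolding eig_def by auto
    moreover have "phi a y = 0"
      using component_of_mem[OF good_C[OF a] y] by (intro phi_eq[OF good_C[OF a]]) simp
    ultimately show ?thesis
      by (simp add: scale phi[OF a])
  qed
  have orth: "B x y = 0" if a: "a \<in> C" and pq: "p \<in> axis_index a" "q \<in> axis_index a" "p \<noteq> q"
    and x: "x \<in> eig2 a p" and y: "y \<in> eig2 a q" for a p q x y
  proof -
    consider "p \<in> S a" | "q \<in> S a" | "p = (1, 1)" "q = (0, 0)" | "p = (0, 0)" "q = (1, 1)"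
      using pq by blast
    then show ?thesis
    proof cases
      case 1
      then show ?thesis
        by (rule orth_odd[OF a _ pq(3) x y])
    next
      case 2
      then show ?thesis
        unfolding sym[of x y] by (rule orth_odd[OF a _ pq(3)[symmetric] y x])
    next
      case 3
      then show ?thesis
        using orth_01[OF a] x y by blast
    next
      case 4
      then show ?thesis
        unfolding sym[of x y] using orth_01[OF a] x y by blast
    qed
  qed
  \<comment> \<open>On joint eigenvectors both sides vanish for different indices by
    \<open>orth\<close>, and for equal indices they are the same multiple of
    \<open>B x y\<close>.\<close>
  have adjoint: "B (a \<cdot> x) y = B x (a \<cdot> y) \<and> B (x \<cdot> a) y = B x (y \<cdot> a)" if a: "a \<in> C" for a x y
  proof (induction x rule: component_induct[OF good_C[OF a]])
    case (1 p x)
    note x = this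
    show ?case
    proof (induction y rule: component_induct[OF good_C[OF a]])
      case (1 q y)
      then show ?case
        using x orth[OF a x(1) 1(1) _ x(2) 1(2)] by (cases "p = q") (simp_all add: mem_eig2 scale)
    qed (simp add: mul_simps add)
  qed (simp add: mul_simps add)
  text \<open>\<open>B (a b - b a) c\<close> is antisymmetric in \<open>a, b\<close> and symmetric in \<open>b, c\<close>, hence zero.\<close>
  have commutator_C: "B (a \<cdot> b) c = B (b \<cdot> a) c" if abc: "a \<in> C" "b \<in> C" "c \<in> C" for a b c
  proof -
    define F where "F x y z = B (x \<cdot> y) z - B (y \<cdot> x) z" for x y z
    have swap: "F x y z = F x z y" if "x \<in> C" for x y z
      using adjoint[OF that, of y z] sym[of y] by (simp add: F_def)
    have anti: "F x y z = - F y x z" for x y z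
      by (simp add: F_def)
    \<comment> \<open>Alternating the two symmetries: \<open>F a b c = F a c b = - F c a b = - F c b
      a = F b c a = F b a c = - F a b c\<close>.\<close>
    have "F a b c = - F a b c"
      using swap[OF abc(1)] swap[OF abc(2)] swap[OF abc(3)] anti by metis
    then have "2 * F a b c = 0"
      by (simp only: mult_2 eq_neg_iff_add_eq_0)
    then have "F a b c = 0"
      using two by simp
    then show ?thesis
      by (simp add: F_def)
  qed
  have commutator_1: "B (a \<cdot> b) z = B (b \<cdot> a) z" if "a \<in> C" "b \<in> C" for a b z
    using span_C[of z]
    by (induction z rule: span_induct_alt) (simp_all add: zero add scale commutator_C[OF that])
  have commutator_2: "B (a \<cdot> y) z = B (y \<cdot> a) z" if "a \<in> C" for a y z
    using span_C[of y]
    by (induction y rule: span_induct_alt) (simp_all add: zero mul_simps add scale commutator_1[OF that])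
  have commutator: "B (x \<cdot> y) z = B (y \<cdot> x) z" for x y z
    using span_C[of x]
  proof (induction x rule: span_induct_alt)
    case (step c a x)
    then show ?case
      using commutator_2[OF step(1), of y z] by (simp add: mul_simps add scale)
  qed (simp add: zero)
  have frobenius: "B (x \<cdot> y) z = B x (y \<cdot> z)" for x y z
    using span_C[of y]
  proof (induction y rule: span_induct_alt)
    case (step c a y)
    \<comment> \<open>The commutator identity moves \<open>a\<close> to the left of
      \<open>x\<close>, where multiplication by \<open>a\<close> is self-adjoint.\<close>
    have "B (x \<cdot> a) z = B x (a \<cdot> z)"
      using adjoint[OF step(1), of x z] commutator[of x a z] by simp
    then show ?case
      using step(2) by (simp add: mul_simps add scale)
  qed (simp add: zero)
  show ?thesis
    unfolding frobenius_form_def using lin_left lin_right sym phi commutator frobenius by blast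
qed

end

theorem theorem2p3:
  fixes scale :: "'f::field \<Rightarrow> 'a::ab_group_add \<Rightarrow> 'a"
    and mul :: "'a \<Rightarrow> 'a \<Rightarrow> 'a"
    and X :: "'a set"
  assumes alg: "nonassoc_algebra scale mul"
    and char_not_2: "CHAR('f) \<noteq> 2"
    and wPAJ: "nonassoc_algebra.weak_PAJ scale mul"
    and X_special: "\<forall>x\<in>X. nonassoc_algebra.special scale mul x"
    and X_homogeneous: "nonassoc_algebra.homogeneous scale mul X"
    and X_generates: "nonassoc_algebra.generated_subalgebra scale mul X = UNIV"
  shows "\<exists>B :: 'a \<Rightarrow> 'a \<Rightarrow> 'f.
           nonassoc_algebra.frobenius_form scale mul B \<and>
           (\<forall>a \<in> nonassoc_algebra.Cl scale mul X.
              (\<forall>y. B a y = nonassoc_algebra.phi scale mul a y) \<and> B a a = 1) \<and>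
           (\<forall>x y z. B (mul x y) z = B (mul y x) z)"
proof -
  interpret nonassoc_algebra scale mul
    by (rule alg)
  \<comment> \<open>If 2 = 0, the characteristic divides 2 without being 2, so it is 1, which is
    impossible in a field.\<close>
  have two: "(2::'f) \<noteq> 0"
  proof
    assume "(2::'f) = 0"
    then have "CHAR('f) dvd 2"
      by (metis of_nat_eq_0_iff_char_dvd of_nat_numeral)
    then have "CHAR('f) \<noteq> 0" "CHAR('f) \<le> 2"
      by (metis dvd_0_left zero_neq_numeral) (rule dvd_imp_le[OF \<open>CHAR('f) dvd 2\<close>], simp)
    then have "CHAR('f) = 1"
      using char_not_2 by linarith
    then have "(1::'f) = 0"
      using of_nat_CHAR[where 'a = 'f] by simp
    then show False by simp
  qed
  have good_X: "good_axis x" if "x \<in> X" for x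
    using X_special special_good that by blast
  interpret good_axes scale mul "Cl X"
  proof unfold_locales
    show "good_axis a" if "a \<in> Cl X" for a
      using Cl_good[OF good_X that] .
    show "miyamoto a {p} b \<in> Cl X" if "a \<in> Cl X" "b \<in> Cl X" "p \<in> S a" for a b p
      using that(3) by (intro Cl_miyamoto[OF good_X that(1,2)]) simp_all
    show "(q, q) \<in> S_circ a" if a: "a \<in> Cl X" and b: "b \<in> Cl X" and q: "(q, q) \<in> S_circ b" for a b q
    proof -
      obtain x where x: "x \<in> X" "S_circ a = S_circ x"
        using Cl_S_circ[OF good_X a] by blast
      obtain y where y: "y \<in> X" "S_circ b = S_circ y"
        using Cl_S_circ[OF good_X b] by blast
      \<comment> \<open>A diagonal index is unchanged by swapping its entries, so both alternatives
        of homogeneity give the same conclusion.\<close>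
      have "S_circ x = S_circ y \<or> S_circ x = S_circ_tilde y"
        using X_homogeneous x(1) y(1) unfolding homogeneous_def by blast
      then show ?thesis
        using q x(2) y(2) unfolding S_circ_tilde_def by auto
    qed
    show "span (Cl X) = UNIV"
      by (rule span_Cl[OF good_X two X_generates])
  qed (rule two)
  show ?thesis
    using frobenius_form_exists phi_self[OF good_C] by metis
qed

end
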